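(* The embedding $\Sigma\colon\mathbf{Mnd}_f(\mathbf{Set})\to[\mathbf F,\mathbf{Set}]\text{-}\mathbf{CAT}$ of finitary monads into (one-object) $[\mathbf F,\mathbf{Set}]$-categories fits into a triangle commuting to within pseudonatural equivalence: the (contravariant) functors to $\mathbf{CAT}$ $$\mathsf T\mapsto \mathsf T\text{-}\mathbf{Alg}\qquad\text{and}\qquad \mathsf T\mapsto[\mathbf F,\mathbf{Set}]\text{-}\mathbf{CAT}(\Sigma\mathsf T,\mathcal S)$$ on $\mathbf{Mnd}_f(\mathbf{Set})$ are pseudonaturally equivalent.
   Context: $\mathbf F$ is the full subcategory of $\mathbf{Set}$ on the finite cardinals. $[\mathbf F,\mathbf{Set}]$ is monoidal with unit the inclusion $I\colon\mathbf F\to\mathbf{Set}$ and tensor $(A\otimes B)(n)=\int^{m\in\mathbf F}Am\times(Bn)^m$; this corresponds to composition of finitary endofunctors of $\mathbf{Set}$. An $[\mathbf F,\mathbf{Set}]$-category is a category enriched in this monoidal category, with composition $\mathcal M(Y,Z)\otimes\mathcal M(X,Y)\to\mathcal M(X,Z)$, and $[\mathbf F,\mathbf{Set}]\text{-}\mathbf{CAT}$ is the $2$-category of (possibly large) $[\mathbf F,\mathbf{Set}]$-categories, enriched functors and enriched natural transformations. $\mathbf{Mnd}_f(\mathbf{Set})$ is the category of finitary monads on $\mathbf{Set}$ (those whose underlying endofunctor preserves filtered colimits) and monad morphisms. A finitary monad $\mathsf T$, restricted along $I$, is a monoid in $[\mathbf F,\mathbf{Set}]$, and $\Sigma\mathsf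 T$ is the corresponding one-object $[\mathbf F,\mathbf{Set}]$-category. $\mathsf T\text{-}\mathbf{Alg}$ is the category of $\mathsf T$-algebras; a monad morphism $\mathsf S\to\mathsf T$ induces a functor $\mathsf T\text{-}\mathbf{Alg}\to\mathsf S\text{-}\mathbf{Alg}$. $\mathcal S$ is the $[\mathbf F,\mathbf{Set}]$-category whose objects are sets, with hom-objects $\mathcal S(X,Y)=\mathbf{Set}(X^{(-)},Y)$, i.e. $\mathcal S_n(X,Y)=\mathbf{Set}(X^n,Y)$, composition $(g,f_1,\dots,f_m)\mapsto g\circ\langle f_1,\dots,f_m\rangle$ for $g\in\mathbf{Set}(Y^m,Z)$, $f_j\in\mathbf{Set}(X^n,Y)$, and identities $1_X\in\mathbf{Set}(X,X)$. *)

theory Defs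
  imports Main "HOL-Library.FuncSet"
begin

section \<open>The universe of sets\<close>

text \<open>
  HOL has no type of all sets, so the category of sets is taken relative to an arbitrary type
  whose elements form a model of second-order set theory: \<open>elts x\<close> is the collection of members
  of \<open>x\<close>, and the axioms are extensionality, separation, union, power set, replacement and
  infinity (pairing follows, choice is inherited from HOL).  Up to the axiom of foundation, which
  the category of sets does not see and which is not required, these are the axioms of a
  Grothendieck universe.  Sets of sets and the like, of arbitrary HOL type, play the role of
  possibly large classes.
\<close>

class set_universe =
  fixes elts :: "'a \<Rightarrow> 'a set"
  assumes elts_extensional: "inj elts"
    and elts_separation: "B \<subseteq> elts x \<Longrightarrow> B \<in> range elts"
    and elts_union: "(\<Union>y\<in>elts x. elts y) \<in> range elts"
    and elts_power: "{y. elts y \<subseteq> elts x} \<in> range elts"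
    and elts_replacement: "f ` elts x \<in> range elts"
    and elts_infinity: "\<exists>x. infinite (elts x)"

definition small :: "'u::set_universe set \<Rightarrow> bool" where
  "small A \<longleftrightarrow> A \<in> range elts"

definition vset :: "'u::set_universe set \<Rightarrow> 'u" where
  "vset A = inv elts A"

definition vpair :: "'u::set_universe \<Rightarrow> 'u \<Rightarrow> 'u" where
  "vpair x y = vset {vset {x}, vset {x, y}}"

text \<open>Functions as elements of the universe, by their graphs; \<open>vexp X Y\<close> is the set of functions
  from \<open>X\<close> to \<open>Y\<close>.\<close>

definition vlam :: "'u::set_universe \<Rightarrow> ('u \<Rightarrow> 'u) \<Rightarrow> 'u" where
  "vlam X f = vset ((\<lambda>x. vpair x (f x)) ` elts X)"

definition vapp :: "'u::set_universe \<Rightarrow> 'u \<Rightarrow> 'u" where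
  "vapp g x = (THE y. vpair x y \<in> elts g)"

definition vexp :: "'u::set_universe \<Rightarrow> 'u \<Rightarrow> 'u" where
  "vexp X Y = vset (vlam X ` (elts X \<rightarrow>\<^sub>E elts Y))"

primrec vnat :: "nat \<Rightarrow> 'u::set_universe" where
  "vnat 0 = vset {}"
| "vnat (Suc n) = vset (insert (vnat n) (elts (vnat n)))"


section \<open>Categories\<close>

text \<open>
  Hom-sets need not be disjoint, so composition \<open>Cmp C x y z g f\<close> of \<open>f : x \<rightarrow> y\<close> and
  \<open>g : y \<rightarrow> z\<close> takes the objects as arguments.  Functors and transformations are required to be
  extensional (undefined off their domain), so that HOL equality between them is the intended one.
\<close>

record ('o, 'm) category =
  Ob :: "'o set"
  Hom :: "'o \<Rightarrow> 'o \<Rightarrow> 'm set"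
  Idn :: "'o \<Rightarrow> 'm"
  Cmp :: "'o \<Rightarrow> 'o \<Rightarrow> 'o \<Rightarrow> 'm \<Rightarrow> 'm \<Rightarrow> 'm"

definition is_category :: "('o, 'm) category \<Rightarrow> bool" where
  "is_category C \<longleftrightarrow>
     (\<forall>x\<in>Ob C. Idn C x \<in> Hom C x x) \<and>
     (\<forall>x\<in>Ob C. \<forall>y\<in>Ob C. \<forall>z\<in>Ob C. \<forall>f\<in>Hom C x y. \<forall>g\<in>Hom C y z. Cmp C x y z g f \<in> Hom C x z) \<and>
     (\<forall>x\<in>Ob C. \<forall>y\<in>Ob C. \<forall>f\<in>Hom C x y.
        Cmp C x x y f (Idn C x) = f \<and> Cmp C x y y (Idn C y) f = f) \<and>
     (\<forall>w\<in>Ob C. \<forall>x\<in>Ob C. \<forall>y\<in>Ob C. \<forall>z\<in>Ob C.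
        \<forall>f\<in>Hom C w x. \<forall>g\<in>Hom C x y. \<forall>h\<in>Hom C y z.
          Cmp C w x z (Cmp C x y z h g) f = Cmp C w y z h (Cmp C w x y g f))"

definition op_cat :: "('o, 'm) category \<Rightarrow> ('o, 'm) category" where
  "op_cat C = \<lparr>Ob = Ob C, Hom = (\<lambda>x y. Hom C y x), Idn = Idn C,
               Cmp = (\<lambda>x y z g f. Cmp C z y x f g)\<rparr>"

definition inverse_arrows ::
    "('o, 'm, 'e) category_scheme \<Rightarrow> 'o \<Rightarrow> 'o \<Rightarrow> 'm \<Rightarrow> 'm \<Rightarrow> bool" where
  "inverse_arrows C x y f g \<longleftrightarrow>
     f \<in> Hom C x y \<and> g \<in> Hom C y x \<and> Cmp C x y x g f = Idn C x \<and> Cmp C y x y f g = Idn C y"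

definition is_iso :: "('o, 'm, 'e) category_scheme \<Rightarrow> 'o \<Rightarrow> 'o \<Rightarrow> 'm \<Rightarrow> bool" where
  "is_iso C x y f \<longleftrightarrow> (\<exists>g. inverse_arrows C x y f g)"

definition inv_arrow :: "('o, 'm, 'e) category_scheme \<Rightarrow> 'o \<Rightarrow> 'o \<Rightarrow> 'm \<Rightarrow> 'm" where
  "inv_arrow C x y f = (THE g. inverse_arrows C x y f g)"


section \<open>Functors and natural transformations\<close>

record ('o, 'm, 'p, 'n) ftr =
  FO :: "'o \<Rightarrow> 'p"
  FM :: "'o \<Rightarrow> 'o \<Rightarrow> 'm \<Rightarrow> 'n"

definition is_functor ::
    "('o, 'm) category \<Rightarrow> ('p, 'n) category \<Rightarrow> ('o, 'm, 'p, 'n) ftr \<Rightarrow> bool" where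
  "is_functor C D F \<longleftrightarrow>
     is_category C \<and> is_category D \<and>
     FO F \<in> Ob C \<rightarrow>\<^sub>E Ob D \<and>
     FM F \<in> (\<Pi>\<^sub>E x\<in>Ob C. \<Pi>\<^sub>E y\<in>Ob C. Hom C x y \<rightarrow>\<^sub>E Hom D (FO F x) (FO F y)) \<and>
     (\<forall>x\<in>Ob C. FM F x x (Idn C x) = Idn D (FO F x)) \<and>
     (\<forall>x\<in>Ob C. \<forall>y\<in>Ob C. \<forall>z\<in>Ob C. \<forall>f\<in>Hom C x y. \<forall>g\<in>Hom C y z.
        FM F x z (Cmp C x y z g f) =
        Cmp D (FO F x) (FO F y) (FO F z) (FM F y z g) (FM F x y f))"

definition fully_faithful ::
    "('o, 'm) category \<Rightarrow> ('p, 'n) category \<Rightarrow> ('o, 'm, 'p, 'n) ftr \<Rightarrow> bool" where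
  "fully_faithful C D F \<longleftrightarrow>
     (\<forall>x\<in>Ob C. \<forall>y\<in>Ob C. bij_betw (FM F x y) (Hom C x y) (Hom D (FO F x) (FO F y)))"

definition ftr_id :: "('o, 'm) category \<Rightarrow> ('o, 'm, 'o, 'm) ftr" where
  "ftr_id C = \<lparr>FO = (\<lambda>x\<in>Ob C. x), FM = (\<lambda>x\<in>Ob C. \<lambda>y\<in>Ob C. \<lambda>f\<in>Hom C x y. f)\<rparr>"

text \<open>\<open>ftr_comp C G F\<close> is \<open>G \<circ> F\<close>, where \<open>C\<close> is the domain of \<open>F\<close>.\<close>

definition ftr_comp ::
    "('o, 'm) category \<Rightarrow> ('p, 'n, 'q, 'k) ftr \<Rightarrow> ('o, 'm, 'p, 'n) ftr \<Rightarrow> ('o, 'm, 'q, 'k) ftr" where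
  "ftr_comp C G F =
     \<lparr>FO = (\<lambda>x\<in>Ob C. FO G (FO F x)),
      FM = (\<lambda>x\<in>Ob C. \<lambda>y\<in>Ob C. \<lambda>f\<in>Hom C x y. FM G (FO F x) (FO F y) (FM F x y f))\<rparr>"

definition op_ftr :: "('o, 'm) category \<Rightarrow> ('o, 'm, 'p, 'n) ftr \<Rightarrow> ('o, 'm, 'p, 'n) ftr" where
  "op_ftr C F = \<lparr>FO = FO F, FM = (\<lambda>x\<in>Ob C. \<lambda>y\<in>Ob C. FM F y x)\<rparr>"

definition nat_trans ::
    "('o, 'm) category \<Rightarrow> ('p, 'n) category \<Rightarrow> ('o, 'm, 'p, 'n) ftr \<Rightarrow> ('o, 'm, 'p, 'n) ftr
      \<Rightarrow> ('o \<Rightarrow> 'n) set" where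
  "nat_trans C D F G =
     {\<alpha>. \<alpha> \<in> (\<Pi>\<^sub>E x\<in>Ob C. Hom D (FO F x) (FO G x)) \<and>
         (\<forall>x\<in>Ob C. \<forall>y\<in>Ob C. \<forall>f\<in>Hom C x y.
            Cmp D (FO F x) (FO F y) (FO G y) (\<alpha> y) (FM F x y f) =
            Cmp D (FO F x) (FO G x) (FO G y) (FM G x y f) (\<alpha> x))}"

definition nat_iso ::
    "('o, 'm) category \<Rightarrow> ('p, 'n) category \<Rightarrow> ('o, 'm, 'p, 'n) ftr \<Rightarrow> ('o, 'm, 'p, 'n) ftr
      \<Rightarrow> ('o \<Rightarrow> 'n) \<Rightarrow> bool" where
  "nat_iso C D F G \<alpha> \<longleftrightarrow>
     \<alpha> \<in> nat_trans C D F G \<and> (\<forall>x\<in>Ob C. is_iso D (FO F x) (FO G x) (\<alpha> x))"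

definition fun_cat ::
    "('o, 'm) category \<Rightarrow> ('p, 'n) category \<Rightarrow> (('o, 'm, 'p, 'n) ftr, 'o \<Rightarrow> 'n) category" where
  "fun_cat C D =
     \<lparr>Ob = {F. is_functor C D F},
      Hom = nat_trans C D,
      Idn = (\<lambda>F. \<lambda>x\<in>Ob C. Idn D (FO F x)),
      Cmp = (\<lambda>F G H \<beta> \<alpha>. \<lambda>x\<in>Ob C. Cmp D (FO F x) (FO G x) (FO H x) (\<beta> x) (\<alpha> x))\<rparr>"

definition is_equivalence ::
    "('o, 'm) category \<Rightarrow> ('p, 'n) category \<Rightarrow> ('o, 'm, 'p, 'n) ftr \<Rightarrow> bool" where
  "is_equivalence C D E \<longleftrightarrow>
     is_functor C D E \<and>
     (\<exists>H \<eta> \<epsilon>. is_functor D C H \<and>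
        nat_iso C C (ftr_id C) (ftr_comp C H E) \<eta> \<and>
        nat_iso D D (ftr_comp D E H) (ftr_id D) \<epsilon>)"

definition CAT :: "(('o, 'm) category, ('o, 'm, 'o, 'm) ftr) category" where
  "CAT = \<lparr>Ob = {C. is_category C}, Hom = (\<lambda>C D. {F. is_functor C D F}),
          Idn = ftr_id, Cmp = (\<lambda>C D E G F. ftr_comp C G F)\<rparr>"


section \<open>Pseudonatural equivalence\<close>

text \<open>
  For functors \<open>P\<close>, \<open>Q\<close> from a category \<open>C\<close> to the 2-category of categories, a pseudonatural
  transformation has functors \<open>E x : P x \<rightarrow> Q x\<close> and natural isomorphisms
  \<open>\<theta> x y f : Q f \<circ> E x \<Rightarrow> E y \<circ> P f\<close>, coherent with identities and composition.  (There are no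
  non-identity 2-cells in \<open>C\<close>.)
\<close>

definition pseudonatural ::
    "('c, 'd) category
      \<Rightarrow> ('c, 'd, ('o, 'm) category, ('o, 'm, 'o, 'm) ftr) ftr
      \<Rightarrow> ('c, 'd, ('p, 'n) category, ('p, 'n, 'p, 'n) ftr) ftr
      \<Rightarrow> ('c \<Rightarrow> ('o, 'm, 'p, 'n) ftr) \<Rightarrow> ('c \<Rightarrow> 'c \<Rightarrow> 'd \<Rightarrow> 'o \<Rightarrow> 'n) \<Rightarrow> bool" where
  "pseudonatural C P Q E \<theta> \<longleftrightarrow>
     (\<forall>x\<in>Ob C. is_functor (FO P x) (FO Q x) (E x)) \<and>
     (\<forall>x\<in>Ob C. \<forall>y\<in>Ob C. \<forall>f\<in>Hom C x y.
        nat_iso (FO P x) (FO Q y)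
          (ftr_comp (FO P x) (FM Q x y f) (E x)) (ftr_comp (FO P x) (E y) (FM P x y f))
          (\<theta> x y f)) \<and>
     (\<forall>x\<in>Ob C. \<forall>a\<in>Ob (FO P x). \<theta> x x (Idn C x) a = Idn (FO Q x) (FO (E x) a)) \<and>
     (\<forall>x\<in>Ob C. \<forall>y\<in>Ob C. \<forall>z\<in>Ob C. \<forall>f\<in>Hom C x y. \<forall>g\<in>Hom C y z. \<forall>a\<in>Ob (FO P x).
        \<theta> x z (Cmp C x y z g f) a =
        Cmp (FO Q z)
          (FO (FM Q y z g) (FO (FM Q x y f) (FO (E x) a)))
          (FO (FM Q y z g) (FO (E y) (FO (FM P x y f) a)))
          (FO (E z) (FO (FM P y z g) (FO (FM P x y f) a)))
          (\<theta> y z g (FO (FM P x y f) a))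
          (FM (FM Q y z g) (FO (FM Q x y f) (FO (E x) a)) (FO (E y) (FO (FM P x y f) a))
             (\<theta> x y f a)))"

definition pseudonaturally_equivalent ::
    "('c, 'd) category
      \<Rightarrow> ('c, 'd, ('o, 'm) category, ('o, 'm, 'o, 'm) ftr) ftr
      \<Rightarrow> ('c, 'd, ('p, 'n) category, ('p, 'n, 'p, 'n) ftr) ftr \<Rightarrow> bool" where
  "pseudonaturally_equivalent C P Q \<longleftrightarrow>
     (\<exists>E \<theta>. pseudonatural C P Q E \<theta> \<and> (\<forall>x\<in>Ob C. is_equivalence (FO P x) (FO Q x) (E x)))"


section \<open>Filtered colimits\<close>

definition is_filtered :: "('o, 'm) category \<Rightarrow> bool" where
  "is_filtered J \<longleftrightarrow>
     is_category J \<and> Ob J \<noteq> {} \<and>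
     (\<forall>i\<in>Ob J. \<forall>j\<in>Ob J. \<exists>k\<in>Ob J. Hom J i k \<noteq> {} \<and> Hom J j k \<noteq> {}) \<and>
     (\<forall>i\<in>Ob J. \<forall>j\<in>Ob J. \<forall>f\<in>Hom J i j. \<forall>g\<in>Hom J i j.
        \<exists>k\<in>Ob J. \<exists>h\<in>Hom J j k. Cmp J i j k h f = Cmp J i j k h g)"

definition is_small_category :: "('u::set_universe, 'u) category \<Rightarrow> bool" where
  "is_small_category J \<longleftrightarrow>
     is_category J \<and> small (Ob J) \<and> (\<forall>i\<in>Ob J. \<forall>j\<in>Ob J. small (Hom J i j))"

definition is_cocone ::
    "('j, 'k) category \<Rightarrow> ('o, 'm) category \<Rightarrow> ('j, 'k, 'o, 'm) ftr \<Rightarrow> 'o \<Rightarrow> ('j \<Rightarrow> 'm) \<Rightarrow> bool" where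
  "is_cocone J C D c l \<longleftrightarrow>
     c \<in> Ob C \<and> l \<in> (\<Pi>\<^sub>E j\<in>Ob J. Hom C (FO D j) c) \<and>
     (\<forall>i\<in>Ob J. \<forall>j\<in>Ob J. \<forall>u\<in>Hom J i j. Cmp C (FO D i) (FO D j) c (l j) (FM D i j u) = l i)"

definition is_colimit ::
    "('j, 'k) category \<Rightarrow> ('o, 'm) category \<Rightarrow> ('j, 'k, 'o, 'm) ftr \<Rightarrow> 'o \<Rightarrow> ('j \<Rightarrow> 'm) \<Rightarrow> bool" where
  "is_colimit J C D c l \<longleftrightarrow>
     is_cocone J C D c l \<and>
     (\<forall>d k. is_cocone J C D d k \<longrightarrow>
        (\<exists>!f. f \<in> Hom C c d \<and> (\<forall>j\<in>Ob J. Cmp C (FO D j) c d f (l j) = k j)))"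

definition preserves_filtered_colimits ::
    "('o, 'm) category \<Rightarrow> ('p, 'n) category \<Rightarrow> ('o, 'm, 'p, 'n) ftr \<Rightarrow> 'u::set_universe itself \<Rightarrow> bool"
  where
  "preserves_filtered_colimits C D T U \<longleftrightarrow>
     (\<forall>(J :: ('u, 'u) category) G c l.
        is_small_category J \<and> is_filtered J \<and> is_functor J C G \<and> is_colimit J C G c l \<longrightarrow>
        is_colimit J D (ftr_comp J T G) (FO T c)
          (\<lambda>j\<in>Ob J. FM T (FO G j) c (l j)))"


section \<open>Monads and their algebras\<close>

record ('o, 'm) monad =
  mnd_fun :: "('o, 'm, 'o, 'm) ftr"
  mnd_unit :: "'o \<Rightarrow> 'm"
  mnd_mult :: "'o \<Rightarrow> 'm"

definition is_monad :: "('o, 'm) category \<Rightarrow> ('o, 'm) monad \<Rightarrow> bool" where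
  "is_monad C M \<longleftrightarrow>
     (let T = mnd_fun M; T1 = FO T; T2 = (\<lambda>x. T1 (T1 x)); T3 = (\<lambda>x. T1 (T2 x));
          \<eta> = mnd_unit M; \<mu> = mnd_mult M in
      is_functor C C T \<and>
      \<eta> \<in> nat_trans C C (ftr_id C) T \<and>
      \<mu> \<in> nat_trans C C (ftr_comp C T T) T \<and>
      (\<forall>x\<in>Ob C.
         Cmp C (T1 x) (T2 x) (T1 x) (\<mu> x) (\<eta> (T1 x)) = Idn C (T1 x) \<and>
         Cmp C (T1 x) (T2 x) (T1 x) (\<mu> x) (FM T x (T1 x) (\<eta> x)) = Idn C (T1 x) \<and>
         Cmp C (T3 x) (T2 x) (T1 x) (\<mu> x) (\<mu> (T1 x)) =
         Cmp C (T3 x) (T2 x) (T1 x) (\<mu> x) (FM T (T2 x) (T1 x) (\<mu> x))))"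

definition monad_morphisms ::
    "('o, 'm) category \<Rightarrow> ('o, 'm) monad \<Rightarrow> ('o, 'm) monad \<Rightarrow> ('o \<Rightarrow> 'm) set" where
  "monad_morphisms C M N =
     (let S = mnd_fun M; T = mnd_fun N in
      {\<phi>. \<phi> \<in> nat_trans C C S T \<and>
          (\<forall>x\<in>Ob C.
             Cmp C x (FO S x) (FO T x) (\<phi> x) (mnd_unit M x) = mnd_unit N x \<and>
             Cmp C (FO S (FO S x)) (FO S x) (FO T x) (\<phi> x) (mnd_mult M x) =
             Cmp C (FO S (FO S x)) (FO T (FO T x)) (FO T x) (mnd_mult N x)
               (Cmp C (FO S (FO S x)) (FO S (FO T x)) (FO T (FO T x))
                  (\<phi> (FO T x)) (FM S (FO S x) (FO T x) (\<phi> x))))})"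

definition Alg :: "('o, 'm) category \<Rightarrow> ('o, 'm) monad \<Rightarrow> ('o \<times> 'm, 'm) category" where
  "Alg C M =
     (let T = mnd_fun M in
      \<lparr>Ob = {(x, a). x \<in> Ob C \<and> a \<in> Hom C (FO T x) x \<and>
               Cmp C x (FO T x) x a (mnd_unit M x) = Idn C x \<and>
               Cmp C (FO T (FO T x)) (FO T x) x a (mnd_mult M x) =
               Cmp C (FO T (FO T x)) (FO T x) x a (FM T (FO T x) x a)},
       Hom = (\<lambda>(x, a) (y, b). {f \<in> Hom C x y.
               Cmp C (FO T x) x y f a = Cmp C (FO T x) (FO T y) y b (FM T x y f)}),
       Idn = (\<lambda>(x, a). Idn C x),
       Cmp = (\<lambda>(x, a) (y, b) (z, c) g f. Cmp C x y z g f)\<rparr>)"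

text \<open>The functor from \<open>N\<close>-algebras to \<open>M\<close>-algebras induced by \<open>\<phi> : M \<rightarrow> N\<close>.\<close>

definition alg_pullback ::
    "('o, 'm) category \<Rightarrow> ('o, 'm) monad \<Rightarrow> ('o, 'm) monad \<Rightarrow> ('o \<Rightarrow> 'm)
      \<Rightarrow> ('o \<times> 'm, 'm, 'o \<times> 'm, 'm) ftr" where
  "alg_pullback C M N \<phi> =
     \<lparr>FO = (\<lambda>(x, a)\<in>Ob (Alg C N).
              (x, Cmp C (FO (mnd_fun M) x) (FO (mnd_fun N) x) x a (\<phi> x))),
      FM = (\<lambda>A\<in>Ob (Alg C N). \<lambda>B\<in>Ob (Alg C N). \<lambda>f\<in>Hom (Alg C N) A B. f)\<rparr>"


section \<open>Categories enriched in a monoidal category\<close>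

text \<open>\<open>TM V A A' B B' f g\<close> is the tensor product of \<open>f : A \<rightarrow> A'\<close> and \<open>g : B \<rightarrow> B'\<close>;
  \<open>Asc V A B C : (A \<otimes> B) \<otimes> C \<rightarrow> A \<otimes> (B \<otimes> C)\<close>, \<open>Lun V A : I \<otimes> A \<rightarrow> A\<close> and
  \<open>Run V A : A \<otimes> I \<rightarrow> A\<close>.\<close>

record ('o, 'm) monoidal = "('o, 'm) category" +
  Unt :: "'o"
  TO :: "'o \<Rightarrow> 'o \<Rightarrow> 'o"
  TM :: "'o \<Rightarrow> 'o \<Rightarrow> 'o \<Rightarrow> 'o \<Rightarrow> 'm \<Rightarrow> 'm \<Rightarrow> 'm"
  Asc :: "'o \<Rightarrow> 'o \<Rightarrow> 'o \<Rightarrow> 'm"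
  Lun :: "'o \<Rightarrow> 'm"
  Run :: "'o \<Rightarrow> 'm"

text \<open>\<open>VCmp K x y z : K(y, z) \<otimes> K(x, y) \<rightarrow> K(x, z)\<close>.\<close>

record ('x, 'o, 'm) vcat =
  VOb :: "'x set"
  VHom :: "'x \<Rightarrow> 'x \<Rightarrow> 'o"
  VIdn :: "'x \<Rightarrow> 'm"
  VCmp :: "'x \<Rightarrow> 'x \<Rightarrow> 'x \<Rightarrow> 'm"

definition is_vcat :: "('o, 'm) monoidal \<Rightarrow> ('x, 'o, 'm) vcat \<Rightarrow> bool" where
  "is_vcat V K \<longleftrightarrow>
     (let H = VHom K; T = TO V; I = Unt V in
      (\<forall>x\<in>VOb K. \<forall>y\<in>VOb K. H x y \<in> Ob V) \<and>
      (\<forall>x\<in>VOb K. VIdn K x \<in> Hom V I (H x x)) \<and>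
      (\<forall>x\<in>VOb K. \<forall>y\<in>VOb K. \<forall>z\<in>VOb K. VCmp K x y z \<in> Hom V (T (H y z) (H x y)) (H x z)) \<and>
      (\<forall>w\<in>VOb K. \<forall>x\<in>VOb K. \<forall>y\<in>VOb K. \<forall>z\<in>VOb K.
         Cmp V (T (T (H y z) (H x y)) (H w x)) (T (H x z) (H w x)) (H w z)
           (VCmp K w x z)
           (TM V (T (H y z) (H x y)) (H x z) (H w x) (H w x) (VCmp K x y z) (Idn V (H w x))) =
         Cmp V (T (T (H y z) (H x y)) (H w x)) (T (H y z) (T (H x y) (H w x))) (H w z)
           (Cmp V (T (H y z) (T (H x y) (H w x))) (T (H y z) (H w y)) (H w z)
              (VCmp K w y z)
              (TM V (H y z) (H y z) (T (H x y) (H w x)) (H w y) (Idn V (H y z)) (VCmp K w x y)))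
           (Asc V (H y z) (H x y) (H w x))) \<and>
      (\<forall>x\<in>VOb K. \<forall>y\<in>VOb K.
         Cmp V (T I (H x y)) (T (H y y) (H x y)) (H x y)
           (VCmp K x y y) (TM V I (H y y) (H x y) (H x y) (VIdn K y) (Idn V (H x y))) =
         Lun V (H x y) \<and>
         Cmp V (T (H x y) I) (T (H x y) (H x x)) (H x y)
           (VCmp K x x y) (TM V (H x y) (H x y) I (H x x) (Idn V (H x y)) (VIdn K x)) =
         Run V (H x y)))"

record ('x, 'y, 'm) vftr =
  VFO :: "'x \<Rightarrow> 'y"
  VFM :: "'x \<Rightarrow> 'x \<Rightarrow> 'm"

definition is_vfunctor ::
    "('o, 'm) monoidal \<Rightarrow> ('x, 'o, 'm) vcat \<Rightarrow> ('y, 'o, 'm) vcat \<Rightarrow> ('x, 'y, 'm) vftr \<Rightarrow> bool" where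
  "is_vfunctor V K L F \<longleftrightarrow>
     (let H = VHom K; H' = (\<lambda>x y. VHom L (VFO F x) (VFO F y)); T = TO V in
      VFO F \<in> VOb K \<rightarrow>\<^sub>E VOb L \<and>
      VFM F \<in> (\<Pi>\<^sub>E x\<in>VOb K. \<Pi>\<^sub>E y\<in>VOb K. Hom V (H x y) (H' x y)) \<and>
      (\<forall>x\<in>VOb K. Cmp V (Unt V) (H x x) (H' x x) (VFM F x x) (VIdn K x) = VIdn L (VFO F x)) \<and>
      (\<forall>x\<in>VOb K. \<forall>y\<in>VOb K. \<forall>z\<in>VOb K.
         Cmp V (T (H y z) (H x y)) (H x z) (H' x z) (VFM F x z) (VCmp K x y z) =
         Cmp V (T (H y z) (H x y)) (T (H' y z) (H' x y)) (H' x z)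
           (VCmp L (VFO F x) (VFO F y) (VFO F z))
           (TM V (H y z) (H' y z) (H x y) (H' x y) (VFM F y z) (VFM F x y))))"

definition vftr_id :: "('o, 'm) monoidal \<Rightarrow> ('x, 'o, 'm) vcat \<Rightarrow> ('x, 'x, 'm) vftr" where
  "vftr_id V K = \<lparr>VFO = (\<lambda>x\<in>VOb K. x), VFM = (\<lambda>x\<in>VOb K. \<lambda>y\<in>VOb K. Idn V (VHom K x y))\<rparr>"

definition vftr_comp ::
    "('o, 'm) monoidal \<Rightarrow> ('x, 'o, 'm) vcat \<Rightarrow> ('y, 'o, 'm) vcat \<Rightarrow> ('z, 'o, 'm) vcat
      \<Rightarrow> ('y, 'z, 'm) vftr \<Rightarrow> ('x, 'y, 'm) vftr \<Rightarrow> ('x, 'z, 'm) vftr" where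
  "vftr_comp V K L M G F =
     \<lparr>VFO = (\<lambda>x\<in>VOb K. VFO G (VFO F x)),
      VFM = (\<lambda>x\<in>VOb K. \<lambda>y\<in>VOb K.
               Cmp V (VHom K x y) (VHom L (VFO F x) (VFO F y))
                 (VHom M (VFO G (VFO F x)) (VFO G (VFO F y)))
                 (VFM G (VFO F x) (VFO F y)) (VFM F x y))\<rparr>"

definition VCAT :: "('o, 'm) monoidal \<Rightarrow> (('x, 'o, 'm) vcat, ('x, 'x, 'm) vftr) category" where
  "VCAT V = \<lparr>Ob = {K. is_vcat V K}, Hom = (\<lambda>K L. {F. is_vfunctor V K L F}),
             Idn = vftr_id V, Cmp = vftr_comp V\<rparr>"

text \<open>Enriched natural transformations \<open>\<alpha>\<^sub>x : I \<rightarrow> L(F x, G x)\<close>; the condition is the equality of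
  the two composites
  \<open>K(x, y) \<cong> I \<otimes> K(x, y) \<rightarrow> L(F y, G y) \<otimes> L(F x, F y) \<rightarrow> L(F x, G y)\<close> and
  \<open>K(x, y) \<cong> K(x, y) \<otimes> I \<rightarrow> L(G x, G y) \<otimes> L(F x, G x) \<rightarrow> L(F x, G y)\<close>.\<close>

definition vnat_trans ::
    "('o, 'm) monoidal \<Rightarrow> ('x, 'o, 'm) vcat \<Rightarrow> ('y, 'o, 'm) vcat
      \<Rightarrow> ('x, 'y, 'm) vftr \<Rightarrow> ('x, 'y, 'm) vftr \<Rightarrow> ('x \<Rightarrow> 'm) set" where
  "vnat_trans V K L F G =
     (let H = VHom K; f = VFO F; g = VFO G; L' = VHom L; T = TO V; I = Unt V in
      {\<alpha>. \<alpha> \<in> (\<Pi>\<^sub>E x\<in>VOb K. Hom V I (L' (f x) (g x))) \<and>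
          (\<forall>x\<in>VOb K. \<forall>y\<in>VOb K.
             Cmp V (H x y) (T (L' (f y) (g y)) (L' (f x) (f y))) (L' (f x) (g y))
               (VCmp L (f x) (f y) (g y))
               (Cmp V (H x y) (T I (H x y)) (T (L' (f y) (g y)) (L' (f x) (f y)))
                  (TM V I (L' (f y) (g y)) (H x y) (L' (f x) (f y)) (\<alpha> y) (VFM F x y))
                  (inv_arrow V (T I (H x y)) (H x y) (Lun V (H x y)))) =
             Cmp V (H x y) (T (L' (g x) (g y)) (L' (f x) (g x))) (L' (f x) (g y))
               (VCmp L (f x) (g x) (g y))
               (Cmp V (H x y) (T (H x y) I) (T (L' (g x) (g y)) (L' (f x) (g x)))
                  (TM V (H x y) (L' (g x) (g y)) I (L' (f x) (g x)) (VFM G x y) (\<alpha> x))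
                  (inv_arrow V (T (H x y) I) (H x y) (Run V (H x y)))))})"

text \<open>The hom-categories of the 2-category of enriched categories.\<close>

definition vfun_cat ::
    "('o, 'm) monoidal \<Rightarrow> ('x, 'o, 'm) vcat \<Rightarrow> ('y, 'o, 'm) vcat
      \<Rightarrow> (('x, 'y, 'm) vftr, 'x \<Rightarrow> 'm) category" where
  "vfun_cat V K L =
     (let L' = VHom L; T = TO V; I = Unt V in
      \<lparr>Ob = {F. is_vfunctor V K L F},
       Hom = vnat_trans V K L,
       Idn = (\<lambda>F. \<lambda>x\<in>VOb K. VIdn L (VFO F x)),
       Cmp = (\<lambda>F G M \<beta> \<alpha>. \<lambda>x\<in>VOb K.
         Cmp V I (T (L' (VFO G x) (VFO M x)) (L' (VFO F x) (VFO G x))) (L' (VFO F x) (VFO M x))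
           (VCmp L (VFO F x) (VFO G x) (VFO M x))
           (Cmp V I (T I I) (T (L' (VFO G x) (VFO M x)) (L' (VFO F x) (VFO G x)))
              (TM V I (L' (VFO G x) (VFO M x)) I (L' (VFO F x) (VFO G x)) (\<beta> x) (\<alpha> x))
              (inv_arrow V (T I I) I (Lun V I))))\<rparr>)"

text \<open>Precomposition with \<open>P : K \<rightarrow> K'\<close>, from \<open>V-CAT(K', L)\<close> to \<open>V-CAT(K, L)\<close>.\<close>

definition vprecomp ::
    "('o, 'm) monoidal \<Rightarrow> ('x, 'o, 'm) vcat \<Rightarrow> ('x, 'o, 'm) vcat \<Rightarrow> ('y, 'o, 'm) vcat
      \<Rightarrow> ('x, 'x, 'm) vftr
      \<Rightarrow> (('x, 'y, 'm) vftr, 'x \<Rightarrow> 'm, ('x, 'y, 'm) vftr, 'x \<Rightarrow> 'm) ftr" where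
  "vprecomp V K K' L P =
     \<lparr>FO = (\<lambda>F\<in>Ob (vfun_cat V K' L). vftr_comp V K K' L F P),
      FM = (\<lambda>F\<in>Ob (vfun_cat V K' L). \<lambda>G\<in>Ob (vfun_cat V K' L). \<lambda>\<alpha>\<in>Hom (vfun_cat V K' L) F G.
              \<lambda>x\<in>VOb K. \<alpha> (VFO P x))\<rparr>"

text \<open>The representable functor \<open>V-CAT(-, L)\<close>, from the opposite of \<open>V-CAT\<close> to \<open>CAT\<close>.\<close>

definition vrep ::
    "('o, 'm) monoidal \<Rightarrow> ('x, 'o, 'm) vcat
      \<Rightarrow> (('x, 'o, 'm) vcat, ('x, 'x, 'm) vftr,
          (('x, 'x, 'm) vftr, 'x \<Rightarrow> 'm) category,
          (('x, 'x, 'm) vftr, 'x \<Rightarrow> 'm, ('x, 'x, 'm) vftr, 'x \<Rightarrow> 'm) ftr) ftr" where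
  "vrep V L =
     \<lparr>FO = (\<lambda>K\<in>Ob (op_cat (VCAT V)). vfun_cat V K L),
      FM = (\<lambda>K'\<in>Ob (op_cat (VCAT V)). \<lambda>K\<in>Ob (op_cat (VCAT V)).
              \<lambda>P\<in>Hom (op_cat (VCAT V)) K' K. vprecomp V K K' L P)\<rparr>"


section \<open>Sets, finite cardinals and finitary monads\<close>

definition SET :: "('u::set_universe, 'u \<Rightarrow> 'u) category" where
  "SET = \<lparr>Ob = UNIV, Hom = (\<lambda>X Y. elts X \<rightarrow>\<^sub>E elts Y), Idn = (\<lambda>X. \<lambda>x\<in>elts X. x),
          Cmp = (\<lambda>X Y Z g f. compose (elts X) g f)\<rparr>"

definition FIN :: "('u::set_universe, 'u \<Rightarrow> 'u) category" where
  "FIN = SET\<lparr>Ob := range vnat\<rparr>"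

definition incl :: "('u::set_universe, 'u \<Rightarrow> 'u, 'u, 'u \<Rightarrow> 'u) ftr" where
  "incl = \<lparr>FO = (\<lambda>n\<in>Ob FIN. n), FM = (\<lambda>m\<in>Ob FIN. \<lambda>n\<in>Ob FIN. \<lambda>s\<in>Hom FIN m n. s)\<rparr>"

definition Mnd_f :: "(('u::set_universe, 'u \<Rightarrow> 'u) monad, 'u \<Rightarrow> 'u \<Rightarrow> 'u) category" where
  "Mnd_f =
     \<lparr>Ob = {M. is_monad SET M \<and> preserves_filtered_colimits SET SET (mnd_fun M) TYPE('u)},
      Hom = monad_morphisms SET,
      Idn = (\<lambda>M. \<lambda>X\<in>Ob SET. Idn SET (FO (mnd_fun M) X)),
      Cmp = (\<lambda>L M N \<psi> \<phi>. \<lambda>X\<in>Ob SET.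
               Cmp SET (FO (mnd_fun L) X) (FO (mnd_fun M) X) (FO (mnd_fun N) X) (\<psi> X) (\<phi> X))\<rparr>"

definition Alg_functor ::
    "(('u::set_universe, 'u \<Rightarrow> 'u) monad, 'u \<Rightarrow> 'u \<Rightarrow> 'u,
      ('u \<times> ('u \<Rightarrow> 'u), 'u \<Rightarrow> 'u) category,
      ('u \<times> ('u \<Rightarrow> 'u), 'u \<Rightarrow> 'u, 'u \<times> ('u \<Rightarrow> 'u), 'u \<Rightarrow> 'u) ftr) ftr" where
  "Alg_functor =
     \<lparr>FO = (\<lambda>M\<in>Ob (op_cat Mnd_f). Alg SET M),
      FM = (\<lambda>N\<in>Ob (op_cat Mnd_f). \<lambda>M\<in>Ob (op_cat Mnd_f). \<lambda>\<phi>\<in>Hom (op_cat Mnd_f) N M.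
              alg_pullback SET M N \<phi>)\<rparr>"


section \<open>The monoidal category \<open>[F, Set]\<close>\<close>

type_synonym 'u presheaf = "('u, 'u \<Rightarrow> 'u, 'u, 'u \<Rightarrow> 'u) ftr"
type_synonym 'u presheaf_map = "'u \<Rightarrow> 'u \<Rightarrow> 'u"

text \<open>
  The coend of \<open>A m \<times> N\<^sup>m\<close> over \<open>m\<close> in \<open>FIN\<close>, for a set \<open>N\<close>: triples \<open>(m, a, b)\<close> with
  \<open>a \<in> A m\<close> and \<open>b : m \<rightarrow> N\<close>, modulo the equivalence relation generated by
  \<open>(m, a, b \<circ> s) \<sim> (m', A s a, b)\<close> for \<open>s : m \<rightarrow> m'\<close>.  Equivalence classes are coded as elements
  of the universe.
\<close>

definition triples :: "'u::set_universe presheaf \<Rightarrow> 'u \<Rightarrow> ('u \<times> 'u \<times> ('u \<Rightarrow> 'u)) set" where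
  "triples A N = {(m, a, b). m \<in> Ob FIN \<and> a \<in> elts (FO A m) \<and> b \<in> Hom SET m N}"

definition coend_gen ::
    "'u::set_universe presheaf \<Rightarrow> 'u \<Rightarrow> (('u \<times> 'u \<times> ('u \<Rightarrow> 'u)) \<times> ('u \<times> 'u \<times> ('u \<Rightarrow> 'u))) set" where
  "coend_gen A N =
     {((m, a, Cmp SET m m' N b s), (m', FM A m m' s a, b)) | m m' s a b.
        m \<in> Ob FIN \<and> m' \<in> Ob FIN \<and> s \<in> Hom FIN m m' \<and> a \<in> elts (FO A m) \<and> b \<in> Hom SET m' N}"

definition coend_class ::
    "'u::set_universe presheaf \<Rightarrow> 'u \<Rightarrow> 'u \<Rightarrow> 'u \<Rightarrow> ('u \<Rightarrow> 'u) \<Rightarrow> 'u" where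
  "coend_class A N m a b =
     vset ((\<lambda>(m, a, b). vpair m (vpair a (vlam m b))) `
           ((coend_gen A N \<union> (coend_gen A N)\<inverse>)\<^sup>* `` {(m, a, b)}))"

definition coend :: "'u::set_universe presheaf \<Rightarrow> 'u \<Rightarrow> 'u" where
  "coend A N = vset ((\<lambda>(m, a, b). coend_class A N m a b) ` triples A N)"

text \<open>The function on \<open>coend A N\<close> induced by a function \<open>h\<close> on triples compatible with the
  equivalence relation.\<close>

definition coend_lift ::
    "'u::set_universe presheaf \<Rightarrow> 'u \<Rightarrow> ('u \<Rightarrow> 'u \<Rightarrow> ('u \<Rightarrow> 'u) \<Rightarrow> 'u) \<Rightarrow> 'u \<Rightarrow> 'u" where
  "coend_lift A N h =
     (\<lambda>c\<in>elts (coend A N).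
        THE v. \<forall>(m, a, b)\<in>triples A N. coend_class A N m a b = c \<longrightarrow> v = h m a b)"

definition tens :: "'u::set_universe presheaf \<Rightarrow> 'u presheaf \<Rightarrow> 'u presheaf" where
  "tens A B =
     \<lparr>FO = (\<lambda>n\<in>Ob FIN. coend A (FO B n)),
      FM = (\<lambda>n\<in>Ob FIN. \<lambda>n'\<in>Ob FIN. \<lambda>s\<in>Hom FIN n n'.
              coend_lift A (FO B n)
                (\<lambda>m a b. coend_class A (FO B n') m a
                           (Cmp SET m (FO B n) (FO B n') (FM B n n' s) b)))\<rparr>"

definition tens_map ::
    "'u::set_universe presheaf \<Rightarrow> 'u presheaf \<Rightarrow> 'u presheaf \<Rightarrow> 'u presheaf
      \<Rightarrow> 'u presheaf_map \<Rightarrow> 'u presheaf_map \<Rightarrow> 'u presheaf_map" where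
  "tens_map A A' B B' \<alpha> \<beta> =
     (\<lambda>n\<in>Ob FIN. coend_lift A (FO B n)
        (\<lambda>m a b. coend_class A' (FO B' n) m (\<alpha> m a) (Cmp SET m (FO B n) (FO B' n) (\<beta> n) b)))"

text \<open>The associator sends \<open>[m, [k, a, b], c]\<close> to \<open>[k, a, j \<mapsto> [m, b j, c]]\<close>.\<close>

definition tens_assoc ::
    "'u::set_universe presheaf \<Rightarrow> 'u presheaf \<Rightarrow> 'u presheaf \<Rightarrow> 'u presheaf_map" where
  "tens_assoc A B C =
     (\<lambda>n\<in>Ob FIN. coend_lift (tens A B) (FO C n)
        (\<lambda>m d c. coend_lift A (FO B m)
           (\<lambda>k a b. coend_class A (FO (tens B C) n) k a
                      (\<lambda>j\<in>elts k. coend_class B (FO C n) m (b j) c)) d))"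

definition tens_lunit :: "'u::set_universe presheaf \<Rightarrow> 'u presheaf_map" where
  "tens_lunit A = (\<lambda>n\<in>Ob FIN. coend_lift incl (FO A n) (\<lambda>m i b. b i))"

definition tens_runit :: "'u::set_universe presheaf \<Rightarrow> 'u presheaf_map" where
  "tens_runit A = (\<lambda>n\<in>Ob FIN. coend_lift A (FO incl n) (\<lambda>m a s. FM A m n s a))"

definition FSet :: "('u::set_universe presheaf, 'u presheaf_map) monoidal" where
  "FSet =
     \<lparr>Ob = Ob (fun_cat FIN SET), Hom = Hom (fun_cat FIN SET),
      Idn = Idn (fun_cat FIN SET), Cmp = Cmp (fun_cat FIN SET),
      Unt = incl, TO = tens, TM = tens_map,
      Asc = tens_assoc, Lun = tens_lunit, Run = tens_runit\<rparr>"


section \<open>The functor \<open>\<Sigma>\<close> and the \<open>[F, Set]\<close>-category \<open>\<S>\<close>\<close>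

definition restrict_to_FIN :: "('u::set_universe, 'u \<Rightarrow> 'u) monad \<Rightarrow> 'u presheaf" where
  "restrict_to_FIN M = ftr_comp FIN (mnd_fun M) incl"

text \<open>The monoid structure on the restriction of \<open>T\<close>: the multiplication sends
  \<open>[m, a, b]\<close>, with \<open>a \<in> T m\<close> and \<open>b : m \<rightarrow> T n\<close>, to \<open>\<mu> (T b a)\<close>.\<close>

definition Sigma_vcat ::
    "('u::set_universe, 'u \<Rightarrow> 'u) monad \<Rightarrow> ('u, 'u presheaf, 'u presheaf_map) vcat" where
  "Sigma_vcat M =
     (let T = mnd_fun M; A = restrict_to_FIN M in
      \<lparr>VOb = {vset {}},
       VHom = (\<lambda>_ _. A),
       VIdn = (\<lambda>_. \<lambda>n\<in>Ob FIN. mnd_unit M n),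
       VCmp = (\<lambda>_ _ _. \<lambda>n\<in>Ob FIN.
                 coend_lift A (FO A n) (\<lambda>m a b. mnd_mult M n (FM T m (FO T n) b a)))\<rparr>)"

definition Sigma_functor ::
    "(('u::set_universe, 'u \<Rightarrow> 'u) monad, 'u \<Rightarrow> 'u \<Rightarrow> 'u,
      ('u, 'u presheaf, 'u presheaf_map) vcat, ('u, 'u, 'u presheaf_map) vftr) ftr" where
  "Sigma_functor =
     \<lparr>FO = (\<lambda>M\<in>Ob Mnd_f. Sigma_vcat M),
      FM = (\<lambda>M\<in>Ob Mnd_f. \<lambda>N\<in>Ob Mnd_f. \<lambda>\<phi>\<in>Hom Mnd_f M N.
              \<lparr>VFO = (\<lambda>x\<in>{vset {}}. x),
               VFM = (\<lambda>x\<in>{vset {}}. \<lambda>y\<in>{vset {}}. \<lambda>n\<in>Ob FIN. \<phi> n)\<rparr>)\<rparr>"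

text \<open>\<open>S(X, Y)(n) = Set(X\<^sup>n, Y)\<close>, covariantly functorial in \<open>n\<close> since \<open>s : m \<rightarrow> n\<close> induces
  \<open>X\<^sup>n \<rightarrow> X\<^sup>m\<close>.\<close>

definition S_hom :: "'u::set_universe \<Rightarrow> 'u \<Rightarrow> 'u presheaf" where
  "S_hom X Y =
     \<lparr>FO = (\<lambda>n\<in>Ob FIN. vexp (vexp n X) Y),
      FM = (\<lambda>m\<in>Ob FIN. \<lambda>n\<in>Ob FIN. \<lambda>s\<in>Hom FIN m n. \<lambda>g\<in>elts (vexp (vexp m X) Y).
              vlam (vexp n X) (\<lambda>x. vapp g (vlam m (\<lambda>i. vapp x (s i)))))\<rparr>"

text \<open>Since the unit \<open>incl\<close> is represented by \<open>1\<close>, the identity map \<open>I \<rightarrow> S(X, X)\<close> that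
  corresponds by the Yoneda lemma to \<open>1\<^sub>X \<in> Set(X, X)\<close> sends \<open>j \<in> n\<close> to the \<open>j\<close>-th projection
  \<open>X\<^sup>n \<rightarrow> X\<close>.\<close>

definition S_vcat :: "('u::set_universe, 'u presheaf, 'u presheaf_map) vcat" where
  "S_vcat =
     \<lparr>VOb = UNIV,
      VHom = S_hom,
      VIdn = (\<lambda>X. \<lambda>n\<in>Ob FIN. \<lambda>j\<in>elts n. vlam (vexp n X) (\<lambda>x. vapp x j)),
      VCmp = (\<lambda>X Y Z. \<lambda>n\<in>Ob FIN.
                coend_lift (S_hom Y Z) (FO (S_hom X Y) n)
                  (\<lambda>m g f. vlam (vexp n X) (\<lambda>x. vapp g (vlam m (\<lambda>j. vapp (f j) x)))))\<rparr>"

end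

theory Submission
  imports Defs
begin

text \<open>
  Each set is the filtered colimit of its finite subsets, so a finitary functor \<open>T\<close> is determined
  by its restriction to finite cardinals: every element of \<open>T X\<close> has the form \<open>T b a\<close> with
  \<open>a \<in> T n\<close> and \<open>b : n \<rightarrow> X\<close>, and a family of maps on such pairs \<open>(a, b)\<close> that is compatible with
  reindexing extends uniquely to \<open>T X\<close>.  This gives full faithfulness of \<open>\<Sigma>\<close>.  It also shows that
  an enriched functor \<open>\<Sigma>T \<rightarrow> \<S>\<close>, that is, a set \<open>X\<close> with compatible maps
  \<open>T n \<rightarrow> Set(X\<^sup>n, X)\<close>, is the same as an algebra structure \<open>a : T X \<rightarrow> X\<close>, through
  \<open>t \<mapsto> (x \<mapsto> a (T x t))\<close>; by the Yoneda lemma, enriched transformations are the same as algebra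
  homomorphisms.  The comparison is an isomorphism of categories and strictly natural in \<open>T\<close>, so
  the coherence cells are identities, and the category and functor axioms on the enriched
  side are transported from the categories of algebras.
\<close>

text \<open>Finitarity is tested against small filtered diagrams, whereas everything enriched speaks
  of finite cardinals. The bridge is the poset of finite subsets of a set: its objects are members
  of the universe, and each finite subset is moved to a cardinal along a chosen bijection. That the
  choice does not matter is the coend relation \<open>(m, a, b o s) ~ (m', A s a, b)\<close>, so the
  same \<open>glue\<close> condition governs maps out of \<open>T X\<close> and maps out of a tensor
  product.

  Equations on \<open>T (T X)\<close> are the obstacle: an element is \<open>T b a\<close> with
  \<open>b : m -> T X\<close>, which is not yet finite data. Since \<open>m\<close> is finite, all
  the \<open>b j\<close> come from one common \<open>T n\<close>, so the element comes from
  \<open>T (T n)\<close>. There the law for finite cardinals applies, and naturality carries it to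
  \<open>X\<close>. This argument serves both monad morphisms and algebras.

  Diagrams in \<open>[F, Set]\<close> are checked on elements. A map out of a tensor product is
  determined by its values on classes, so each enriched axiom becomes an equation about
  \<open>coend_class\<close>.\<close>

abbreviation set_maps :: "'u::set_universe \<Rightarrow> 'u \<Rightarrow> ('u \<Rightarrow> 'u) set" (infixr "\<leadsto>" 60) where
  "X \<leadsto> Y \<equiv> elts X \<rightarrow>\<^sub>E elts Y"

lemma PiE_app: "f \<in> A \<rightarrow>\<^sub>E B \<Longrightarrow> x \<in> A \<Longrightarrow> f x \<in> B"
  by (rule PiE_mem)

lemma PiE_eqI:
  assumes "f \<in> A \<rightarrow>\<^sub>E B" "g \<in> A \<rightarrow>\<^sub>E C" "\<And>x. x \<in> A \<Longrightarrow> f x = g x"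
  shows "f = g"
  by (rule extensionalityI[of _ A]) (use assms in \<open>auto simp: PiE_def\<close>)

subsection \<open>Sets of the universe\<close>

lemma elts_vset: "small A \<Longrightarrow> elts (vset A) = A"
  unfolding small_def vset_def by (rule f_inv_into_f)

lemma vset_inject: "small A \<Longrightarrow> small B \<Longrightarrow> vset A = vset B \<longleftrightarrow> A = B"
  by (metis elts_vset)

lemma small_elts: "small (elts x)"
  unfolding small_def by simp

lemma small_subset: "small B \<Longrightarrow> A \<subseteq> B \<Longrightarrow> small A"
  unfolding small_def using elts_separation by blast

lemma small_image:
  fixes f :: "'u::set_universe \<Rightarrow> 'u"
  shows "small A \<Longrightarrow> small (f ` A)"
  unfolding small_def using elts_replacement by blast

lemma ex_small_infinite: "\<exists>A::'u::set_universe set. small A \<and> infinite A"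
  using elts_infinity small_elts by blast

text \<open>Replacement concerns self-maps of the universe, so a sequence indexed by
  \<open>nat\<close> has to pass through an infinite small set: the range of an injective sequence
  in it is small by separation, and \<open>f\<close> is read off along the inverse. Pairing and
  smallness of all finite sets come from here, as a finite set lies inside the range of a
  sequence.\<close>

lemma small_countable_range:
  fixes f :: "nat \<Rightarrow> 'u::set_universe"
  shows "small (range f)"
proof -
  obtain A :: "'u set" where A: "small A" "infinite A"
    using ex_small_infinite by (elim exE conjE) (rule that)
  then obtain e :: "nat \<Rightarrow> 'u" where e: "inj e" "range e \<subseteq> A"
    using infinite_countable_subset[OF A(2)] by (elim exE conjE) (rule that)
  have "range f = (\<lambda>x. f (inv e x)) ` range e"
    using e(1) by (auto simp: image_comp)
  also have "small \<dots>"
    using A e by (intro small_image) (rule small_subset)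
  finally show ?thesis .
qed

lemma small_finite:
  fixes A :: "'u::set_universe set"
  assumes "finite A"
  shows "small A"
proof -
  obtain f :: "nat \<Rightarrow> 'u" and n where "A = f ` {i. i < n}"
    using finite_imp_nat_seg_image_inj_on[OF assms] by blast
  then have "A \<subseteq> range f" by blast
  then show ?thesis by (rule small_subset[OF small_countable_range])
qed

lemma small_UN:
  fixes B :: "'u::set_universe \<Rightarrow> 'u set"
  assumes "small A" and "\<And>x. x \<in> A \<Longrightarrow> small (B x)"
  shows "small (\<Union>x\<in>A. B x)"
proof -
  \<comment> \<open>The union axiom wants a set of sets of the universe, so the family
    \<open>B\<close> is replaced by the small set of the codes \<open>vset (B x)\<close>.\<close>
  have "(\<Union>x\<in>A. B x) = (\<Union>y\<in>elts (vset ((\<lambda>x. vset (B x)) ` A)). elts y)"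
    using assms by (simp add: elts_vset small_image)
  then show ?thesis
    unfolding small_def using elts_union by metis
qed

lemma small_power: "small A \<Longrightarrow> small {y. elts y \<subseteq> A}"
  unfolding small_def using elts_power by auto

lemma vpair_inject: "vpair a b = vpair c d \<longleftrightarrow> a = c \<and> b = d"
  unfolding vpair_def by (auto simp: vset_inject small_finite doubleton_eq_iff)

lemma small_vpairs: 
  assumes "small A" "small B"
  shows "small {vpair x y | x y. x \<in> A \<and> y \<in> B}"
proof -
  have "{vpair x y | x y. x \<in> A \<and> y \<in> B} = (\<Union>x\<in>A. vpair x ` B)" by blast
  then show ?thesis using assms by (simp add: small_UN small_image)
qed

lemma elts_vlam: "elts (vlam X f) = (\<lambda>x. vpair x (f x)) ` elts X"
  unfolding vlam_def by (simp add: elts_vset small_image small_elts)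

lemma vapp_vlam: "x \<in> elts X \<Longrightarrow> vapp (vlam X f) x = f x"
  unfolding vapp_def by (auto simp: elts_vlam vpair_inject)

lemma vlam_cong: "(\<And>x. x \<in> elts X \<Longrightarrow> f x = g x) \<Longrightarrow> vlam X f = vlam X g"
  unfolding vlam_def by (intro arg_cong[where f = vset] image_cong) auto

lemma vlam_inj: "vlam X f = vlam X g \<Longrightarrow> x \<in> elts X \<Longrightarrow> f x = g x"
  by (metis vapp_vlam)

lemma vlam_inject:
  assumes "f \<in> elts X \<rightarrow>\<^sub>E B" "g \<in> elts X \<rightarrow>\<^sub>E C" "vlam X f = vlam X g"
  shows "f = g"
proof
  show "f x = g x" for x
    using assms vlam_inj[OF assms(3), of x] by (cases "x \<in> elts X") (auto simp: PiE_iff extensional_def)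
qed

text \<open>Graphs of functions are subsets of the product, so the collection of all of them is
  bounded by a power set and \<open>vset\<close> loses nothing.\<close>

lemma elts_vexp: "elts (vexp X Y) = vlam X ` (X \<leadsto> Y)"
proof -
  have "vlam X ` (X \<leadsto> Y)
      \<subseteq> {z. elts z \<subseteq> {vpair x y | x y. x \<in> elts X \<and> y \<in> elts Y}}"
    by (auto simp: elts_vlam vpair_inject) (erule (1) PiE_app)
  then have "small (vlam X ` (X \<leadsto> Y))"
    by (rule small_subset[rotated]) (intro small_power small_vpairs small_elts)
  then show ?thesis unfolding vexp_def by (rule elts_vset)
qed

lemma vlam_in_vexp: "(\<And>x. x \<in> elts X \<Longrightarrow> f x \<in> elts Y) \<Longrightarrow> vlam X f \<in> elts (vexp X Y)"
  unfolding elts_vexp by (rule image_eqI[where x = "restrict f (elts X)"]) (auto intro: vlam_cong)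

lemma vapp_in: "g \<in> elts (vexp X Y) \<Longrightarrow> x \<in> elts X \<Longrightarrow> vapp g x \<in> elts Y"
  by (auto simp: elts_vexp vapp_vlam)

lemma vlam_vapp: "g \<in> elts (vexp X Y) \<Longrightarrow> vlam X (vapp g) = g"
  by (auto simp: elts_vexp vapp_vlam intro: vlam_cong)

lemma elts_vnat: "elts (vnat n) = vnat ` {..<n}"
proof (induction n)
  case 0
  then show ?case by (simp add: elts_vset small_finite)
next
  case (Suc n)
  then show ?case
    by (simp add: elts_vset small_finite lessThan_Suc)
qed

lemma vnat_notin_self: "vnat n \<notin> elts (vnat n :: 'u::set_universe)"
proof (induction n)
  case 0
  then show ?case by (simp add: elts_vnat del: vnat.simps)
next
  case (Suc n)
  have *: "elts (vnat (Suc n)) = insert (vnat n) (elts (vnat n :: 'u))"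
    by (simp add: elts_vnat lessThan_Suc del: vnat.simps)
  show ?case
  proof
    assume "vnat (Suc n) \<in> elts (vnat (Suc n) :: 'u)"
    then obtain k where k: "k \<le> n" "vnat (Suc n) = (vnat k :: 'u)"
      unfolding elts_vnat by (elim imageE) (rule that[rotated], assumption, simp)
    then have "vnat n \<in> elts (vnat k :: 'u)" using * by simp
    also have "\<dots> \<subseteq> elts (vnat n)" using k(1) by (auto simp: elts_vnat simp del: vnat.simps)
    finally show False using Suc by simp
  qed
qed

lemma inj_vnat: "inj (vnat :: nat \<Rightarrow> 'u::set_universe)"
proof (rule linorder_injI)
  fix m n :: nat
  assume "m < n"
  then have "vnat m \<in> elts (vnat n :: 'u)" by (simp add: elts_vnat)
  then show "vnat m \<noteq> (vnat n :: 'u)" using vnat_notin_self[of n, where 'u = 'u] by auto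
qed

lemma ex_bij_vnat:
  assumes "finite F"
  shows "\<exists>n e. bij_betw e (elts (vnat n :: 'u::set_universe)) F"
proof -
  have "finite (elts (vnat (card F) :: 'u))" "card (elts (vnat (card F) :: 'u)) = card F"
    using inj_vnat[where 'u = 'u] by (auto simp: elts_vnat card_image inj_on_subset simp del: vnat.simps)
  then show ?thesis using assms by (meson finite_same_card_bij)
qed

subsection \<open>Sets and presheaves on finite cardinals\<close>

lemma SET_simps [simp]:
  "Ob SET = UNIV" "Hom SET X Y = X \<leadsto> Y" "Idn SET X = (\<lambda>x\<in>elts X. x)"
  "Cmp SET X Y Z g f = compose (elts X) g f"
  by (simp_all add: SET_def)

lemma FIN_simps [simp]:
  "Hom FIN X Y = X \<leadsto> Y" "Idn FIN X = (\<lambda>x\<in>elts X. x)"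
  "Cmp FIN X Y Z g f = compose (elts X) g f"
  by (simp_all add: FIN_def SET_def)

lemma Ob_FIN: "Ob FIN = range vnat"
  by (simp add: FIN_def)

lemma vnat_FIN [simp]: "vnat n \<in> Ob FIN" "vset {} \<in> Ob FIN"
  unfolding Ob_FIN by (simp, metis vnat.simps(1) rangeI)

lemma compose_PiE: "f \<in> A \<rightarrow>\<^sub>E B \<Longrightarrow> g \<in> B \<rightarrow>\<^sub>E C \<Longrightarrow> compose A g f \<in> A \<rightarrow>\<^sub>E C"
  by (auto simp: compose_def)

lemma compose_assoc_PiE:
  "f \<in> A \<rightarrow>\<^sub>E B \<Longrightarrow> compose A h (compose A g f) = compose A (compose B h g) f"
  by (auto simp: compose_def fun_eq_iff)

lemma compose_id_PiE:
  "f \<in> A \<rightarrow>\<^sub>E B \<Longrightarrow> compose A f (\<lambda>x\<in>A. x) = f" "f \<in> A \<rightarrow>\<^sub>E B \<Longrightarrow> compose A (\<lambda>x\<in>B. x) f = f"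
  by (auto simp: compose_def fun_eq_iff)

lemma is_category_SET: "is_category SET"
  unfolding is_category_def
  by (auto simp: compose_PiE compose_assoc_PiE compose_id_PiE)

lemma is_category_FIN: "is_category FIN"
  unfolding is_category_def
  by (auto simp: compose_PiE compose_assoc_PiE compose_id_PiE)

text \<open>Functor laws into \<open>SET\<close> are equations between extensional functions. Here
  and in \<open>functor_SET_D\<close> they are traded for equations at elements, the form in which
  they are used from now on.\<close>

lemma is_functor_SET_I:
  assumes "is_category C" "FO T \<in> extensional (Ob C)"
    "FM T \<in> (\<Pi>\<^sub>E x\<in>Ob C. \<Pi>\<^sub>E y\<in>Ob C. Hom C x y \<rightarrow>\<^sub>E (FO T x \<leadsto> FO T y))"
    "\<And>x a. x \<in> Ob C \<Longrightarrow> a \<in> elts (FO T x) \<Longrightarrow> FM T x x (Idn C x) a = a"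
    "\<And>x y z f g a. x \<in> Ob C \<Longrightarrow> y \<in> Ob C \<Longrightarrow> z \<in> Ob C \<Longrightarrow> f \<in> Hom C x y \<Longrightarrow> g \<in> Hom C y z
      \<Longrightarrow> a \<in> elts (FO T x) \<Longrightarrow> FM T x z (Cmp C x y z g f) a = FM T y z g (FM T x y f a)"
  shows "is_functor C SET T"
proof -
  have M: "FM T x y f \<in> FO T x \<leadsto> FO T y"
    if "x \<in> Ob C" "y \<in> Ob C" "f \<in> Hom C x y" for x y f
    using assms(3) that by (auto simp: PiE_iff)
  have C: "Idn C x \<in> Hom C x x" "f \<in> Hom C x y \<Longrightarrow> g \<in> Hom C y z \<Longrightarrow> Cmp C x y z g f \<in> Hom C x z"
    if "x \<in> Ob C" "y \<in> Ob C" "z \<in> Ob C" for x y z f g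
    using assms(1) that unfolding is_category_def by blast+
  have "FM T x x (Idn C x) = (\<lambda>x\<in>elts (FO T x). x)" if "x \<in> Ob C" for x
    by (rule PiE_ext[OF M]) (use that C assms(4) in auto)
  moreover have "FM T x z (Cmp C x y z g f) = compose (elts (FO T x)) (FM T y z g) (FM T x y f)"
    if "x \<in> Ob C" "y \<in> Ob C" "z \<in> Ob C" "f \<in> Hom C x y" "g \<in> Hom C y z" for x y z f g
    by (rule PiE_ext[OF M compose_PiE[OF M M]]) (use that C assms(5) in \<open>auto simp: compose_def\<close>)
  ultimately show ?thesis
    using assms(1-3) is_category_SET unfolding is_functor_def by (auto simp: PiE_def)
qed

lemma functor_SET_D:
  assumes "is_functor C SET T"
  shows "x \<in> Ob C \<Longrightarrow> y \<in> Ob C \<Longrightarrow> f \<in> Hom C x y \<Longrightarrow> FM T x y f \<in> FO T x \<leadsto> FO T y"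
    "x \<in> Ob C \<Longrightarrow> y \<in> Ob C \<Longrightarrow> f \<in> Hom C x y \<Longrightarrow> a \<in> elts (FO T x) \<Longrightarrow> FM T x y f a \<in> elts (FO T y)"
    "x \<in> Ob C \<Longrightarrow> a \<in> elts (FO T x) \<Longrightarrow> FM T x x (Idn C x) a = a"
    "x \<in> Ob C \<Longrightarrow> y \<in> Ob C \<Longrightarrow> z \<in> Ob C \<Longrightarrow> f \<in> Hom C x y \<Longrightarrow> g \<in> Hom C y z
      \<Longrightarrow> a \<in> elts (FO T x) \<Longrightarrow> FM T x z (Cmp C x y z g f) a = FM T y z g (FM T x y f a)"
proof -
  show *: "FM T x y f \<in> FO T x \<leadsto> FO T y" if "x \<in> Ob C" "y \<in> Ob C" "f \<in> Hom C x y" for x y f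
    using assms that unfolding is_functor_def by (auto simp: PiE_iff)
  then show "x \<in> Ob C \<Longrightarrow> y \<in> Ob C \<Longrightarrow> f \<in> Hom C x y \<Longrightarrow> a \<in> elts (FO T x)
      \<Longrightarrow> FM T x y f a \<in> elts (FO T y)" by blast
  show "x \<in> Ob C \<Longrightarrow> a \<in> elts (FO T x) \<Longrightarrow> FM T x x (Idn C x) a = a"
    using assms unfolding is_functor_def by auto
  show "x \<in> Ob C \<Longrightarrow> y \<in> Ob C \<Longrightarrow> z \<in> Ob C \<Longrightarrow> f \<in> Hom C x y \<Longrightarrow> g \<in> Hom C y z
      \<Longrightarrow> a \<in> elts (FO T x) \<Longrightarrow> FM T x z (Cmp C x y z g f) a = FM T y z g (FM T x y f a)"
    using assms unfolding is_functor_def by (auto simp: compose_eq)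
qed

subsection \<open>Coends\<close>

lemma triples_iff:
  "(m, a, b) \<in> triples A N \<longleftrightarrow> m \<in> Ob FIN \<and> a \<in> elts (FO A m) \<and> b \<in> m \<leadsto> N"
  by (simp add: triples_def)

definition coend_equiv ::
  "'u::set_universe presheaf \<Rightarrow> 'u \<Rightarrow> (('u \<times> 'u \<times> ('u \<Rightarrow> 'u)) \<times> ('u \<times> 'u \<times> ('u \<Rightarrow> 'u))) set" where
  "coend_equiv A N = (coend_gen A N \<union> (coend_gen A N)\<inverse>)\<^sup>*"

lemma equiv_coend_equiv: "equiv UNIV (coend_equiv A N)"
  unfolding coend_equiv_def
  by (intro equivI refl_rtrancl trans_rtrancl sym_rtrancl) (auto simp: sym_def)

text \<open>An equivalence relation \<open>P\<close> that contains the generating pairs contains the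
  relation they generate; the induction runs along a zigzag of generators.\<close>

lemma coend_equiv_induct:
  assumes "(p, q) \<in> coend_equiv A N"
    and "\<And>r s. (r, s) \<in> coend_gen A N \<Longrightarrow> P r s" "\<And>r. P r r" "\<And>r s. P r s \<Longrightarrow> P s r"
    "\<And>r s t. P r s \<Longrightarrow> P s t \<Longrightarrow> P r t"
  shows "P p q"
  using assms(1) unfolding coend_equiv_def
proof (induction rule: rtrancl_induct)
  case (step y z)
  then have "P y z" using assms(2,4) by blast
  with step show ?case using assms(5) by blast
qed (rule assms(3))

lemma coend_gen_triples:
  assumes "is_functor FIN SET A" "(p, q) \<in> coend_gen A N"
  shows "p \<in> triples A N \<and> q \<in> triples A N"
  using assms(2) unfolding coend_gen_def
  by (auto simp: triples_iff compose_PiE intro!: functor_SET_D(2)[OF assms(1)])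

lemma coend_equiv_triples:
  assumes "is_functor FIN SET A" "(p, q) \<in> coend_equiv A N"
  shows "p \<in> triples A N \<longleftrightarrow> q \<in> triples A N"
  using assms(2) by (rule coend_equiv_induct) (use coend_gen_triples[OF assms(1)] in auto)

definition triple_code :: "'u::set_universe \<times> 'u \<times> ('u \<Rightarrow> 'u) \<Rightarrow> 'u" where
  "triple_code = (\<lambda>(m, a, b). vpair m (vpair a (vlam m b)))"

text \<open>\<open>vlam m b\<close> is only the graph of \<open>b\<close> over \<open>m\<close>; it
  determines \<open>b\<close> because the third entry of a triple is extensional.\<close>

lemma inj_triple_code: "inj_on triple_code (triples A N)"
proof (rule inj_onI)
  fix p q
  assume "p \<in> triples A N" "q \<in> triples A N" "triple_code p = triple_code q"
  then show "p = q"
    by (cases p; cases q)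
      (simp add: triple_code_def triples_iff vpair_inject, metis vlam_inject)
qed

text \<open>\<open>FIN\<close> has only countably many objects, and over each \<open>m\<close> the
  codes lie in a product of \<open>A m\<close> and the set of functions from \<open>m\<close> to
  \<open>N\<close>. This is what allows a coend over all of \<open>FIN\<close> to live in the
  universe.\<close>

lemma small_triple_codes: "small (triple_code ` triples A N)"
proof -
  have "triple_code ` triples A N \<subseteq>
      (\<Union>m\<in>range vnat. {vpair k y | k y. k \<in> {m} \<and>
         y \<in> {vpair a g | a g. a \<in> elts (FO A m) \<and> g \<in> elts (vexp m N)}})"
    by (force simp: triple_code_def triples_iff Ob_FIN elts_vexp)
  moreover have "small (\<Union>m\<in>range vnat. {vpair k y | k y. k \<in> {m} \<and>
         y \<in> {vpair a g | a g. a \<in> elts (FO A m) \<and> g \<in> elts (vexp m N)}})"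
    by (intro small_UN small_countable_range small_vpairs small_elts) (rule small_finite, simp)
  ultimately show ?thesis by (rule small_subset[rotated])
qed

lemma coend_class_altdef:
  "coend_class A N m a b = vset (triple_code ` (coend_equiv A N `` {(m, a, b)}))"
  unfolding coend_class_def triple_code_def coend_equiv_def ..

text \<open>Both passages, from a class to the set of its codes and from that set to an element of
  the universe, are known to be injective only for subsets of \<open>triples A N\<close>;
  functoriality of \<open>A\<close> guarantees that a class starting there stays there.\<close>

lemma coend_class_eq_iff:
  assumes "is_functor FIN SET A" "(m, a, b) \<in> triples A N" "(m', a', b') \<in> triples A N"
  shows "coend_class A N m a b = coend_class A N m' a' b'
    \<longleftrightarrow> ((m, a, b), (m', a', b')) \<in> coend_equiv A N"
proof -
  have sub: "coend_equiv A N `` {p} \<subseteq> triples A N" if "p \<in> triples A N" for p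
    using coend_equiv_triples[OF assms(1)] that by blast
  have "coend_class A N m a b = coend_class A N m' a' b' \<longleftrightarrow>
      coend_equiv A N `` {(m, a, b)} = coend_equiv A N `` {(m', a', b')}"
    unfolding coend_class_altdef using sub[OF assms(2)] sub[OF assms(3)]
    by (subst vset_inject) (auto intro!: small_subset[OF small_triple_codes] image_mono
        simp: inj_on_image_eq_iff[OF inj_triple_code])
  also have "\<dots> \<longleftrightarrow> ((m, a, b), (m', a', b')) \<in> coend_equiv A N"
    using eq_equiv_class_iff[OF equiv_coend_equiv] by blast
  finally show ?thesis .
qed

lemma coend_class_glue:
  assumes "m \<in> Ob FIN" "m' \<in> Ob FIN" "s \<in> m \<leadsto> m'" "a \<in> elts (FO A m)"
    "b \<in> m' \<leadsto> N"
  shows "coend_class A N m a (compose (elts m) b s) = coend_class A N m' (FM A m m' s a) b"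
proof -
  have "((m, a, compose (elts m) b s), (m', FM A m m' s a, b)) \<in> coend_gen A N"
    unfolding coend_gen_def using assms by auto
  then have "((m, a, compose (elts m) b s), (m', FM A m m' s a, b)) \<in> coend_equiv A N"
    unfolding coend_equiv_def by blast
  then show ?thesis
    unfolding coend_class_altdef by (simp add: equiv_class_eq[OF equiv_coend_equiv])
qed

lemma elts_coend: "elts (coend A N) = (\<lambda>(m, a, b). coend_class A N m a b) ` triples A N"
proof -
  \<comment> \<open>Replacement needs a domain inside the universe, so the triples are first
    recovered from their codes.\<close>
  have "(\<lambda>(m, a, b). coend_class A N m a b) ` triples A N =
      (\<lambda>c. let p = inv_into (triples A N) triple_code c in case p of (m, a, b) \<Rightarrow> coend_class A N m a b) `
        triple_code ` triples A N"
    by (force simp: inv_into_f_f[OF inj_triple_code] image_iff)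
  then have "small ((\<lambda>(m, a, b). coend_class A N m a b) ` triples A N)"
    by (simp add: small_image small_triple_codes)
  then show ?thesis unfolding coend_def by (rule elts_vset)
qed

lemma coend_class_in:
  "m \<in> Ob FIN \<Longrightarrow> a \<in> elts (FO A m) \<Longrightarrow> b \<in> m \<leadsto> N \<Longrightarrow> coend_class A N m a b \<in> elts (coend A N)"
  unfolding elts_coend using triples_iff[of m a b A N] by (force intro: rev_image_eqI)

lemma coendE:
  assumes "c \<in> elts (coend A N)"
  obtains m a b where "m \<in> Ob FIN" "a \<in> elts (FO A m)" "b \<in> m \<leadsto> N"
    "c = coend_class A N m a b"
  using assms unfolding elts_coend by (auto simp: triples_iff)

text \<open>The universal property of the coend. \<open>glue\<close> is invariance under the
  generating pairs, which spreads to the whole relation, so the description in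
  \<open>coend_lift\<close> has exactly one candidate.\<close>

lemma coend_lift_class:
  assumes A: "is_functor FIN SET A"
    and glue: "\<And>m m' s a b. m \<in> Ob FIN \<Longrightarrow> m' \<in> Ob FIN \<Longrightarrow> s \<in> m \<leadsto> m' \<Longrightarrow>
      a \<in> elts (FO A m) \<Longrightarrow> b \<in> m' \<leadsto> N \<Longrightarrow>
      h m a (compose (elts m) b s) = h m' (FM A m m' s a) b"
    and p: "m \<in> Ob FIN" "a \<in> elts (FO A m)" "b \<in> m \<leadsto> N"
  shows "coend_lift A N h (coend_class A N m a b) = h m a b"
proof -
  have compat: "(\<lambda>(m, a, b). h m a b) p = (\<lambda>(m, a, b). h m a b) q" if "(p, q) \<in> coend_equiv A N" for p q
    using that
    by (rule coend_equiv_induct) (auto simp: coend_gen_def glue)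
  have t: "(m, a, b) \<in> triples A N" using p by (simp add: triples_iff)
  have "(THE v. \<forall>(m', a', b')\<in>triples A N.
      coend_class A N m' a' b' = coend_class A N m a b \<longrightarrow> v = h m' a' b') = h m a b"
  proof (rule the_equality)
    show "\<forall>(m', a', b')\<in>triples A N.
      coend_class A N m' a' b' = coend_class A N m a b \<longrightarrow> h m a b = h m' a' b'"
      using t compat coend_class_eq_iff[OF A] by fastforce
  qed (use t in auto)
  then show ?thesis
    unfolding coend_lift_def using p by (simp add: coend_class_in)
qed

lemma functor_SET_SET_D:
  assumes "is_functor SET SET T"
  shows "f \<in> X \<leadsto> Y \<Longrightarrow> FM T X Y f \<in> FO T X \<leadsto> FO T Y"
    "f \<in> X \<leadsto> Y \<Longrightarrow> a \<in> elts (FO T X) \<Longrightarrow> FM T X Y f a \<in> elts (FO T Y)"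
    "a \<in> elts (FO T X) \<Longrightarrow> FM T X X (\<lambda>x\<in>elts X. x) a = a"
    "f \<in> X \<leadsto> Y \<Longrightarrow> g \<in> Y \<leadsto> Z \<Longrightarrow> a \<in> elts (FO T X)
      \<Longrightarrow> FM T X Z (compose (elts X) g f) a = FM T Y Z g (FM T X Y f a)"
  using functor_SET_D[OF assms] by (simp_all del: restrict_apply)

lemma functor_FIN_SET_D:
  assumes "is_functor FIN SET T"
  shows "m \<in> Ob FIN \<Longrightarrow> n \<in> Ob FIN \<Longrightarrow> f \<in> m \<leadsto> n
      \<Longrightarrow> FM T m n f \<in> FO T m \<leadsto> FO T n"
    "m \<in> Ob FIN \<Longrightarrow> n \<in> Ob FIN \<Longrightarrow> f \<in> m \<leadsto> n \<Longrightarrow> a \<in> elts (FO T m)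
      \<Longrightarrow> FM T m n f a \<in> elts (FO T n)"
    "m \<in> Ob FIN \<Longrightarrow> a \<in> elts (FO T m) \<Longrightarrow> FM T m m (\<lambda>x\<in>elts m. x) a = a"
    "k \<in> Ob FIN \<Longrightarrow> m \<in> Ob FIN \<Longrightarrow> n \<in> Ob FIN \<Longrightarrow> f \<in> k \<leadsto> m
      \<Longrightarrow> g \<in> m \<leadsto> n \<Longrightarrow> a \<in> elts (FO T k)
      \<Longrightarrow> FM T k n (compose (elts k) g f) a = FM T m n g (FM T k m f a)"
  using functor_SET_D[OF assms] by (simp_all del: restrict_apply)

subsection \<open>Finitary endofunctors of the category of sets\<close>

text \<open>A poset as a thin category: the single token \<open>vset {}\<close> stands for every
  inclusion. Subsets are represented by the elements coding them, because
  \<open>preserves_filtered_colimits\<close> quantifies over index categories whose objects and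
  arrows are elements of the universe.\<close>

definition finset_cat :: "'u::set_universe \<Rightarrow> ('u, 'u) category" where
  "finset_cat X =
     \<lparr>Ob = {F. finite (elts F) \<and> elts F \<subseteq> elts X},
      Hom = (\<lambda>F G. {p. p = vset {} \<and> elts F \<subseteq> elts G}),
      Idn = (\<lambda>_. vset {}), Cmp = (\<lambda>_ _ _ _ _. vset {})\<rparr>"

definition finset_diagram :: "'u::set_universe \<Rightarrow> ('u, 'u, 'u, 'u \<Rightarrow> 'u) ftr" where
  "finset_diagram X =
     \<lparr>FO = (\<lambda>F\<in>Ob (finset_cat X). F),
      FM = (\<lambda>F\<in>Ob (finset_cat X). \<lambda>G\<in>Ob (finset_cat X). \<lambda>_\<in>Hom (finset_cat X) F G. \<lambda>x\<in>elts F. x)\<rparr>"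

lemma finset_cat_simps:
  "F \<in> Ob (finset_cat X) \<longleftrightarrow> finite (elts F) \<and> elts F \<subseteq> elts X"
  "p \<in> Hom (finset_cat X) F G \<longleftrightarrow> p = vset {} \<and> elts F \<subseteq> elts G"
  by (simp_all add: finset_cat_def)

lemma is_category_finset_cat: "is_category (finset_cat X)"
  unfolding is_category_def finset_cat_def by auto

lemma is_small_category_finset_cat: "is_small_category (finset_cat X)"
proof -
  have "small (Ob (finset_cat X))"
    by (rule small_subset[OF small_power[OF small_elts[of X]]]) (auto simp: finset_cat_simps)
  moreover have "small (Hom (finset_cat X) F G)" for F G
    by (rule small_finite, rule finite_subset[of _ "{vset {}}"]) (auto simp: finset_cat_simps)
  ultimately show ?thesis
    unfolding is_small_category_def using is_category_finset_cat by blast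
qed

lemma vset_finset:
  "finite A \<Longrightarrow> A \<subseteq> elts X \<Longrightarrow> vset A \<in> Ob (finset_cat X)" "finite A \<Longrightarrow> elts (vset A) = A"
  by (simp_all add: finset_cat_simps elts_vset small_finite)

lemma is_filtered_finset_cat: "is_filtered (finset_cat X)"
  unfolding is_filtered_def
proof (intro conjI ballI is_category_finset_cat)
  show "Ob (finset_cat X) \<noteq> {}"
    using vset_finset(1)[of "{}" X] by auto
next
  fix F G assume "F \<in> Ob (finset_cat X)" "G \<in> Ob (finset_cat X)"
  then show "\<exists>K\<in>Ob (finset_cat X). Hom (finset_cat X) F K \<noteq> {} \<and> Hom (finset_cat X) G K \<noteq> {}"
    using vset_finset(1)[of "elts F \<union> elts G" X] vset_finset(2)[of "elts F \<union> elts G"]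
    by (intro bexI[of _ "vset (elts F \<union> elts G)"]) (auto simp: finset_cat_simps)
next
  fix F G f g assume "F \<in> Ob (finset_cat X)" "G \<in> Ob (finset_cat X)"
  then show "\<exists>K\<in>Ob (finset_cat X). \<exists>h\<in>Hom (finset_cat X) G K.
      Cmp (finset_cat X) F G K h f = Cmp (finset_cat X) F G K h g"
    by (intro bexI[of _ G] bexI[of _ "vset {}"]) (auto simp: finset_cat_def)
qed

lemma finset_diagram_simps:
  "F \<in> Ob (finset_cat X) \<Longrightarrow> FO (finset_diagram X) F = F"
  "F \<in> Ob (finset_cat X) \<Longrightarrow> G \<in> Ob (finset_cat X) \<Longrightarrow> p \<in> Hom (finset_cat X) F G
    \<Longrightarrow> FM (finset_diagram X) F G p = (\<lambda>x\<in>elts F. x)"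
  by (simp_all add: finset_diagram_def)

lemma is_functor_finset_diagram: "is_functor (finset_cat X) SET (finset_diagram X)"
proof (rule is_functor_SET_I[OF is_category_finset_cat])
  show "FO (finset_diagram X) \<in> extensional (Ob (finset_cat X))"
    by (simp add: finset_diagram_def)
next
  show "FM (finset_diagram X) \<in> (\<Pi>\<^sub>E F\<in>Ob (finset_cat X). \<Pi>\<^sub>E G\<in>Ob (finset_cat X).
      Hom (finset_cat X) F G \<rightarrow>\<^sub>E (FO (finset_diagram X) F \<leadsto> FO (finset_diagram X) G))"
    by (auto simp: finset_diagram_def finset_cat_simps)
next
  fix F a
  assume "F \<in> Ob (finset_cat X)" "a \<in> elts (FO (finset_diagram X) F)"
  then show "FM (finset_diagram X) F F (Idn (finset_cat X) F) a = a"
    by (simp add: finset_diagram_def finset_cat_def)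
next
  fix F G H f g a
  assume "F \<in> Ob (finset_cat X)" "G \<in> Ob (finset_cat X)" "H \<in> Ob (finset_cat X)"
    "f \<in> Hom (finset_cat X) F G" "g \<in> Hom (finset_cat X) G H" "a \<in> elts (FO (finset_diagram X) F)"
  then show "FM (finset_diagram X) F H (Cmp (finset_cat X) F G H g f) a =
      FM (finset_diagram X) G H g (FM (finset_diagram X) F G f a)"
    by (auto simp: finset_diagram_def finset_cat_def)
qed

lemma is_colimit_finset_diagram:
  "is_colimit (finset_cat X) SET (finset_diagram X) X (\<lambda>F\<in>Ob (finset_cat X). \<lambda>x\<in>elts F. x)"
  unfolding is_colimit_def
proof (intro conjI allI impI)
  show "is_cocone (finset_cat X) SET (finset_diagram X) X (\<lambda>F\<in>Ob (finset_cat X). \<lambda>x\<in>elts F. x)"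
    unfolding is_cocone_def
    by (auto simp: finset_diagram_simps finset_cat_simps compose_def fun_eq_iff)
next
  fix Y k
  assume k: "is_cocone (finset_cat X) SET (finset_diagram X) Y k"
  have kF: "k F \<in> F \<leadsto> Y" if "F \<in> Ob (finset_cat X)" for F
    using k that unfolding is_cocone_def by (auto simp: PiE_iff finset_diagram_simps)
  have kFG: "k G x = k F x" if "F \<in> Ob (finset_cat X)" "G \<in> Ob (finset_cat X)" "elts F \<subseteq> elts G" "x \<in> elts F" for F G x
  proof -
    have "compose (elts F) (k G) (\<lambda>x\<in>elts F. x) = k F"
      using k that(1-3) unfolding is_cocone_def by (auto simp: finset_diagram_simps finset_cat_simps)
    then show ?thesis using that(4) by (metis compose_eq restrict_apply')
  qed
  \<comment> \<open>The value at \<open>x\<close> is forced by the leg at the singleton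
    \<open>{x}\<close>; the cocone condition for \<open>{x}\<close> inside \<open>F\<close> makes it
    agree with the leg at \<open>F\<close>.\<close>
  define f where "f = (\<lambda>x\<in>elts X. k (vset {x}) x)"
  have s: "vset {x} \<in> Ob (finset_cat X)" "elts (vset {x}) = {x}" if "x \<in> elts X" for x
    using that vset_finset(1)[of "{x}" X] vset_finset(2)[of "{x}"] by auto
  show "\<exists>!f. f \<in> Hom SET X Y \<and> (\<forall>F\<in>Ob (finset_cat X).
      Cmp SET (FO (finset_diagram X) F) X Y f ((\<lambda>F\<in>Ob (finset_cat X). \<lambda>x\<in>elts F. x) F) = k F)"
  proof (intro ex1I[of _ f] conjI ballI)
    show "f \<in> Hom SET X Y"
      using s kF by (auto simp: f_def PiE_iff)
  next
    fix F assume F: "F \<in> Ob (finset_cat X)"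
    have "f x = k F x" if "x \<in> elts F" for x
      using kFG[OF s(1) F, of x x] s(2)[of x] F that by (auto simp: f_def finset_cat_simps)
    then show "Cmp SET (FO (finset_diagram X) F) X Y f ((\<lambda>F\<in>Ob (finset_cat X). \<lambda>x\<in>elts F. x) F) = k F"
      using kF[OF F] F by (auto simp: finset_diagram_simps compose_def fun_eq_iff PiE_iff extensional_def)
  next
    fix g
    assume g: "g \<in> Hom SET X Y \<and> (\<forall>F\<in>Ob (finset_cat X).
      Cmp SET (FO (finset_diagram X) F) X Y g ((\<lambda>F\<in>Ob (finset_cat X). \<lambda>x\<in>elts F. x) F) = k F)"
    have "g x = k (vset {x}) x" if "x \<in> elts X" for x
    proof -
      have "compose (elts (vset {x})) g (\<lambda>x\<in>elts (vset {x}). x) = k (vset {x})"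
        using g s(1)[OF that] by (auto simp: finset_diagram_simps)
      then show ?thesis using s(2)[OF that] by (metis compose_eq restrict_apply' singletonI)
    qed
    then show "g = f"
      using g by (auto simp: f_def fun_eq_iff PiE_iff extensional_def)
  qed
qed

definition finitary :: "('u::set_universe, 'u \<Rightarrow> 'u, 'u, 'u \<Rightarrow> 'u) ftr \<Rightarrow> bool" where
  "finitary T \<longleftrightarrow> is_functor SET SET T \<and> preserves_filtered_colimits SET SET T TYPE('u)"

lemma finitary_functor: "finitary T \<Longrightarrow> is_functor SET SET T"
  by (simp add: finitary_def)

text \<open>The colimit property of \<open>T X\<close> over the finite subsets of \<open>X\<close>,
  freed from cocones and stated on elements. Its two halves are named separately because they do
  different work: the first builds maps out of \<open>T X\<close>, the second shows that the legs
  are jointly surjective.\<close>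

lemma finitary_colimit:
  fixes X Y :: "'u::set_universe"
  assumes T: "finitary T"
  shows finitary_ex: "\<And>k. (\<And>F. finite (elts F) \<Longrightarrow> elts F \<subseteq> elts X \<Longrightarrow> k F \<in> FO T F \<leadsto> Y)
      \<Longrightarrow> (\<And>F G t. finite (elts F) \<Longrightarrow> finite (elts G) \<Longrightarrow> elts F \<subseteq> elts G \<Longrightarrow> elts G \<subseteq> elts X
        \<Longrightarrow> t \<in> elts (FO T F) \<Longrightarrow> k G (FM T F G (\<lambda>x\<in>elts F. x) t) = k F t)
      \<Longrightarrow> \<exists>f\<in>FO T X \<leadsto> Y. \<forall>F. finite (elts F) \<longrightarrow> elts F \<subseteq> elts X \<longrightarrow>
          (\<forall>t\<in>elts (FO T F). f (FM T F X (\<lambda>x\<in>elts F. x) t) = k F t)"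
    and finitary_unique: "\<And>f g. f \<in> FO T X \<leadsto> Y \<Longrightarrow> g \<in> FO T X \<leadsto> Y \<Longrightarrow>
      (\<And>F t. finite (elts F) \<Longrightarrow> elts F \<subseteq> elts X \<Longrightarrow> t \<in> elts (FO T F) \<Longrightarrow>
        f (FM T F X (\<lambda>x\<in>elts F. x) t) = g (FM T F X (\<lambda>x\<in>elts F. x) t)) \<Longrightarrow> f = g"
proof -
  let ?J = "finset_cat X" and ?D = "ftr_comp (finset_cat X) T (finset_diagram X)"
  let ?l = "\<lambda>F\<in>Ob ?J. FM T (FO (finset_diagram X) F) X ((\<lambda>F\<in>Ob ?J. \<lambda>x\<in>elts F. x) F)"
  note TD = functor_SET_SET_D[OF finitary_functor[OF T]]
  have col: "is_colimit ?J SET ?D (FO T X) ?l"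
    using T is_small_category_finset_cat is_filtered_finset_cat is_functor_finset_diagram
      is_colimit_finset_diagram
    unfolding finitary_def preserves_filtered_colimits_def by blast
  have DO: "FO ?D F = FO T F" if "F \<in> Ob ?J" for F
    using that by (simp add: ftr_comp_def finset_diagram_simps)
  have DM: "FM ?D F G p = FM T F G (\<lambda>x\<in>elts F. x)" if "F \<in> Ob ?J" "G \<in> Ob ?J" "p \<in> Hom ?J F G" for F G p
    using that by (simp add: ftr_comp_def finset_diagram_simps)
  have incl: "(\<lambda>x\<in>elts F. x) \<in> F \<leadsto> G" if "elts F \<subseteq> elts G" for F G :: 'u
    using that by auto
  have ex1: "\<exists>!f. f \<in> FO T X \<leadsto> Y \<and>
      (\<forall>F\<in>Ob ?J. compose (elts (FO T F)) f (FM T F X (\<lambda>x\<in>elts F. x)) = k F)"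
    if k: "k \<in> (\<Pi>\<^sub>E F\<in>Ob ?J. FO T F \<leadsto> Y)"
      and kk: "\<And>F G t. F \<in> Ob ?J \<Longrightarrow> G \<in> Ob ?J \<Longrightarrow> elts F \<subseteq> elts G
        \<Longrightarrow> t \<in> elts (FO T F) \<Longrightarrow> k G (FM T F G (\<lambda>x\<in>elts F. x) t) = k F t" for k
  proof -
    have kF: "k F \<in> FO T F \<leadsto> Y" if "F \<in> Ob ?J" for F
      using k that by (auto simp: PiE_iff)
    have "is_cocone ?J SET ?D Y k"
      unfolding is_cocone_def
    proof (intro conjI ballI)
      show "k \<in> (\<Pi>\<^sub>E F\<in>Ob ?J. Hom SET (FO ?D F) Y)"
        using k by (auto simp: PiE_iff DO)
    next
      fix F G p assume *: "F \<in> Ob ?J" "G \<in> Ob ?J" "p \<in> Hom ?J F G"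
      then have "elts F \<subseteq> elts G" by (simp add: finset_cat_simps)
      have "compose (elts (FO T F)) (k G) (FM T F G (\<lambda>x\<in>elts F. x)) = k F"
        by (rule PiE_ext[OF compose_PiE[OF TD(1)[OF incl] kF] kF])
          (use * \<open>elts F \<subseteq> elts G\<close> in \<open>auto simp: compose_eq kk\<close>)
      then show "Cmp SET (FO ?D F) (FO ?D G) Y (k G) (FM ?D F G p) = k F"
        using * by (simp add: DO DM)
    qed simp
    then have "\<exists>!f. f \<in> Hom SET (FO T X) Y \<and> (\<forall>F\<in>Ob ?J. Cmp SET (FO ?D F) (FO T X) Y f (?l F) = k F)"
      using col unfolding is_colimit_def by blast
    moreover have "Cmp SET (FO ?D F) (FO T X) Y f (?l F) = compose (elts (FO T F)) f (FM T F X (\<lambda>x\<in>elts F. x))"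
      if "F \<in> Ob ?J" for F f
      using that by (simp add: DO finset_diagram_simps)
    ultimately show ?thesis by (simp cong: ball_cong)
  qed
  show "\<exists>f\<in>FO T X \<leadsto> Y. \<forall>F. finite (elts F) \<longrightarrow> elts F \<subseteq> elts X \<longrightarrow>
          (\<forall>t\<in>elts (FO T F). f (FM T F X (\<lambda>x\<in>elts F. x) t) = k F t)"
    if k: "\<And>F. finite (elts F) \<Longrightarrow> elts F \<subseteq> elts X \<Longrightarrow> k F \<in> FO T F \<leadsto> Y"
      and kk: "\<And>F G t. finite (elts F) \<Longrightarrow> finite (elts G) \<Longrightarrow> elts F \<subseteq> elts G \<Longrightarrow> elts G \<subseteq> elts X
        \<Longrightarrow> t \<in> elts (FO T F) \<Longrightarrow> k G (FM T F G (\<lambda>x\<in>elts F. x) t) = k F t" for k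
  proof -
    have "restrict k (Ob ?J) \<in> (\<Pi>\<^sub>E F\<in>Ob ?J. FO T F \<leadsto> Y)"
      by (rule restrict_PiE_iff[THEN iffD2]) (simp add: k finset_cat_simps)
    then have "\<exists>!f. f \<in> FO T X \<leadsto> Y \<and>
        (\<forall>F\<in>Ob ?J. compose (elts (FO T F)) f (FM T F X (\<lambda>x\<in>elts F. x)) = restrict k (Ob ?J) F)"
      by (rule ex1) (use kk in \<open>auto simp: finset_cat_simps\<close>)
    then obtain f where f: "f \<in> FO T X \<leadsto> Y"
      "\<forall>F\<in>Ob ?J. compose (elts (FO T F)) f (FM T F X (\<lambda>x\<in>elts F. x)) = restrict k (Ob ?J) F" by blast
    have "f (FM T F X (\<lambda>x\<in>elts F. x) t) = k F t"
      if "finite (elts F)" "elts F \<subseteq> elts X" "t \<in> elts (FO T F)" for F t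
    proof -
      have F: "F \<in> Ob ?J" using that by (simp add: finset_cat_simps)
      then have "compose (elts (FO T F)) f (FM T F X (\<lambda>x\<in>elts F. x)) t = k F t"
        using f(2) by simp
      then show ?thesis using that(3) by (simp only: compose_eq)
    qed
    then show ?thesis using f(1) by blast
  qed
  show "f = g"
    if f: "f \<in> FO T X \<leadsto> Y" and g: "g \<in> FO T X \<leadsto> Y" and
      fg: "\<And>F t. finite (elts F) \<Longrightarrow> elts F \<subseteq> elts X \<Longrightarrow> t \<in> elts (FO T F) \<Longrightarrow>
        f (FM T F X (\<lambda>x\<in>elts F. x) t) = g (FM T F X (\<lambda>x\<in>elts F. x) t)" for f g
  proof -
    \<comment> \<open>Both maps are mediating for the cocone that \<open>f\<close> itself induces,
      so the uniqueness part of \<open>ex1\<close> identifies them.\<close>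
    define k where "k = (\<lambda>F\<in>Ob ?J. compose (elts (FO T F)) f (FM T F X (\<lambda>x\<in>elts F. x)))"
    have "k \<in> (\<Pi>\<^sub>E F\<in>Ob ?J. FO T F \<leadsto> Y)"
      unfolding k_def
      by (rule restrict_PiE_iff[THEN iffD2], intro ballI compose_PiE[OF TD(1)[OF incl] f])
        (simp add: finset_cat_simps)
    then have "\<exists>!f. f \<in> FO T X \<leadsto> Y \<and>
        (\<forall>F\<in>Ob ?J. compose (elts (FO T F)) f (FM T F X (\<lambda>x\<in>elts F. x)) = k F)"
    proof (rule ex1)
      fix F G t assume *: "F \<in> Ob ?J" "G \<in> Ob ?J" "elts F \<subseteq> elts G" "t \<in> elts (FO T F)"
      have "FM T G X (\<lambda>x\<in>elts G. x) (FM T F G (\<lambda>x\<in>elts F. x) t) =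
        FM T F X (compose (elts F) (\<lambda>x\<in>elts G. x) (\<lambda>x\<in>elts F. x)) t"
        by (rule TD(4)[symmetric]) (use * in \<open>auto simp: finset_cat_simps\<close>)
      also have "compose (elts F) (\<lambda>x\<in>elts G. x) (\<lambda>x\<in>elts F. x) = (\<lambda>x\<in>elts F. x)"
        using *(3) by (auto simp: compose_def fun_eq_iff)
      finally have eq: "FM T G X (\<lambda>x\<in>elts G. x) (FM T F G (\<lambda>x\<in>elts F. x) t) =
        FM T F X (\<lambda>x\<in>elts F. x) t" .
      have "k G (FM T F G (\<lambda>x\<in>elts F. x) t) =
          f (FM T G X (\<lambda>x\<in>elts G. x) (FM T F G (\<lambda>x\<in>elts F. x) t))"
        using * TD(2)[OF incl[OF *(3)] *(4)] by (simp add: k_def compose_eq)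
      also have "\<dots> = k F t"
        unfolding eq using * by (simp add: k_def compose_eq)
      finally show "k G (FM T F G (\<lambda>x\<in>elts F. x) t) = k F t" .
    qed
    moreover have "\<forall>F\<in>Ob ?J. compose (elts (FO T F)) g (FM T F X (\<lambda>x\<in>elts F. x)) = k F"
      using fg by (auto simp: k_def compose_def finset_cat_simps)
    moreover have "\<forall>F\<in>Ob ?J. compose (elts (FO T F)) f (FM T F X (\<lambda>x\<in>elts F. x)) = k F"
      by (simp add: k_def)
    ultimately show ?thesis using f g by blast
  qed
qed

section \<open>Presentations of elements of \<open>T X\<close> by finite cardinals\<close>

lemma ex_FIN_iso:
  assumes "finite (elts (F::'u::set_universe))"
  shows "\<exists>n::'u\<in>Ob FIN. \<exists>e\<in>n \<leadsto> F. \<exists>i\<in>F \<leadsto> n.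
    (\<forall>x\<in>elts F. e (i x) = x) \<and> (\<forall>j\<in>elts n. i (e j) = j)"
proof -
  obtain n e where e: "bij_betw e (elts (vnat n :: 'u)) (elts F)"
    using ex_bij_vnat[OF assms] by blast
  define i where "i = inv_into (elts (vnat n)) e"
  have i: "bij_betw i (elts F) (elts (vnat n))"
    unfolding i_def by (rule bij_betw_inv_into[OF e])
  have "e j \<in> elts F" if "j \<in> elts (vnat n)" for j using e that by (rule bij_betwE[THEN bspec])
  moreover have "i x \<in> elts (vnat n)" if "x \<in> elts F" for x using i that by (rule bij_betwE[THEN bspec])
  moreover have "e (i x) = x" if "x \<in> elts F" for x
    unfolding i_def using bij_betw_inv_into_right[OF e that] .
  moreover have "i (e j) = j" if "j \<in> elts (vnat n)" for j
    unfolding i_def using bij_betw_inv_into_left[OF e that] .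
  ultimately show ?thesis
    by - (rule bexI[of _ "vnat n :: 'u"], rule bexI[of _ "restrict e (elts (vnat n))"],
        rule bexI[of _ "restrict i (elts F)"], simp_all)
qed


text \<open>Existence half of the statement that \<open>T\<close> is the left Kan extension of its
  restriction to \<open>FIN\<close>: a function on presentations \<open>T b a\<close> that respects
  the coend relation descends to \<open>T X\<close>.\<close>

lemma finitary_lift:
  fixes X Y :: "'u::set_universe"
  assumes T: "finitary T"
    and h: "\<And>m a b. m \<in> Ob FIN \<Longrightarrow> a \<in> elts (FO T m) \<Longrightarrow> b \<in> m \<leadsto> X \<Longrightarrow> h m a b \<in> elts Y"
    and glue: "\<And>m m' s a b. m \<in> Ob FIN \<Longrightarrow> m' \<in> Ob FIN \<Longrightarrow> s \<in> m \<leadsto> m' \<Longrightarrow>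
      a \<in> elts (FO T m) \<Longrightarrow> b \<in> m' \<leadsto> X \<Longrightarrow>
      h m a (compose (elts m) b s) = h m' (FM T m m' s a) b"
  shows "\<exists>f\<in>FO T X \<leadsto> Y. \<forall>m\<in>Ob FIN. \<forall>a\<in>elts (FO T m). \<forall>b\<in>m \<leadsto> X.
    f (FM T m X b a) = h m a b"
proof -
  note TD = functor_SET_SET_D[OF finitary_functor[OF T]]
  obtain n e i where nei: "\<And>F::'u. finite (elts F) \<Longrightarrow> (n F :: 'u) \<in> Ob FIN"
    "\<And>F::'u. finite (elts F) \<Longrightarrow> e F \<in> (n F :: 'u) \<leadsto> F"
    "\<And>F::'u. finite (elts F) \<Longrightarrow> i F \<in> F \<leadsto> n F"
    "\<And>(F::'u) x. finite (elts F) \<Longrightarrow> x \<in> elts F \<Longrightarrow> e F (i F x) = x"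
    using ex_FIN_iso by metis
  have eX: "e F \<in> n F \<leadsto> G" if "finite (elts F)" "elts F \<subseteq> elts G" for F G
    using nei(2)[OF that(1)] that(2) by (auto simp: PiE_iff)
  \<comment> \<open>The leg at \<open>F\<close> presents \<open>t\<close> through the chosen
    bijection of \<open>F\<close> with the cardinal \<open>n F\<close>. By \<open>glue\<close>,
    every other presentation gives the same value (\<open>k_rep\<close>), so the legs are compatible
    although the bijections chosen for nested subsets need not be.\<close>
  define k where "k = (\<lambda>F. \<lambda>t\<in>elts (FO T F). h (n F) (FM T F (n F) (i F) t) (e F))"
  have k_rep: "k F (FM T m F b a) = h m a b"
    if "finite (elts F)" "elts F \<subseteq> elts X" "m \<in> Ob FIN" "a \<in> elts (FO T m)" "b \<in> m \<leadsto> F" for F m a b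
  proof -
    have "k F (FM T m F b a) = h (n F) (FM T F (n F) (i F) (FM T m F b a)) (e F)"
      using that by (simp add: k_def TD(2))
    also have "FM T F (n F) (i F) (FM T m F b a) = FM T m (n F) (compose (elts m) (i F) b) a"
      using that nei by (simp add: TD(4))
    also have "h (n F) \<dots> (e F) = h m a (compose (elts m) (e F) (compose (elts m) (i F) b))"
      by (rule glue[symmetric, OF that(3) nei(1)[OF that(1)] compose_PiE[OF that(5) nei(3)[OF that(1)]]
          that(4) eX[OF that(1,2)]])
    also have "compose (elts m) (e F) (compose (elts m) (i F) b) = b"
      using that(1,5) nei(4)[OF that(1)] by (auto simp: compose_def fun_eq_iff PiE_iff extensional_def)
    finally show ?thesis .
  qed
  have rep: "\<exists>a\<in>elts (FO T (n F)). t = FM T (n F) F (e F) a" if "finite (elts F)" "t \<in> elts (FO T F)" for F t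
  proof
    show "FM T F (n F) (i F) t \<in> elts (FO T (n F))"
      using that nei by (simp add: TD(2))
    have "compose (elts F) (e F) (i F) = (\<lambda>x\<in>elts F. x)"
      using nei(4)[OF that(1)] by (auto simp: compose_def)
    then show "t = FM T (n F) F (e F) (FM T F (n F) (i F) t)"
      using that nei TD(3) by (simp flip: TD(4))
  qed
  have "\<exists>f\<in>FO T X \<leadsto> Y. \<forall>F. finite (elts F) \<longrightarrow> elts F \<subseteq> elts X \<longrightarrow>
          (\<forall>t\<in>elts (FO T F). f (FM T F X (\<lambda>x\<in>elts F. x) t) = k F t)"
  proof (rule finitary_ex[OF T])
    fix F assume F: "finite (elts F)" "elts F \<subseteq> elts X"
    then show "k F \<in> FO T F \<leadsto> Y"
      unfolding k_def using nei eX by (simp add: h TD(2))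
  next
    fix F G t
    assume *: "finite (elts F)" "finite (elts G)" "elts F \<subseteq> elts G" "elts G \<subseteq> elts X" "t \<in> elts (FO T F)"
    then obtain a where a: "a \<in> elts (FO T (n F))" "t = FM T (n F) F (e F) a"
      using rep by blast
    have "FM T F G (\<lambda>x\<in>elts F. x) t = FM T (n F) G (compose (elts (n F)) (\<lambda>x\<in>elts F. x) (e F)) a"
      unfolding a(2) by (rule TD(4)[symmetric]) (use * nei a in auto)
    also have "compose (elts (n F)) (\<lambda>x\<in>elts F. x) (e F) = e F"
      by (rule compose_id_PiE(2)) (rule nei(2)[OF *(1)])
    finally have "FM T F G (\<lambda>x\<in>elts F. x) t = FM T (n F) G (e F) a" .
    then have "k G (FM T F G (\<lambda>x\<in>elts F. x) t) = k G (FM T (n F) G (e F) a)"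
      by (rule arg_cong)
    also have "\<dots> = h (n F) a (e F)"
      using * a(1) nei(1) eX by (simp add: k_rep)
    also have "\<dots> = k F t"
      unfolding a(2) using * a(1) nei(1) eX by (subst k_rep) auto
    finally show "k G (FM T F G (\<lambda>x\<in>elts F. x) t) = k F t" .
  qed
  then obtain f where f: "f \<in> FO T X \<leadsto> Y"
    "\<And>F t. finite (elts F) \<Longrightarrow> elts F \<subseteq> elts X \<Longrightarrow> t \<in> elts (FO T F) \<Longrightarrow>
       f (FM T F X (\<lambda>x\<in>elts F. x) t) = k F t" by blast
  have "f (FM T m X b a) = h m a b"
    if "m \<in> Ob FIN" "a \<in> elts (FO T m)" "b \<in> m \<leadsto> X" for m a b
  proof -
    \<comment> \<open>A finite tuple \<open>b\<close> factors through its image, which is one of the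
      finite subsets in the diagram.\<close>
    define F where "F = vset (b ` elts m)"
    have fin: "finite (b ` elts m)"
      using that(1) by (auto simp: Ob_FIN elts_vnat simp del: vnat.simps)
    then have eF: "elts F = b ` elts m"
      by (simp add: F_def elts_vset small_finite)
    then have F: "finite (elts F)" "elts F \<subseteq> elts X"
      using fin that(3) by (auto simp: PiE_iff)
    have b: "b \<in> m \<leadsto> F"
      using that(3) by (auto simp: eF PiE_iff)
    have "FM T m X b a = FM T m X (compose (elts m) (\<lambda>x\<in>elts F. x) b) a"
      by (subst compose_id_PiE(2)[OF b]) (rule refl)
    also have "\<dots> = FM T F X (\<lambda>x\<in>elts F. x) (FM T m F b a)"
      by (rule TD(4)) (use b F that in auto)
    finally have "f (FM T m X b a) = f (FM T F X (\<lambda>x\<in>elts F. x) (FM T m F b a))"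
      by (rule arg_cong)
    then show ?thesis
      by (rule trans) (simp only: f(2)[OF F TD(2)[OF b that(2)]] k_rep[OF F that(1,2) b])
  qed
  then show ?thesis using f(1) by blast
qed

text \<open>Joint surjectivity is squeezed out of uniqueness alone. Two maps from \<open>T X\<close>
  to the two-element set \<open>vnat 2\<close>, the constant \<open>vnat 0\<close> and the one
  separating presentable elements from the rest, agree on every leg because elements coming from
  \<open>T F\<close> are presentable; hence they are equal.\<close>

lemma finitary_rep:
  fixes X :: "'u::set_universe"
  assumes T: "finitary T" and t: "t \<in> elts (FO T X)"
  obtains m a b where "m \<in> Ob FIN" "a \<in> elts (FO T m)" "b \<in> m \<leadsto> X" "t = FM T m X b a"
proof -
  note TD = functor_SET_SET_D[OF finitary_functor[OF T]]
  let ?P = "\<lambda>t. \<exists>m\<in>Ob FIN. \<exists>a\<in>elts (FO T m). \<exists>b\<in>m \<leadsto> X. t = FM T m X b a"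
  let ?f = "\<lambda>t\<in>elts (FO T X). vnat 0 :: 'u"
  let ?g = "\<lambda>t\<in>elts (FO T X). if ?P t then vnat 0 else vnat 1 :: 'u"
  have v: "vnat 0 \<in> elts (vnat 2 :: 'u)" "vnat 1 \<in> elts (vnat 2 :: 'u)"
    unfolding elts_vnat by (rule imageI, simp)+
  have v3: "vnat 0 \<noteq> (vnat 1 :: 'u)"
    using inj_vnat[where 'u = 'u] by (simp add: inj_eq del: vnat.simps)
  have "?f = ?g"
  proof (rule finitary_unique[OF T, of _ X "vnat 2"])
    fix F t assume *: "finite (elts F)" "elts F \<subseteq> elts X" "t \<in> elts (FO T F)"
    obtain n :: 'u and e i where nei: "n \<in> Ob FIN" "e \<in> n \<leadsto> F" "i \<in> F \<leadsto> n"
      "\<And>x. x \<in> elts F \<Longrightarrow> e (i x) = x"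
      using ex_FIN_iso[OF *(1)] by blast
    have incl: "(\<lambda>x\<in>elts F. x) \<in> F \<leadsto> X" using *(2) by auto
    have eX: "e \<in> n \<leadsto> X" using nei(2) *(2) by (auto simp: PiE_iff)
    have "FM T F X (\<lambda>x\<in>elts F. x) t = FM T F X (compose (elts F) e i) t"
      by (rule arg_cong[where f = "\<lambda>u. FM T F X u t"]) (auto simp: compose_def nei)
    also have "\<dots> = FM T n X e (FM T F n i t)"
      by (rule TD(4)[OF nei(3) eX *(3)])
    finally have "?P (FM T F X (\<lambda>x\<in>elts F. x) t)"
      using nei eX TD(2)[OF nei(3) *(3)] by blast
    then show "?f (FM T F X (\<lambda>x\<in>elts F. x) t) = ?g (FM T F X (\<lambda>x\<in>elts F. x) t)"
      by (simp del: vnat.simps)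
  qed (use v in \<open>auto simp del: vnat.simps\<close>)
  then have "?f t = ?g t" by (rule fun_cong)
  then have "?P t" using t v3 by (simp split: if_splits del: vnat.simps)
  then show ?thesis using that by blast
qed

text \<open>The uniqueness that goes with \<open>finitary_lift\<close>: presentations exhaust
  \<open>T X\<close>.\<close>

lemma finitary_ext:
  fixes X :: "'u::set_universe"
  assumes T: "finitary T" and "f \<in> elts (FO T X) \<rightarrow>\<^sub>E A" "g \<in> elts (FO T X) \<rightarrow>\<^sub>E B"
    and eq: "\<And>m a b. m \<in> Ob FIN \<Longrightarrow> a \<in> elts (FO T m) \<Longrightarrow> b \<in> m \<leadsto> X \<Longrightarrow>
      f (FM T m X b a) = g (FM T m X b a)"
  shows "f = g"
proof (rule PiE_eqI[OF assms(2,3)])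
  fix t assume "t \<in> elts (FO T X)"
  then obtain m :: 'u and a b where "m \<in> Ob FIN" "a \<in> elts (FO T m)" "b \<in> m \<leadsto> X" "t = FM T m X b a"
    by (rule finitary_rep[OF T])
  then show "f t = g t" using eq by simp
qed

text \<open>One cardinal \<open>n\<close> serves all entries of a finite tuple in
  \<open>T X\<close>: the supports of the entries are finitely many finite subsets of
  \<open>X\<close>, and their union is again finite. It lets an element of \<open>T (T X)\<close> be
  traced back to \<open>T (T n)\<close>.\<close>

lemma finitary_rep_family:
  fixes X m :: "'u::set_universe"
  assumes T: "finitary T" and m: "m \<in> Ob FIN" and b: "b \<in> m \<leadsto> FO T X"
  obtains n c b' where "n \<in> Ob FIN" "c \<in> n \<leadsto> X" "b' \<in> m \<leadsto> FO T n"
    "b = compose (elts m) (FM T n X c) b'"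
proof -
  note TD = functor_SET_SET_D[OF finitary_functor[OF T]]
  have "\<exists>k a c. k \<in> Ob FIN \<and> a \<in> elts (FO T k) \<and> c \<in> k \<leadsto> X \<and> b j = FM T k X c a"
    if "j \<in> elts m" for j
    using finitary_rep[OF T PiE_app[OF b that]] by metis
  then obtain k a c where kac: "\<And>j. j \<in> elts m \<Longrightarrow> (k j :: 'u) \<in> Ob FIN"
    "\<And>j. j \<in> elts m \<Longrightarrow> a j \<in> elts (FO T (k j))"
    "\<And>j. j \<in> elts m \<Longrightarrow> c j \<in> k j \<leadsto> X"
    "\<And>j. j \<in> elts m \<Longrightarrow> b j = FM T (k j) X (c j) (a j)"
    by metis
  define F where "F = vset (\<Union>j\<in>elts m. c j ` elts (k j))"
  have fin: "finite (elts j)" if "j \<in> Ob FIN" for j :: 'u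
    using that by (auto simp: Ob_FIN elts_vnat simp del: vnat.simps)
  then have finU: "finite (\<Union>j\<in>elts m. c j ` elts (k j))"
    using m kac(1) by blast
  then have eF: "elts F = (\<Union>j\<in>elts m. c j ` elts (k j))"
    by (simp add: F_def elts_vset small_finite)
  have cF: "c j \<in> k j \<leadsto> F" if "j \<in> elts m" for j
    using kac(3)[OF that] that by (auto simp: eF PiE_iff)
  have FX: "elts F \<subseteq> elts X" using kac(3) by (auto simp: eF PiE_iff)
  obtain n :: 'u and e i where nei: "n \<in> Ob FIN" "e \<in> n \<leadsto> F" "i \<in> F \<leadsto> n"
    "\<And>x. x \<in> elts F \<Longrightarrow> e (i x) = x"
    using ex_FIN_iso[of F] finU eF by metis
  have eX: "e \<in> n \<leadsto> X" using nei(2) FX by (auto simp: PiE_iff)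
  \<comment> \<open>\<open>i\<close> carries each support into the common cardinal; \<open>e\<close>
    after \<open>i\<close> is the identity on \<open>F\<close>, so \<open>T e\<close> returns the
    original entries.\<close>
  define b' where "b' = (\<lambda>j\<in>elts m. FM T (k j) n (compose (elts (k j)) i (c j)) (a j))"
  have ic: "compose (elts (k j)) i (c j) \<in> k j \<leadsto> n" if "j \<in> elts m" for j
    by (rule compose_PiE[OF cF[OF that] nei(3)])
  have b': "b' \<in> m \<leadsto> FO T n"
    unfolding b'_def using TD(2)[OF ic kac(2)] by simp
  have "FM T n X e (b' j) = b j" if j: "j \<in> elts m" for j
  proof -
    have "FM T n X e (b' j) = FM T (k j) X (compose (elts (k j)) e (compose (elts (k j)) i (c j))) (a j)"
      unfolding b'_def using j TD(4)[OF ic[OF j] eX kac(2)[OF j]] by simp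
    also have "compose (elts (k j)) e (compose (elts (k j)) i (c j)) = c j"
      using cF[OF j] nei(4) by (auto simp: compose_def fun_eq_iff PiE_iff extensional_def)
    finally show ?thesis using kac(4)[OF j] by simp
  qed
  then have "b = compose (elts m) (FM T n X e) b'"
    using b by (auto simp: compose_def fun_eq_iff PiE_iff extensional_def)
  then show ?thesis using that nei(1) eX b' by blast
qed

declare vnat.simps [simp del]

subsection \<open>The monoidal structure on \<open>[F, Set]\<close>, elementwise\<close>

lemma nat_trans_SET_I:
  assumes F: "is_functor C SET F" and G: "is_functor C SET G"
    and "\<alpha> \<in> extensional (Ob C)"
    and \<alpha>: "\<And>x. x \<in> Ob C \<Longrightarrow> \<alpha> x \<in> FO F x \<leadsto> FO G x"
    and nat: "\<And>x y f a. x \<in> Ob C \<Longrightarrow> y \<in> Ob C \<Longrightarrow> f \<in> Hom C x y \<Longrightarrow> a \<in> elts (FO F x)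
      \<Longrightarrow> \<alpha> y (FM F x y f a) = FM G x y f (\<alpha> x a)"
  shows "\<alpha> \<in> nat_trans C SET F G"
proof -
  have "\<alpha> \<in> (\<Pi>\<^sub>E x\<in>Ob C. FO F x \<leadsto> FO G x)"
    using assms(3) \<alpha> unfolding PiE_def Pi_def by blast
  moreover have "compose (elts (FO F x)) (\<alpha> y) (FM F x y f) = compose (elts (FO F x)) (FM G x y f) (\<alpha> x)"
    if "x \<in> Ob C" "y \<in> Ob C" "f \<in> Hom C x y" for x y f
    using nat[OF that] by (simp add: compose_def cong: restrict_cong)
  ultimately show ?thesis
    unfolding nat_trans_def by simp
qed

lemma nat_trans_SET_D:
  assumes "\<alpha> \<in> nat_trans C SET F G"
  shows "\<alpha> \<in> extensional (Ob C)"
    "x \<in> Ob C \<Longrightarrow> \<alpha> x \<in> FO F x \<leadsto> FO G x"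
    "x \<in> Ob C \<Longrightarrow> a \<in> elts (FO F x) \<Longrightarrow> \<alpha> x a \<in> elts (FO G x)"
    "x \<in> Ob C \<Longrightarrow> y \<in> Ob C \<Longrightarrow> f \<in> Hom C x y \<Longrightarrow> a \<in> elts (FO F x)
      \<Longrightarrow> \<alpha> y (FM F x y f a) = FM G x y f (\<alpha> x a)"
proof -
  have \<alpha>: "\<alpha> \<in> (\<Pi>\<^sub>E x\<in>Ob C. FO F x \<leadsto> FO G x)"
    and nat: "\<And>x y f. x \<in> Ob C \<Longrightarrow> y \<in> Ob C \<Longrightarrow> f \<in> Hom C x y \<Longrightarrow>
      compose (elts (FO F x)) (\<alpha> y) (FM F x y f) = compose (elts (FO F x)) (FM G x y f) (\<alpha> x)"
    using assms unfolding nat_trans_def by simp_all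
  show "\<alpha> \<in> extensional (Ob C)" using \<alpha> by (simp add: PiE_def)
  show *: "\<alpha> x \<in> FO F x \<leadsto> FO G x" if "x \<in> Ob C" for x
    using \<alpha> that by (rule PiE_mem)
  show "x \<in> Ob C \<Longrightarrow> a \<in> elts (FO F x) \<Longrightarrow> \<alpha> x a \<in> elts (FO G x)"
    using * by (rule PiE_app)
  show "\<alpha> y (FM F x y f a) = FM G x y f (\<alpha> x a)"
    if "x \<in> Ob C" "y \<in> Ob C" "f \<in> Hom C x y" "a \<in> elts (FO F x)"
    using fun_cong[OF nat[OF that(1-3)], of a] that(4) by (simp only: compose_eq)
qed

lemma nat_trans_SET_eqI:
  assumes "\<alpha> \<in> nat_trans C SET F G" "\<beta> \<in> nat_trans C SET F G'"
    and "\<And>x a. x \<in> Ob C \<Longrightarrow> a \<in> elts (FO F x) \<Longrightarrow> \<alpha> x a = \<beta> x a"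
  shows "\<alpha> = \<beta>"
proof (rule extensionalityI)
  fix x assume x: "x \<in> Ob C"
  show "\<alpha> x = \<beta> x"
    by (rule PiE_eqI[OF nat_trans_SET_D(2)[OF assms(1) x] nat_trans_SET_D(2)[OF assms(2) x]])
      (rule assms(3)[OF x])
qed (use assms nat_trans_SET_D(1) in blast)+

lemma nat_trans_FIN_natural:
  "\<alpha> \<in> nat_trans FIN SET A B \<Longrightarrow> m \<in> Ob FIN \<Longrightarrow> n \<in> Ob FIN \<Longrightarrow> s \<in> m \<leadsto> n
    \<Longrightarrow> a \<in> elts (FO A m) \<Longrightarrow> \<alpha> n (FM A m n s a) = FM B m n s (\<alpha> m a)"
  by (erule nat_trans_SET_D(4)) simp_all

lemma FSet_simps [simp]:
  "Ob FSet = {A. is_functor FIN SET A}" "Hom FSet = nat_trans FIN SET"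
  "Unt FSet = incl" "TO FSet = tens" "TM FSet = tens_map" "Asc FSet = tens_assoc"
  "Lun FSet = tens_lunit" "Run FSet = tens_runit"
  by (simp_all add: FSet_def fun_cat_def)

lemma Idn_FSet: "Idn FSet A = (\<lambda>n\<in>Ob FIN. \<lambda>x\<in>elts (FO A n). x)"
  by (simp add: FSet_def fun_cat_def)

lemma Cmp_FSet: "Cmp FSet A B C \<beta> \<alpha> = (\<lambda>n\<in>Ob FIN. compose (elts (FO A n)) (\<beta> n) (\<alpha> n))"
  by (simp add: FSet_def fun_cat_def)

lemma Idn_FSet_apply [simp]: "n \<in> Ob FIN \<Longrightarrow> x \<in> elts (FO A n) \<Longrightarrow> Idn FSet A n x = x"
  by (simp add: Idn_FSet)

lemma Cmp_FSet_apply [simp]: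
  "n \<in> Ob FIN \<Longrightarrow> x \<in> elts (FO A n) \<Longrightarrow> Cmp FSet A B C \<beta> \<alpha> n x = \<beta> n (\<alpha> n x)"
  by (simp add: Cmp_FSet compose_eq)

text \<open>Composition in \<open>FSet\<close> depends on no object but the source \<open>A\<close>,
  hence the unrelated intermediate objects and targets on the two sides.\<close>

lemma Cmp_FSet_eqI:
  "(\<And>n x. n \<in> Ob FIN \<Longrightarrow> x \<in> elts (FO A n) \<Longrightarrow> \<beta> n (\<alpha> n x) = \<beta>' n (\<alpha>' n x))
    \<Longrightarrow> Cmp FSet A B C \<beta> \<alpha> = Cmp FSet A B' C' \<beta>' \<alpha>'"
  by (simp add: Cmp_FSet compose_def cong: restrict_cong)

lemma Idn_FSet_in: 
  assumes "is_functor FIN SET A"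
  shows "Idn FSet A \<in> nat_trans FIN SET A A"
  by (rule nat_trans_SET_I[OF assms assms])
    (simp_all add: Idn_FSet functor_FIN_SET_D[OF assms])

lemma Cmp_FSet_in:
  assumes "is_functor FIN SET A" "is_functor FIN SET C"
    "\<alpha> \<in> nat_trans FIN SET A B" "\<beta> \<in> nat_trans FIN SET B C"
  shows "Cmp FSet A B C \<beta> \<alpha> \<in> nat_trans FIN SET A C"
proof (rule nat_trans_SET_I[OF assms(1,2)])
  show "Cmp FSet A B C \<beta> \<alpha> \<in> extensional (Ob FIN)" by (simp add: Cmp_FSet)
  show "Cmp FSet A B C \<beta> \<alpha> n \<in> FO A n \<leadsto> FO C n" if "n \<in> Ob FIN" for n
    using compose_PiE[OF nat_trans_SET_D(2)[OF assms(3) that] nat_trans_SET_D(2)[OF assms(4) that]] that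
    by (simp add: Cmp_FSet)
  show "Cmp FSet A B C \<beta> \<alpha> n (FM A m n s a) = FM C m n s (Cmp FSet A B C \<beta> \<alpha> m a)"
    if "m \<in> Ob FIN" "n \<in> Ob FIN" "s \<in> Hom FIN m n" "a \<in> elts (FO A m)" for m n s a
    using that functor_FIN_SET_D[OF assms(1)] nat_trans_SET_D[OF assms(3)] nat_trans_SET_D[OF assms(4)]
    by simp
qed

lemma Cmp_FSet_eqI':
  assumes "\<gamma> \<in> nat_trans FIN SET A C'"
    "\<And>n x. n \<in> Ob FIN \<Longrightarrow> x \<in> elts (FO A n) \<Longrightarrow> \<beta> n (\<alpha> n x) = \<gamma> n x"
  shows "Cmp FSet A B C \<beta> \<alpha> = \<gamma>"
proof -
  have "Cmp FSet A B C \<beta> \<alpha> = Cmp FSet A A C' \<gamma> (Idn FSet A)"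
    by (rule Cmp_FSet_eqI) (simp add: assms(2))
  also have "\<dots> = \<gamma>"
  proof (rule extensionalityI[of _ "Ob FIN"])
    fix n :: 'a assume n: "n \<in> Ob FIN"
    show "Cmp FSet A A C' \<gamma> (Idn FSet A) n = \<gamma> n"
      by (rule PiE_eqI[OF _ nat_trans_SET_D(2)[OF assms(1) n], of _ UNIV]) (simp_all add: n Cmp_FSet compose_def)
  qed (use nat_trans_SET_D(1)[OF assms(1)] in \<open>simp_all add: Cmp_FSet\<close>)
  finally show ?thesis .
qed

text \<open>\<open>inv_arrow\<close> is a definite description, settled by exhibiting an elementwise
  inverse. This is how the inverse unitors in the definitions of enriched transformations and their
  composites become computable.\<close>

lemma inv_arrow_FSet:
  assumes f: "f \<in> nat_trans FIN SET A B" and g: "g \<in> nat_trans FIN SET B A"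
    and gf: "\<And>n x. n \<in> Ob FIN \<Longrightarrow> x \<in> elts (FO A n) \<Longrightarrow> g n (f n x) = x"
    and fg: "\<And>n y. n \<in> Ob FIN \<Longrightarrow> y \<in> elts (FO B n) \<Longrightarrow> f n (g n y) = y"
  shows "inv_arrow FSet A B f = g"
  unfolding inv_arrow_def
proof (rule the_equality)
  show "inverse_arrows FSet A B f g"
    unfolding inverse_arrows_def using f g
    by (simp add: Cmp_FSet Idn_FSet compose_def gf fg cong: restrict_cong)
next
  fix g' assume g': "inverse_arrows FSet A B f g'"
  show "g' = g"
  proof (rule nat_trans_SET_eqI[OF _ g])
    show "g' \<in> nat_trans FIN SET B A" using g' by (simp add: inverse_arrows_def)
    fix n y assume n: "n \<in> Ob FIN" and y: "y \<in> elts (FO B n)"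
    then have x: "g n y \<in> elts (FO A n)" using nat_trans_SET_D(3)[OF g] by blast
    have "Cmp FSet A B A g' f n (g n y) = Idn FSet A n (g n y)"
      using g' by (simp add: inverse_arrows_def)
    then show "g' n y = g n y" using n x fg[OF n y] by simp
  qed
qed

lemma coend_lift_PiE:
  assumes "is_functor FIN SET A"
    and "\<And>m m' s a b. m \<in> Ob FIN \<Longrightarrow> m' \<in> Ob FIN \<Longrightarrow> s \<in> m \<leadsto> m' \<Longrightarrow>
      a \<in> elts (FO A m) \<Longrightarrow> b \<in> m' \<leadsto> N \<Longrightarrow>
      h m a (compose (elts m) b s) = h m' (FM A m m' s a) b"
    and "\<And>m a b. m \<in> Ob FIN \<Longrightarrow> a \<in> elts (FO A m) \<Longrightarrow> b \<in> m \<leadsto> N \<Longrightarrow> h m a b \<in> Y"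
  shows "coend_lift A N h \<in> elts (coend A N) \<rightarrow>\<^sub>E Y"
proof (rule PiE_I)
  fix c assume "c \<in> elts (coend A N)"
  then obtain m a b where *: "m \<in> Ob FIN" "a \<in> elts (FO A m)" "b \<in> m \<leadsto> N"
    and c: "c = coend_class A N m a b" by (rule coendE)
  show "coend_lift A N h c \<in> Y"
    unfolding c using * assms(3) by (subst coend_lift_class[OF assms(1,2)])
qed (simp add: coend_lift_def)

section \<open>Tensor products and maps between them\<close>

context
  fixes A B :: "'u::set_universe presheaf"
  assumes A: "is_functor FIN SET A" and B: "is_functor FIN SET B"
begin

lemma FO_tens [simp]: "n \<in> Ob FIN \<Longrightarrow> FO (tens A B) n = coend A (FO B n)"
  by (simp add: tens_def)

text \<open>Postcomposing the tuple with a fixed function respects the coend relation, by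
  associativity of composition. Applied to \<open>FM B n n' s\<close>, this makes the action of
  \<open>tens A B\<close> well defined.\<close>

lemma tens_glue:
  assumes "n \<in> Ob FIN" "n' \<in> Ob FIN" "\<beta> \<in> FO B n \<leadsto> N'"
    "m \<in> Ob FIN" "m' \<in> Ob FIN" "s \<in> m \<leadsto> m'" "a \<in> elts (FO A m)"
    "b \<in> m' \<leadsto> FO B n"
  shows "coend_class A N' m a (compose (elts m) \<beta> (compose (elts m) b s)) =
    coend_class A N' m' (FM A m m' s a) (compose (elts m') \<beta> b)"
  unfolding compose_assoc_PiE[OF assms(6)]
  by (rule coend_class_glue) (use assms in \<open>simp_all add: compose_PiE\<close>)

lemma FM_tens_class [simp]:
  assumes "n \<in> Ob FIN" "n' \<in> Ob FIN" "s \<in> n \<leadsto> n'"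
    "m \<in> Ob FIN" "a \<in> elts (FO A m)" "b \<in> m \<leadsto> FO B n"
  shows "FM (tens A B) n n' s (coend_class A (FO B n) m a b) =
    coend_class A (FO B n') m a (compose (elts m) (FM B n n' s) b)"
  using assms
  by (simp add: tens_def coend_lift_class[OF A] tens_glue functor_FIN_SET_D(1)[OF B])

lemma is_functor_tens: "is_functor FIN SET (tens A B)"
proof (rule is_functor_SET_I[OF is_category_FIN])
  show "FO (tens A B) \<in> extensional (Ob FIN)" by (simp add: tens_def)
next
  have "FM (tens A B) n n' s \<in> coend A (FO B n) \<leadsto> coend A (FO B n')"
    if "n \<in> Ob FIN" "n' \<in> Ob FIN" "s \<in> n \<leadsto> n'" for n n' s
    using that
    by (simp add: tens_def)
      (rule coend_lift_PiE[OF A]; simp add: tens_glue functor_FIN_SET_D(1)[OF B] coend_class_in compose_PiE)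
  then show "FM (tens A B) \<in> (\<Pi>\<^sub>E x\<in>Ob FIN. \<Pi>\<^sub>E y\<in>Ob FIN. Hom FIN x y \<rightarrow>\<^sub>E
      (FO (tens A B) x \<leadsto> FO (tens A B) y))"
    by (simp add: tens_def)
next
  fix n c assume n: "n \<in> Ob FIN" and "c \<in> elts (FO (tens A B) n)"
  then have "c \<in> elts (coend A (FO B n))" by simp
  then obtain m a b where *: "m \<in> Ob FIN" "a \<in> elts (FO A m)" "b \<in> m \<leadsto> FO B n"
    and c: "c = coend_class A (FO B n) m a b" by (rule coendE)
  have "FM B n n (\<lambda>x\<in>elts n. x) = (\<lambda>x\<in>elts (FO B n). x)"
    by (rule PiE_eqI[of _ "elts (FO B n)" UNIV _ UNIV])
      (use functor_FIN_SET_D(1)[OF B n n, of "\<lambda>x\<in>elts n. x"] functor_FIN_SET_D(3)[OF B n] in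
        \<open>simp_all add: PiE_def\<close>)
  then show "FM (tens A B) n n (Idn FIN n) c = c"
    unfolding c using n * by (simp add: compose_id_PiE)
next
  fix k n p f g c assume n: "k \<in> Ob FIN" "n \<in> Ob FIN" "p \<in> Ob FIN" and fg: "f \<in> Hom FIN k n" "g \<in> Hom FIN n p"
    and "c \<in> elts (FO (tens A B) k)"
  then have "c \<in> elts (coend A (FO B k))" by simp
  then obtain m a b where *: "m \<in> Ob FIN" "a \<in> elts (FO A m)" "b \<in> m \<leadsto> FO B k"
    and c: "c = coend_class A (FO B k) m a b" by (rule coendE)
  have "compose (elts m) (FM B k p (compose (elts k) g f)) b =
      compose (elts m) (FM B n p g) (compose (elts m) (FM B k n f) b)"
    using n fg PiE_app[OF *(3)] functor_FIN_SET_D[OF B] by (simp add: compose_def cong: restrict_cong)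
  then show "FM (tens A B) k p (Cmp FIN k n p g f) c = FM (tens A B) n p g (FM (tens A B) k n f c)"
    unfolding c using n fg * functor_FIN_SET_D[OF B] by (simp add: compose_PiE)
qed


end

text \<open>Classes exhaust a tensor product, so equations between maps out of it need only be
  checked on them. This lemma and its variant with a single map on the right bring the enriched
  axioms down to generators.\<close>

lemma Cmp_FSet_tens_eqI:
  assumes "is_functor FIN SET A" "is_functor FIN SET B"
    and "\<And>n m a b. n \<in> Ob FIN \<Longrightarrow> m \<in> Ob FIN \<Longrightarrow> a \<in> elts (FO A m) \<Longrightarrow> b \<in> m \<leadsto> FO B n
      \<Longrightarrow> \<beta> n (\<alpha> n (coend_class A (FO B n) m a b)) = \<beta>' n (\<alpha>' n (coend_class A (FO B n) m a b))"
  shows "Cmp FSet (tens A B) D E \<beta> \<alpha> = Cmp FSet (tens A B) D' E' \<beta>' \<alpha>'"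
proof (rule Cmp_FSet_eqI)
  fix n x assume n: "n \<in> Ob FIN" and "x \<in> elts (FO (tens A B) n)"
  then have "x \<in> elts (coend A (FO B n))" by (simp add: FO_tens[OF assms(1,2)])
  then obtain m a b where "m \<in> Ob FIN" "a \<in> elts (FO A m)" "b \<in> m \<leadsto> FO B n"
    "x = coend_class A (FO B n) m a b" by (rule coendE)
  then show "\<beta> n (\<alpha> n x) = \<beta>' n (\<alpha>' n x)" using assms(3) n by simp
qed

lemma Cmp_FSet_tens_eqI':
  assumes "is_functor FIN SET A" "is_functor FIN SET B" "\<gamma> \<in> nat_trans FIN SET (tens A B) E'"
    and "\<And>n m a b. n \<in> Ob FIN \<Longrightarrow> m \<in> Ob FIN \<Longrightarrow> a \<in> elts (FO A m) \<Longrightarrow> b \<in> m \<leadsto> FO B n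
      \<Longrightarrow> \<beta> n (\<alpha> n (coend_class A (FO B n) m a b)) = \<gamma> n (coend_class A (FO B n) m a b)"
  shows "Cmp FSet (tens A B) D E \<beta> \<alpha> = \<gamma>"
proof (rule Cmp_FSet_eqI'[OF assms(3)])
  fix n x assume n: "n \<in> Ob FIN" and "x \<in> elts (FO (tens A B) n)"
  then have "x \<in> elts (coend A (FO B n))" by (simp add: FO_tens[OF assms(1,2)])
  then obtain m a b where "m \<in> Ob FIN" "a \<in> elts (FO A m)" "b \<in> m \<leadsto> FO B n"
    "x = coend_class A (FO B n) m a b" by (rule coendE)
  then show "\<beta> n (\<alpha> n x) = \<gamma> n x" using assms(4) n by simp
qed

lemma compose_in_PiE: "f \<in> A \<rightarrow>\<^sub>E B \<Longrightarrow> (\<And>y. y \<in> B \<Longrightarrow> g y \<in> C) \<Longrightarrow> compose A g f \<in> A \<rightarrow>\<^sub>E C"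
  by (auto simp: compose_def)

text \<open>A map out of a tensor product is a \<open>coend_lift\<close> in each degree
  \<open>n\<close>. The obligations are invariance under the coend relation in \<open>m\<close>, the
  typing, and naturality in \<open>n\<close>. The unitors and the composition maps of
  \<open>Sigma_vcat\<close> and \<open>S_vcat\<close> are obtained this way.\<close>

lemma nat_trans_tens_I:
  fixes A B D :: "'u::set_universe presheaf"
  assumes A: "is_functor FIN SET A" and B: "is_functor FIN SET B" and D: "is_functor FIN SET D"
    and glue: "\<And>n m m' s a b. n \<in> Ob FIN \<Longrightarrow> m \<in> Ob FIN \<Longrightarrow> m' \<in> Ob FIN \<Longrightarrow> s \<in> m \<leadsto> m' \<Longrightarrow>
      a \<in> elts (FO A m) \<Longrightarrow> b \<in> m' \<leadsto> FO B n \<Longrightarrow>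
      h n m a (compose (elts m) b s) = h n m' (FM A m m' s a) b"
    and in_D: "\<And>n m a b. n \<in> Ob FIN \<Longrightarrow> m \<in> Ob FIN \<Longrightarrow> a \<in> elts (FO A m) \<Longrightarrow>
      b \<in> m \<leadsto> FO B n \<Longrightarrow> h n m a b \<in> elts (FO D n)"
    and nat: "\<And>n n' s m a b. n \<in> Ob FIN \<Longrightarrow> n' \<in> Ob FIN \<Longrightarrow> s \<in> n \<leadsto> n' \<Longrightarrow> m \<in> Ob FIN \<Longrightarrow>
      a \<in> elts (FO A m) \<Longrightarrow> b \<in> m \<leadsto> FO B n \<Longrightarrow>
      h n' m a (compose (elts m) (FM B n n' s) b) = FM D n n' s (h n m a b)"
  shows "(\<lambda>n\<in>Ob FIN. coend_lift A (FO B n) (h n)) \<in> nat_trans FIN SET (tens A B) D"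
proof (rule nat_trans_SET_I[OF is_functor_tens[OF A B] D])
  show "(\<lambda>n\<in>Ob FIN. coend_lift A (FO B n) (h n)) n \<in> FO (tens A B) n \<leadsto> FO D n"
    if "n \<in> Ob FIN" for n
    using that by (simp add: FO_tens[OF A B] coend_lift_PiE[OF A glue in_D])
next
  fix n n' s x
  assume n: "n \<in> Ob FIN" "n' \<in> Ob FIN" and s: "s \<in> Hom FIN n n'" and "x \<in> elts (FO (tens A B) n)"
  then have "x \<in> elts (coend A (FO B n))" by (simp add: FO_tens[OF A B])
  then obtain m a b where *: "m \<in> Ob FIN" "a \<in> elts (FO A m)" "b \<in> m \<leadsto> FO B n"
    and x: "x = coend_class A (FO B n) m a b" by (rule coendE)
  have s': "s \<in> n \<leadsto> n'" using s by simp
  have "coend_lift A (FO B n') (h n') (FM (tens A B) n n' s x) =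
      coend_lift A (FO B n') (h n') (coend_class A (FO B n') m a (compose (elts m) (FM B n n' s) b))"
    unfolding x by (simp only: FM_tens_class[OF A B n s' *])
  also have "\<dots> = h n' m a (compose (elts m) (FM B n n' s) b)"
    by (rule coend_lift_class[OF A glue[OF n(2)]])
      (use * compose_PiE[OF *(3) functor_FIN_SET_D(1)[OF B n s']] in simp_all)
  also have "\<dots> = FM D n n' s (h n m a b)"
    by (rule nat[OF n s' *])
  also have "h n m a b = coend_lift A (FO B n) (h n) x"
    unfolding x by (rule coend_lift_class[OF A glue[OF n(1)] *, symmetric])
  finally show "(\<lambda>n\<in>Ob FIN. coend_lift A (FO B n) (h n)) n' (FM (tens A B) n n' s x) =
      FM D n n' s ((\<lambda>n\<in>Ob FIN. coend_lift A (FO B n) (h n)) n x)"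
    using n by simp
qed simp

context
  fixes A A' B B' :: "'u::set_universe presheaf" and \<alpha> \<beta>
  assumes A: "is_functor FIN SET A" and A': "is_functor FIN SET A'"
    and B: "is_functor FIN SET B" and B': "is_functor FIN SET B'"
    and \<alpha>: "\<alpha> \<in> nat_trans FIN SET A A'" and \<beta>: "\<beta> \<in> nat_trans FIN SET B B'"
begin

text \<open>\<alpha> moves past the action of \<open>s\<close> by naturality, \<beta> past the
  reindexed tuple by associativity of composition.\<close>

lemma tens_map_glue:
  assumes "n \<in> Ob FIN" "m \<in> Ob FIN" "m' \<in> Ob FIN" "s \<in> m \<leadsto> m'" "a \<in> elts (FO A m)"
    "b \<in> m' \<leadsto> FO B n"
  shows "coend_class A' (FO B' n) m (\<alpha> m a) (compose (elts m) (\<beta> n) (compose (elts m) b s)) =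
    coend_class A' (FO B' n) m' (\<alpha> m' (FM A m m' s a)) (compose (elts m') (\<beta> n) b)"
  unfolding compose_assoc_PiE[OF assms(4)] nat_trans_FIN_natural[OF \<alpha> assms(2-5)]
  by (rule coend_class_glue)
    (use assms nat_trans_SET_D(3)[OF \<alpha>] compose_PiE[OF assms(6) nat_trans_SET_D(2)[OF \<beta> assms(1)]] in simp_all)

lemma tens_map_class [simp]:
  assumes "n \<in> Ob FIN" "m \<in> Ob FIN" "a \<in> elts (FO A m)" "b \<in> m \<leadsto> FO B n"
  shows "tens_map A A' B B' \<alpha> \<beta> n (coend_class A (FO B n) m a b) =
    coend_class A' (FO B' n) m (\<alpha> m a) (compose (elts m) (\<beta> n) b)"
  using assms by (simp add: tens_map_def coend_lift_class[OF A] tens_map_glue)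

end

section \<open>Unitors and their inverses\<close>

lemma is_functor_incl: "is_functor FIN SET incl"
  by (rule is_functor_SET_I[OF is_category_FIN]) (simp_all add: incl_def compose_eq compose_PiE)

lemma incl_simps [simp]:
  "n \<in> Ob FIN \<Longrightarrow> FO incl n = n"
  "m \<in> Ob FIN \<Longrightarrow> n \<in> Ob FIN \<Longrightarrow> s \<in> m \<leadsto> n \<Longrightarrow> FM incl m n s = s"
  by (simp_all add: incl_def)

lemma elts_one: "elts (vnat (Suc 0)) = {vset {} :: 'u::set_universe}"
  unfolding elts_vnat by (simp add: lessThan_Suc vnat.simps(1))

context
  fixes A :: "'u::set_universe presheaf"
  assumes A: "is_functor FIN SET A"
begin

lemma tens_lunit_class [simp]:
  assumes "n \<in> Ob FIN" "m \<in> Ob FIN" "i \<in> elts m" "b \<in> m \<leadsto> FO A n"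
  shows "tens_lunit A n (coend_class incl (FO A n) m i b) = b i"
proof -
  have "coend_lift incl (FO A n) (\<lambda>m i b. b i) (coend_class incl (FO A n) m i b) = b i"
    by (rule coend_lift_class[OF is_functor_incl]) (use assms in \<open>simp_all add: compose_eq\<close>)
  then show ?thesis using assms(1) by (simp add: tens_lunit_def)
qed

lemma tens_lunit_in: "tens_lunit A \<in> nat_trans FIN SET (tens incl A) A"
  unfolding tens_lunit_def
  by (rule nat_trans_tens_I[OF is_functor_incl A A]) (simp_all add: compose_eq PiE_app)

lemma runit_glue:
  assumes "n \<in> Ob FIN" "m \<in> Ob FIN" "m' \<in> Ob FIN" "s \<in> m \<leadsto> m'" "a \<in> elts (FO A m)"
    "b \<in> m' \<leadsto> FO incl n"
  shows "FM A m n (compose (elts m) b s) a = FM A m' n b (FM A m m' s a)"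
  using assms functor_FIN_SET_D[OF A] by simp

lemma tens_runit_class [simp]:
  assumes "n \<in> Ob FIN" "m \<in> Ob FIN" "a \<in> elts (FO A m)" "s \<in> m \<leadsto> n"
  shows "tens_runit A n (coend_class A n m a s) = FM A m n s a"
proof -
  have "tens_runit A n (coend_class A (FO incl n) m a s) = FM A m n s a"
    using assms by (simp add: tens_runit_def del: incl_simps(1))
      (rule coend_lift_class[OF A], simp_all add: runit_glue)
  then show ?thesis using assms(1) by simp
qed

lemma tens_runit_in: "tens_runit A \<in> nat_trans FIN SET (tens A incl) A"
  unfolding tens_runit_def
  by (rule nat_trans_tens_I[OF A is_functor_incl A])
    (simp_all add: runit_glue functor_FIN_SET_D[OF A])

text \<open>Below, \<open>vnat (Suc 0)\<close> is the cardinal \<open>1\<close> and \<open>vset {}\<close> is its element \<open>0\<close>.\<close>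

definition lunit_inv :: "'u presheaf_map" where
  "lunit_inv = (\<lambda>n\<in>Ob FIN. \<lambda>a\<in>elts (FO A n). coend_class incl (FO A n) (vnat (Suc 0)) (vset {}) (\<lambda>_\<in>elts (vnat (Suc 0)). a))"

definition runit_inv :: "'u presheaf_map" where
  "runit_inv = (\<lambda>n\<in>Ob FIN. \<lambda>a\<in>elts (FO A n). coend_class A n n a (\<lambda>i\<in>elts n. i))"

text \<open>An element \<open>i\<close> of \<open>m\<close> is the image of the only element of 1
  under the map that picks it. Gluing along that map brings every class of
  \<open>tens incl A\<close> into a normal form over 1, which is why \<open>lunit_inv\<close> undoes
  the unitor.\<close>

lemma lunit_class_const:
  assumes "n \<in> Ob FIN" "m \<in> Ob FIN" "i \<in> elts m" "b \<in> m \<leadsto> FO A n"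
  shows "coend_class incl (FO A n) m i b =
    coend_class incl (FO A n) (vnat (Suc 0)) (vset {}) (\<lambda>_\<in>elts (vnat (Suc 0)). b i)"
proof -
  let ?s = "\<lambda>_\<in>elts (vnat (Suc 0)). i"
  have s: "?s \<in> vnat (Suc 0) \<leadsto> m" using assms(3) by simp
  have "compose (elts (vnat (Suc 0))) b ?s = (\<lambda>_\<in>elts (vnat (Suc 0)). b i)"
    by (simp add: compose_def cong: restrict_cong)
  moreover have "FM incl (vnat (Suc 0)) m ?s (vset {}) = i"
    using assms(2) s by (simp add: elts_one)
  moreover have "coend_class incl (FO A n) (vnat (Suc 0)) (vset {}) (compose (elts (vnat (Suc 0))) b ?s) =
      coend_class incl (FO A n) m (FM incl (vnat (Suc 0)) m ?s (vset {})) b"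
    by (rule coend_class_glue[OF vnat_FIN(1) assms(2) s _ assms(4)]) (simp add: elts_one)
  ultimately show ?thesis by metis
qed

lemma lunit_inv_in: "lunit_inv \<in> nat_trans FIN SET A (tens incl A)"
proof (rule nat_trans_SET_I[OF A is_functor_tens[OF is_functor_incl A]])
  show "lunit_inv n \<in> FO A n \<leadsto> FO (tens incl A) n" if "n \<in> Ob FIN" for n
    using that unfolding lunit_inv_def
    by (simp add: FO_tens[OF is_functor_incl A] coend_class_in elts_one)
  show "lunit_inv n (FM A m n s a) = FM (tens incl A) m n s (lunit_inv m a)"
    if "m \<in> Ob FIN" "n \<in> Ob FIN" "s \<in> Hom FIN m n" "a \<in> elts (FO A m)" for m n s a
    using that functor_FIN_SET_D[OF A] unfolding lunit_inv_def
    by (simp add: FM_tens_class[OF is_functor_incl A] elts_one compose_def cong: restrict_cong)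
qed (simp add: lunit_inv_def)

lemma inv_arrow_lunit: "inv_arrow FSet (tens incl A) A (tens_lunit A) = lunit_inv"
proof (rule inv_arrow_FSet[OF tens_lunit_in lunit_inv_in])
  fix n x assume n: "n \<in> Ob FIN" and "x \<in> elts (FO (tens incl A) n)"
  then have "x \<in> elts (coend incl (FO A n))" by (simp add: FO_tens[OF is_functor_incl A])
  then obtain m i b where *: "m \<in> Ob FIN" "i \<in> elts (FO incl m)" "b \<in> m \<leadsto> FO A n"
    and x: "x = coend_class incl (FO A n) m i b" by (rule coendE)
  have i: "i \<in> elts m" using * by simp
  have "lunit_inv n (tens_lunit A n x) = lunit_inv n (b i)"
    unfolding x using n * i by simp
  also have "\<dots> = x"
    unfolding x lunit_class_const[OF n *(1) i *(3)] using n PiE_app[OF *(3) i] by (simp add: lunit_inv_def)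
  finally show "lunit_inv n (tens_lunit A n x) = x" .
next
  fix n a assume "n \<in> Ob FIN" and "a \<in> elts (FO A n)"
  then show "tens_lunit A n (lunit_inv n a) = a"
    by (simp add: lunit_inv_def elts_one)
qed

lemma runit_inv_in: "runit_inv \<in> nat_trans FIN SET A (tens A incl)"
proof (rule nat_trans_SET_I[OF A is_functor_tens[OF A is_functor_incl]])
  show "runit_inv n \<in> FO A n \<leadsto> FO (tens A incl) n" if "n \<in> Ob FIN" for n
    using that unfolding runit_inv_def
    by (simp add: FO_tens[OF A is_functor_incl] coend_class_in)
  show "runit_inv n (FM A m n s a) = FM (tens A incl) m n s (runit_inv m a)"
    if "m \<in> Ob FIN" "n \<in> Ob FIN" "s \<in> Hom FIN m n" "a \<in> elts (FO A m)" for m n s a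
  proof -
    have s: "s \<in> m \<leadsto> n" using that(3) by simp
    have id: "(\<lambda>i\<in>elts n. i) \<in> n \<leadsto> n" for n :: 'u by simp
    have "FM (tens A incl) m n s (coend_class A (FO incl m) m a (\<lambda>i\<in>elts m. i)) =
        coend_class A (FO incl n) m a (compose (elts m) (FM incl m n s) (\<lambda>i\<in>elts m. i))"
      by (rule FM_tens_class[OF A is_functor_incl that(1,2) s that(1,4)]) (simp add: that)
    also have "compose (elts m) (FM incl m n s) (\<lambda>i\<in>elts m. i) = compose (elts m) (\<lambda>i\<in>elts n. i) s"
      using that s by (simp add: compose_id_PiE)
    \<comment> \<open>Gluing along \<open>s\<close> itself: the tuple \<open>s\<close> over
      \<open>m\<close> becomes the identity tuple over \<open>n\<close>, and \<open>a\<close>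
      becomes \<open>A s a\<close>.\<close>
    also have "coend_class A (FO incl n) m a \<dots> = coend_class A (FO incl n) n (FM A m n s a) (\<lambda>i\<in>elts n. i)"
      by (rule coend_class_glue[OF that(1,2) s that(4)]) (simp add: that)
    finally have eq: "FM (tens A incl) m n s (coend_class A (FO incl m) m a (\<lambda>i\<in>elts m. i)) =
        coend_class A (FO incl n) n (FM A m n s a) (\<lambda>i\<in>elts n. i)" .
    have r: "runit_inv m a = coend_class A (FO incl m) m a (\<lambda>i\<in>elts m. i)"
      "runit_inv n (FM A m n s a) = coend_class A (FO incl n) n (FM A m n s a) (\<lambda>i\<in>elts n. i)"
      using that s functor_FIN_SET_D(2)[OF A] by (simp_all add: runit_inv_def)
    show ?thesis unfolding r eq ..
  qed
qed (simp add: runit_inv_def)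

lemma inv_arrow_runit: "inv_arrow FSet (tens A incl) A (tens_runit A) = runit_inv"
proof (rule inv_arrow_FSet[OF tens_runit_in runit_inv_in])
  fix n x assume n: "n \<in> Ob FIN" and "x \<in> elts (FO (tens A incl) n)"
  then have "x \<in> elts (coend A n)" by (simp add: FO_tens[OF A is_functor_incl])
  then obtain m a s where *: "m \<in> Ob FIN" "a \<in> elts (FO A m)" "s \<in> m \<leadsto> n"
    and x: "x = coend_class A n m a s" by (rule coendE)
  have "coend_class A n n (FM A m n s a) (\<lambda>i\<in>elts n. i) = coend_class A n m a (compose (elts m) (\<lambda>i\<in>elts n. i) s)"
    by (rule coend_class_glue[symmetric]) (use n * in simp_all)
  then show "runit_inv n (tens_runit A n x) = x"
    unfolding x using n * functor_FIN_SET_D(2)[OF A] by (simp add: runit_inv_def compose_id_PiE)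
next
  fix n a assume "n \<in> Ob FIN" and "a \<in> elts (FO A n)"
  then show "tens_runit A n (runit_inv n a) = a"
    using functor_FIN_SET_D(3)[OF A] by (simp add: runit_inv_def)
qed

end

section \<open>The associator\<close>

context
  fixes A B C :: "'u::set_universe presheaf"
  assumes A: "is_functor FIN SET A" and B: "is_functor FIN SET B" and C: "is_functor FIN SET C"
begin

text \<open>The associator is a lift within a lift. For fixed \<open>m\<close> and \<open>c\<close>
  the inner family must respect the relation in \<open>k\<close> (\<open>inner\<close>), and only
  then does it make sense to ask the result to respect the relation in \<open>m\<close>
  (\<open>outer_glue\<close>).\<close>

lemma tens_assoc_class [simp]:
  assumes "n \<in> Ob FIN" "m \<in> Ob FIN" "k \<in> Ob FIN" "a \<in> elts (FO A k)"
    "b \<in> k \<leadsto> FO B m" "c \<in> m \<leadsto> FO C n"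
  shows "tens_assoc A B C n (coend_class (tens A B) (FO C n) m (coend_class A (FO B m) k a b) c) =
    coend_class A (FO (tens B C) n) k a (\<lambda>j\<in>elts k. coend_class B (FO C n) m (b j) c)"
proof -
  let ?i = "\<lambda>m c k a b. coend_class A (FO (tens B C) n) k a (\<lambda>j\<in>elts k. coend_class B (FO C n) m (b j) c)"
  have inner: "coend_lift A (FO B m) (?i m c) (coend_class A (FO B m) k a b) = ?i m c k a b"
    if "m \<in> Ob FIN" "k \<in> Ob FIN" "a \<in> elts (FO A k)" "b \<in> k \<leadsto> FO B m"
      "c \<in> m \<leadsto> FO C n" for m c k a b
  proof (rule coend_lift_class[OF A _ that(2-4)])
    fix k k' :: 'u and s a b
    assume *: "k \<in> Ob FIN" "k' \<in> Ob FIN" "s \<in> k \<leadsto> k'" "a \<in> elts (FO A k)"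
      "b \<in> k' \<leadsto> FO B m"
    let ?b = "\<lambda>j\<in>elts k'. coend_class B (FO C n) m (b j) c"
    have "?b \<in> k' \<leadsto> FO (tens B C) n"
      using * that assms(1) by (simp add: FO_tens[OF B C] coend_class_in PiE_app)
    moreover have "(\<lambda>j\<in>elts k. coend_class B (FO C n) m (compose (elts k) b s j) c) = compose (elts k) ?b s"
      using PiE_app[OF *(3)] by (simp add: compose_def cong: restrict_cong)
    ultimately show "?i m c k a (compose (elts k) b s) = ?i m c k' (FM A k k' s a) b"
      using * by (simp add: coend_class_glue)
  qed
  have outer_glue: "coend_lift A (FO B m) (?i m (compose (elts m) c s)) d =
      coend_lift A (FO B m') (?i m' c) (FM (tens A B) m m' s d)"
    if m: "m \<in> Ob FIN" "m' \<in> Ob FIN" "s \<in> m \<leadsto> m'" and d: "d \<in> elts (FO (tens A B) m)"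
      and c: "c \<in> m' \<leadsto> FO C n" for m m' s d c
  proof -
    have "d \<in> elts (coend A (FO B m))" using m d by (simp add: FO_tens[OF A B])
    then obtain k a b where *: "k \<in> Ob FIN" "a \<in> elts (FO A k)" "b \<in> k \<leadsto> FO B m"
      and d: "d = coend_class A (FO B m) k a b" by (rule coendE)
    \<comment> \<open>The map \<open>s\<close> is moved from \<open>c\<close> into each entry: the
      class of \<open>(m, b j, c o s)\<close> is that of \<open>(m', B s (b j), c)\<close>, which is
      exactly how \<open>tens A B\<close> lets \<open>s\<close> act on \<open>d\<close>.\<close>
    have "(\<lambda>j\<in>elts k. coend_class B (FO C n) m (b j) (compose (elts m) c s)) =
        (\<lambda>j\<in>elts k. coend_class B (FO C n) m' (compose (elts k) (FM B m m' s) b j) c)"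
      using m c PiE_app[OF *(3)] by (simp add: coend_class_glue compose_eq cong: restrict_cong)
    moreover have "compose (elts k) (FM B m m' s) b \<in> k \<leadsto> FO B m'"
      by (rule compose_PiE[OF *(3) functor_FIN_SET_D(1)[OF B m]])
    ultimately show ?thesis
      unfolding d using m c * by (simp add: FM_tens_class[OF A B] inner compose_PiE)
  qed
  have "coend_lift (tens A B) (FO C n) (\<lambda>m d c. coend_lift A (FO B m) (?i m c) d)
      (coend_class (tens A B) (FO C n) m (coend_class A (FO B m) k a b) c) =
      coend_lift A (FO B m) (?i m c) (coend_class A (FO B m) k a b)"
    by (rule coend_lift_class[OF is_functor_tens[OF A B] outer_glue])
      (use assms in \<open>simp_all add: FO_tens[OF A B] coend_class_in\<close>)
  then show ?thesis
    using assms by (simp add: tens_assoc_def inner)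
qed

end

subsection \<open>\<open>[F, Set]\<close>-categories, elementwise\<close>

lemma compose_Idn_FSet [simp]:
  "n \<in> Ob FIN \<Longrightarrow> b \<in> X \<rightarrow>\<^sub>E elts (FO A n) \<Longrightarrow> compose X (Idn FSet A n) b = b"
  by (simp add: Idn_FSet compose_id_PiE)

text \<open>On classes the enriched axioms are the laws of substitution for finitary operations:
  iterated substitution is associative, substituting into a projection returns the corresponding
  entry, and substituting projections reindexes. A general \<open>s\<close> occurs in
  \<open>runit\<close> because the right unitor is evaluated on a class with an arbitrary tuple in
  the unit.\<close>

lemma is_vcat_FSet_I:
  fixes K :: "('x, 'u::set_universe presheaf, 'u presheaf_map) vcat"
  assumes hom: "\<And>x y. x \<in> VOb K \<Longrightarrow> y \<in> VOb K \<Longrightarrow> is_functor FIN SET (VHom K x y)"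
    and idn: "\<And>x. x \<in> VOb K \<Longrightarrow> VIdn K x \<in> nat_trans FIN SET incl (VHom K x x)"
    and cmp: "\<And>x y z. x \<in> VOb K \<Longrightarrow> y \<in> VOb K \<Longrightarrow> z \<in> VOb K \<Longrightarrow>
      VCmp K x y z \<in> nat_trans FIN SET (tens (VHom K y z) (VHom K x y)) (VHom K x z)"
    and assoc: "\<And>w x y z n m k a b c. w \<in> VOb K \<Longrightarrow> x \<in> VOb K \<Longrightarrow> y \<in> VOb K \<Longrightarrow> z \<in> VOb K \<Longrightarrow>
      n \<in> Ob FIN \<Longrightarrow> m \<in> Ob FIN \<Longrightarrow> k \<in> Ob FIN \<Longrightarrow> a \<in> elts (FO (VHom K y z) k) \<Longrightarrow>
      b \<in> k \<leadsto> FO (VHom K x y) m \<Longrightarrow> c \<in> m \<leadsto> FO (VHom K w x) n \<Longrightarrow>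
      VCmp K w x z n (coend_class (VHom K x z) (FO (VHom K w x) n) m
        (VCmp K x y z m (coend_class (VHom K y z) (FO (VHom K x y) m) k a b)) c) =
      VCmp K w y z n (coend_class (VHom K y z) (FO (VHom K w y) n) k a
        (\<lambda>j\<in>elts k. VCmp K w x y n (coend_class (VHom K x y) (FO (VHom K w x) n) m (b j) c)))"
    and lunit: "\<And>x y n m i b. x \<in> VOb K \<Longrightarrow> y \<in> VOb K \<Longrightarrow> n \<in> Ob FIN \<Longrightarrow> m \<in> Ob FIN \<Longrightarrow> i \<in> elts m \<Longrightarrow>
      b \<in> m \<leadsto> FO (VHom K x y) n \<Longrightarrow>
      VCmp K x y y n (coend_class (VHom K y y) (FO (VHom K x y) n) m (VIdn K y m i) b) = b i"
    and runit: "\<And>x y n m a s. x \<in> VOb K \<Longrightarrow> y \<in> VOb K \<Longrightarrow> n \<in> Ob FIN \<Longrightarrow> m \<in> Ob FIN \<Longrightarrow>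
      a \<in> elts (FO (VHom K x y) m) \<Longrightarrow> s \<in> m \<leadsto> n \<Longrightarrow>
      VCmp K x x y n (coend_class (VHom K x y) (FO (VHom K x x) n) m a (compose (elts m) (VIdn K x n) s)) =
      FM (VHom K x y) m n s a"
  shows "is_vcat FSet K"
  unfolding is_vcat_def Let_def FSet_simps
proof (intro conjI ballI)
  fix w x y z assume o: "w \<in> VOb K" "x \<in> VOb K" "y \<in> VOb K" "z \<in> VOb K"
  let ?H = "VHom K"
  show "Cmp FSet (tens (tens (?H y z) (?H x y)) (?H w x)) (tens (?H x z) (?H w x)) (?H w z) (VCmp K w x z)
      (tens_map (tens (?H y z) (?H x y)) (?H x z) (?H w x) (?H w x) (VCmp K x y z) (Idn FSet (?H w x))) =
    Cmp FSet (tens (tens (?H y z) (?H x y)) (?H w x)) (tens (?H y z) (tens (?H x y) (?H w x))) (?H w z)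
      (Cmp FSet (tens (?H y z) (tens (?H x y) (?H w x))) (tens (?H y z) (?H w y)) (?H w z) (VCmp K w y z)
        (tens_map (?H y z) (?H y z) (tens (?H x y) (?H w x)) (?H w y) (Idn FSet (?H y z)) (VCmp K w x y)))
      (tens_assoc (?H y z) (?H x y) (?H w x))"
  proof (rule Cmp_FSet_tens_eqI[OF is_functor_tens[OF hom[OF o(3,4)] hom[OF o(2,3)]] hom[OF o(1,2)]])
    fix n m :: 'u and d c
    assume n: "n \<in> Ob FIN" and m: "m \<in> Ob FIN" and d: "d \<in> elts (FO (tens (?H y z) (?H x y)) m)"
      and c: "c \<in> m \<leadsto> FO (?H w x) n"
    \<comment> \<open>The outer operation \<open>d\<close> itself lives in a tensor product and has
      to be presented as a class once more before the associator can act.\<close>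
    then have "d \<in> elts (coend (?H y z) (FO (?H x y) m))" by (simp add: FO_tens[OF hom[OF o(3,4)] hom[OF o(2,3)]])
    then obtain k a b where k: "k \<in> Ob FIN" and a: "a \<in> elts (FO (?H y z) k)"
      and b: "b \<in> k \<leadsto> FO (?H x y) m"
      and deq: "d = coend_class (?H y z) (FO (?H x y) m) k a b" by (rule coendE)
    let ?bc = "\<lambda>j\<in>elts k. coend_class (?H x y) (FO (?H w x) n) m (b j) c"
    have bc: "?bc \<in> k \<leadsto> FO (tens (?H x y) (?H w x)) n"
      using n m k b c PiE_app[OF b] by (simp add: FO_tens[OF hom[OF o(2,3)] hom[OF o(1,2)]] coend_class_in)
    have "tens_map (tens (?H y z) (?H x y)) (?H x z) (?H w x) (?H w x) (VCmp K x y z) (Idn FSet (?H w x)) n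
        (coend_class (tens (?H y z) (?H x y)) (FO (?H w x) n) m d c) =
      coend_class (?H x z) (FO (?H w x) n) m (VCmp K x y z m d) c"
      by (subst tens_map_class[OF is_functor_tens[OF hom[OF o(3,4)] hom[OF o(2,3)]] hom[OF o(2,4)]
            hom[OF o(1,2)] hom[OF o(1,2)] cmp[OF o(2-4)] Idn_FSet_in[OF hom[OF o(1,2)]] n m d c])
        (simp only: compose_Idn_FSet[OF n c])
    moreover have "tens_assoc (?H y z) (?H x y) (?H w x) n
        (coend_class (tens (?H y z) (?H x y)) (FO (?H w x) n) m d c) =
      coend_class (?H y z) (FO (tens (?H x y) (?H w x)) n) k a ?bc"
      unfolding deq by (rule tens_assoc_class[OF hom[OF o(3,4)] hom[OF o(2,3)] hom[OF o(1,2)] n m k a b c])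
    moreover have "coend_class (?H y z) (FO (tens (?H x y) (?H w x)) n) k a ?bc
        \<in> elts (FO (tens (?H y z) (tens (?H x y) (?H w x))) n)"
      using n coend_class_in[OF k a bc]
      by (simp add: FO_tens[OF hom[OF o(3,4)] is_functor_tens[OF hom[OF o(2,3)] hom[OF o(1,2)]]])
    moreover have "tens_map (?H y z) (?H y z) (tens (?H x y) (?H w x)) (?H w y) (Idn FSet (?H y z)) (VCmp K w x y) n
        (coend_class (?H y z) (FO (tens (?H x y) (?H w x)) n) k a ?bc) =
      coend_class (?H y z) (FO (?H w y) n) k a (compose (elts k) (VCmp K w x y n) ?bc)"
      by (subst tens_map_class[OF hom[OF o(3,4)] hom[OF o(3,4)] is_functor_tens[OF hom[OF o(2,3)] hom[OF o(1,2)]]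
          hom[OF o(1,3)] Idn_FSet_in[OF hom[OF o(3,4)]] cmp[OF o(1-3)] n k a bc]) (simp only: Idn_FSet_apply[OF k a])
    moreover have "compose (elts k) (VCmp K w x y n) ?bc =
        (\<lambda>j\<in>elts k. VCmp K w x y n (coend_class (?H x y) (FO (?H w x) n) m (b j) c))"
      by (simp add: compose_def cong: restrict_cong)
    ultimately show "VCmp K w x z n (tens_map (tens (?H y z) (?H x y)) (?H x z) (?H w x) (?H w x) (VCmp K x y z)
          (Idn FSet (?H w x)) n (coend_class (tens (?H y z) (?H x y)) (FO (?H w x) n) m d c)) =
      Cmp FSet (tens (?H y z) (tens (?H x y) (?H w x))) (tens (?H y z) (?H w y)) (?H w z) (VCmp K w y z)
        (tens_map (?H y z) (?H y z) (tens (?H x y) (?H w x)) (?H w y) (Idn FSet (?H y z)) (VCmp K w x y)) n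
        (tens_assoc (?H y z) (?H x y) (?H w x) n (coend_class (tens (?H y z) (?H x y)) (FO (?H w x) n) m d c))"
      using assoc[OF o n m k a b c] n by (simp only: Cmp_FSet_apply deq)
  qed
next
  fix x y assume o: "x \<in> VOb K" "y \<in> VOb K"
  let ?H = "VHom K"
  note hxy = hom[OF o] and hyy = hom[OF o(2,2)] and hxx = hom[OF o(1,1)]
  show "Cmp FSet (tens incl (?H x y)) (tens (?H y y) (?H x y)) (?H x y) (VCmp K x y y)
      (tens_map incl (?H y y) (?H x y) (?H x y) (VIdn K y) (Idn FSet (?H x y))) = tens_lunit (?H x y)"
  proof (rule Cmp_FSet_tens_eqI'[OF is_functor_incl hxy tens_lunit_in[OF hxy]])
    fix n m :: 'u and i b assume *: "n \<in> Ob FIN" "m \<in> Ob FIN" "i \<in> elts (FO incl m)" "b \<in> m \<leadsto> FO (?H x y) n"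
    have i: "i \<in> elts m" using * by simp
    show "VCmp K x y y n (tens_map incl (?H y y) (?H x y) (?H x y) (VIdn K y) (Idn FSet (?H x y)) n
        (coend_class incl (FO (?H x y) n) m i b)) = tens_lunit (?H x y) n (coend_class incl (FO (?H x y) n) m i b)"
      by (simp only: tens_map_class[OF is_functor_incl hyy hxy hxy idn[OF o(2)] Idn_FSet_in[OF hxy] *]
          tens_lunit_class[OF hxy *(1,2) i *(4)] compose_Idn_FSet[OF *(1,4)] lunit[OF o *(1,2) i *(4)])
  qed
  show "Cmp FSet (tens (?H x y) incl) (tens (?H x y) (?H x x)) (?H x y) (VCmp K x x y)
      (tens_map (?H x y) (?H x y) incl (?H x x) (Idn FSet (?H x y)) (VIdn K x)) = tens_runit (?H x y)"
  proof (rule Cmp_FSet_tens_eqI'[OF hxy is_functor_incl tens_runit_in[OF hxy]])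
    fix n m :: 'u and a s assume *: "n \<in> Ob FIN" "m \<in> Ob FIN" "a \<in> elts (FO (?H x y) m)" "s \<in> m \<leadsto> FO incl n"
    have s: "s \<in> m \<leadsto> n" using * by simp
    show "VCmp K x x y n (tens_map (?H x y) (?H x y) incl (?H x x) (Idn FSet (?H x y)) (VIdn K x) n
        (coend_class (?H x y) (FO incl n) m a s)) = tens_runit (?H x y) n (coend_class (?H x y) (FO incl n) m a s)"
      unfolding tens_map_class[OF hxy hxy is_functor_incl hxx Idn_FSet_in[OF hxy] idn[OF o(1)] *]
      using * s by (simp add: runit[OF o *(1,2,3) s] tens_runit_class[OF hxy *(1,2,3) s])
  qed
qed (simp_all add: hom idn cmp)

lemma is_vcat_FSet_D:
  assumes "is_vcat FSet K"
  shows "x \<in> VOb K \<Longrightarrow> y \<in> VOb K \<Longrightarrow> is_functor FIN SET (VHom K x y)"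
    "x \<in> VOb K \<Longrightarrow> VIdn K x \<in> nat_trans FIN SET incl (VHom K x x)"
    "x \<in> VOb K \<Longrightarrow> y \<in> VOb K \<Longrightarrow> z \<in> VOb K \<Longrightarrow>
      VCmp K x y z \<in> nat_trans FIN SET (tens (VHom K y z) (VHom K x y)) (VHom K x z)"
  using assms unfolding is_vcat_def Let_def FSet_simps by simp_all

section \<open>Enriched functors\<close>

context
  fixes K :: "('x, 'u::set_universe presheaf, 'u presheaf_map) vcat"
    and L :: "('y, 'u presheaf, 'u presheaf_map) vcat"
  assumes K: "is_vcat FSet K" and L: "is_vcat FSet L"
begin

lemma is_vfunctor_FSet_I:
  assumes FO: "VFO F \<in> VOb K \<rightarrow>\<^sub>E VOb L"
    and ext: "VFM F \<in> extensional (VOb K)" "\<And>x. x \<in> VOb K \<Longrightarrow> VFM F x \<in> extensional (VOb K)"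
    and FM: "\<And>x y. x \<in> VOb K \<Longrightarrow> y \<in> VOb K \<Longrightarrow>
      VFM F x y \<in> nat_trans FIN SET (VHom K x y) (VHom L (VFO F x) (VFO F y))"
    and idn: "\<And>x n i. x \<in> VOb K \<Longrightarrow> n \<in> Ob FIN \<Longrightarrow> i \<in> elts n \<Longrightarrow>
      VFM F x x n (VIdn K x n i) = VIdn L (VFO F x) n i"
    and cmp: "\<And>x y z n m a b. x \<in> VOb K \<Longrightarrow> y \<in> VOb K \<Longrightarrow> z \<in> VOb K \<Longrightarrow> n \<in> Ob FIN \<Longrightarrow> m \<in> Ob FIN \<Longrightarrow>
      a \<in> elts (FO (VHom K y z) m) \<Longrightarrow> b \<in> m \<leadsto> FO (VHom K x y) n \<Longrightarrow>
      VFM F x z n (VCmp K x y z n (coend_class (VHom K y z) (FO (VHom K x y) n) m a b)) =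
      VCmp L (VFO F x) (VFO F y) (VFO F z) n (coend_class (VHom L (VFO F y) (VFO F z))
        (FO (VHom L (VFO F x) (VFO F y)) n) m (VFM F y z m a) (compose (elts m) (VFM F x y n) b))"
  shows "is_vfunctor FSet K L F"
  unfolding is_vfunctor_def Let_def FSet_simps
proof (intro conjI ballI)
  have F: "VFO F x \<in> VOb L" if "x \<in> VOb K" for x using FO that by (rule PiE_app)
  show "VFM F \<in> (\<Pi>\<^sub>E x\<in>VOb K. \<Pi>\<^sub>E y\<in>VOb K. nat_trans FIN SET (VHom K x y) (VHom L (VFO F x) (VFO F y)))"
    using ext FM unfolding PiE_def Pi_def by blast
  show "Cmp FSet incl (VHom K x x) (VHom L (VFO F x) (VFO F x)) (VFM F x x) (VIdn K x) = VIdn L (VFO F x)"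
    if x: "x \<in> VOb K" for x
    by (rule Cmp_FSet_eqI'[OF is_vcat_FSet_D(2)[OF L F[OF x]]]) (simp add: idn[OF x])
  fix x y z assume o: "x \<in> VOb K" "y \<in> VOb K" "z \<in> VOb K"
  note [simp] = is_vcat_FSet_D(1)[OF K] is_vcat_FSet_D(1)[OF L] F
  show "Cmp FSet (tens (VHom K y z) (VHom K x y)) (VHom K x z) (VHom L (VFO F x) (VFO F z)) (VFM F x z) (VCmp K x y z) =
    Cmp FSet (tens (VHom K y z) (VHom K x y)) (tens (VHom L (VFO F y) (VFO F z)) (VHom L (VFO F x) (VFO F y)))
      (VHom L (VFO F x) (VFO F z)) (VCmp L (VFO F x) (VFO F y) (VFO F z))
      (tens_map (VHom K y z) (VHom L (VFO F y) (VFO F z)) (VHom K x y) (VHom L (VFO F x) (VFO F y)) (VFM F y z) (VFM F x y))"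
    by (rule Cmp_FSet_tens_eqI) (simp_all add: o cmp tens_map_class FM)
qed (rule FO)

lemma is_vfunctor_FSet_D:
  assumes "is_vfunctor FSet K L F"
  shows "VFO F \<in> VOb K \<rightarrow>\<^sub>E VOb L" "x \<in> VOb K \<Longrightarrow> VFO F x \<in> VOb L"
    "VFM F \<in> extensional (VOb K)" "x \<in> VOb K \<Longrightarrow> VFM F x \<in> extensional (VOb K)"
    "x \<in> VOb K \<Longrightarrow> y \<in> VOb K \<Longrightarrow> VFM F x y \<in> nat_trans FIN SET (VHom K x y) (VHom L (VFO F x) (VFO F y))"
    "x \<in> VOb K \<Longrightarrow> n \<in> Ob FIN \<Longrightarrow> i \<in> elts n \<Longrightarrow> VFM F x x n (VIdn K x n i) = VIdn L (VFO F x) n i"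
    "x \<in> VOb K \<Longrightarrow> y \<in> VOb K \<Longrightarrow> z \<in> VOb K \<Longrightarrow> n \<in> Ob FIN \<Longrightarrow> m \<in> Ob FIN \<Longrightarrow>
      a \<in> elts (FO (VHom K y z) m) \<Longrightarrow> b \<in> m \<leadsto> FO (VHom K x y) n \<Longrightarrow>
      VFM F x z n (VCmp K x y z n (coend_class (VHom K y z) (FO (VHom K x y) n) m a b)) =
      VCmp L (VFO F x) (VFO F y) (VFO F z) n (coend_class (VHom L (VFO F y) (VFO F z))
        (FO (VHom L (VFO F x) (VFO F y)) n) m (VFM F y z m a) (compose (elts m) (VFM F x y n) b))"
proof -
  show FO: "VFO F \<in> VOb K \<rightarrow>\<^sub>E VOb L"
    using assms unfolding is_vfunctor_def Let_def by simp
  show F: "x \<in> VOb K \<Longrightarrow> VFO F x \<in> VOb L" for x using FO by (rule PiE_app)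
  have FM: "VFM F \<in> (\<Pi>\<^sub>E x\<in>VOb K. \<Pi>\<^sub>E y\<in>VOb K. nat_trans FIN SET (VHom K x y) (VHom L (VFO F x) (VFO F y)))"
    using assms unfolding is_vfunctor_def Let_def by simp
  then show "VFM F \<in> extensional (VOb K)" by (simp add: PiE_def)
  show "x \<in> VOb K \<Longrightarrow> VFM F x \<in> extensional (VOb K)" using PiE_mem[OF FM] by (simp add: PiE_def)
  show FMxy: "VFM F x y \<in> nat_trans FIN SET (VHom K x y) (VHom L (VFO F x) (VFO F y))"
    if "x \<in> VOb K" "y \<in> VOb K" for x y
    using PiE_mem[OF PiE_mem[OF FM that(1)] that(2)] .
  show "VFM F x x n (VIdn K x n i) = VIdn L (VFO F x) n i" if x: "x \<in> VOb K" and n: "n \<in> Ob FIN" and i: "i \<in> elts n"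
  proof -
    have "Cmp FSet incl (VHom K x x) (VHom L (VFO F x) (VFO F x)) (VFM F x x) (VIdn K x) n i = VIdn L (VFO F x) n i"
      using assms x unfolding is_vfunctor_def Let_def by simp
    then show ?thesis using n i by simp
  qed
  assume o: "x \<in> VOb K" "y \<in> VOb K" "z \<in> VOb K" and n: "n \<in> Ob FIN" "m \<in> Ob FIN" and
    ab: "a \<in> elts (FO (VHom K y z) m)" "b \<in> m \<leadsto> FO (VHom K x y) n"
  note [simp] = is_vcat_FSet_D(1)[OF K] is_vcat_FSet_D(1)[OF L] F FMxy
  have "Cmp FSet (tens (VHom K y z) (VHom K x y)) (VHom K x z) (VHom L (VFO F x) (VFO F z)) (VFM F x z) (VCmp K x y z) =
    Cmp FSet (tens (VHom K y z) (VHom K x y)) (tens (VHom L (VFO F y) (VFO F z)) (VHom L (VFO F x) (VFO F y)))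
      (VHom L (VFO F x) (VFO F z)) (VCmp L (VFO F x) (VFO F y) (VFO F z))
      (tens_map (VHom K y z) (VHom L (VFO F y) (VFO F z)) (VHom K x y) (VHom L (VFO F x) (VFO F y)) (VFM F y z) (VFM F x y))"
    using assms o unfolding is_vfunctor_def Let_def by simp
  from fun_cong[OF fun_cong[OF this, of n], of "coend_class (VHom K y z) (FO (VHom K x y) n) m a b"]
  show "VFM F x z n (VCmp K x y z n (coend_class (VHom K y z) (FO (VHom K x y) n) m a b)) =
      VCmp L (VFO F x) (VFO F y) (VFO F z) n (coend_class (VHom L (VFO F y) (VFO F z))
        (FO (VHom L (VFO F x) (VFO F y)) n) m (VFM F y z m a) (compose (elts m) (VFM F x y n) b))"
    using o n ab by (simp add: coend_class_in)
qed

end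

section \<open>The category of enriched categories\<close>

lemma vftr_eqI:
  fixes F G :: "('x, 'y, 'm) vftr"
  assumes "VFO F \<in> extensional A" "VFO G \<in> extensional A" "\<And>x. x \<in> A \<Longrightarrow> VFO F x = VFO G x"
    "VFM F \<in> extensional A" "VFM G \<in> extensional A"
    "\<And>x. x \<in> A \<Longrightarrow> VFM F x \<in> extensional A" "\<And>x. x \<in> A \<Longrightarrow> VFM G x \<in> extensional A"
    "\<And>x y. x \<in> A \<Longrightarrow> y \<in> A \<Longrightarrow> VFM F x y = VFM G x y"
  shows "F = G"
proof -
  have "VFM F x = VFM G x" if "x \<in> A" for x
    by (rule extensionalityI[of _ A]) (use assms(6-8) that in auto)
  then have "VFM F = VFM G"
    by (rule extensionalityI[OF assms(4,5)])
  moreover have "VFO F = VFO G"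
    by (rule extensionalityI[OF assms(1-3)])
  ultimately show ?thesis by simp
qed

lemma vftr_comp_simps:
  "x \<in> VOb K \<Longrightarrow> VFO (vftr_comp V K L M G F) x = VFO G (VFO F x)"
  "x \<in> VOb K \<Longrightarrow> y \<in> VOb K \<Longrightarrow> VFM (vftr_comp V K L M G F) x y =
    Cmp V (VHom K x y) (VHom L (VFO F x) (VFO F y)) (VHom M (VFO G (VFO F x)) (VFO G (VFO F y)))
      (VFM G (VFO F x) (VFO F y)) (VFM F x y)"
  by (simp_all add: vftr_comp_def)

lemma is_vfunctor_vftr_id:
  fixes K :: "('x, 'u::set_universe presheaf, 'u presheaf_map) vcat"
  assumes K: "is_vcat FSet K"
  shows "is_vfunctor FSet K K (vftr_id FSet K)"
proof (rule is_vfunctor_FSet_I[OF K K])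
  note KD = is_vcat_FSet_D[OF K]
  fix x and n i :: 'u assume *: "x \<in> VOb K" "n \<in> Ob FIN" "i \<in> elts n"
  then have "VIdn K x n i \<in> elts (FO (VHom K x x) n)"
    using nat_trans_SET_D(3)[OF KD(2)[OF *(1)] *(2)] by simp
  then show "VFM (vftr_id FSet K) x x n (VIdn K x n i) = VIdn K (VFO (vftr_id FSet K) x) n i"
    using * by (simp add: vftr_id_def)
next
  note KD = is_vcat_FSet_D[OF K]
  fix x y z n m a b assume o: "x \<in> VOb K" "y \<in> VOb K" "z \<in> VOb K" and n: "n \<in> Ob FIN" "m \<in> Ob FIN" and
    ab: "a \<in> elts (FO (VHom K y z) m)" "b \<in> m \<leadsto> FO (VHom K x y) n"
  have "coend_class (VHom K y z) (FO (VHom K x y) n) m a b \<in> elts (FO (tens (VHom K y z) (VHom K x y)) n)"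
    using o n ab by (simp add: FO_tens KD(1) coend_class_in)
  then have "VCmp K x y z n (coend_class (VHom K y z) (FO (VHom K x y) n) m a b) \<in> elts (FO (VHom K x z) n)"
    using nat_trans_SET_D(3)[OF KD(3)[OF o] n(1)] by blast
  then show "VFM (vftr_id FSet K) x z n (VCmp K x y z n (coend_class (VHom K y z) (FO (VHom K x y) n) m a b)) =
      VCmp K (VFO (vftr_id FSet K) x) (VFO (vftr_id FSet K) y) (VFO (vftr_id FSet K) z) n
        (coend_class (VHom K (VFO (vftr_id FSet K) y) (VFO (vftr_id FSet K) z))
        (FO (VHom K (VFO (vftr_id FSet K) x) (VFO (vftr_id FSet K) y)) n) m (VFM (vftr_id FSet K) y z m a)
        (compose (elts m) (VFM (vftr_id FSet K) x y n) b))"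
    using o n ab by (simp add: vftr_id_def)
qed (simp_all add: vftr_id_def Idn_FSet_in is_vcat_FSet_D(1)[OF K])

lemma is_vfunctor_vftr_comp:
  fixes K :: "('x, 'u::set_universe presheaf, 'u presheaf_map) vcat"
  assumes K: "is_vcat FSet K" and L: "is_vcat FSet L" and M: "is_vcat FSet M"
    and F: "is_vfunctor FSet K L F" and G: "is_vfunctor FSet L M G"
  shows "is_vfunctor FSet K M (vftr_comp FSet K L M G F)"
proof (rule is_vfunctor_FSet_I[OF K M])
  note KD = is_vcat_FSet_D[OF K] and LD = is_vcat_FSet_D[OF L] and MD = is_vcat_FSet_D[OF M]
  note FD = is_vfunctor_FSet_D[OF K L F] and GD = is_vfunctor_FSet_D[OF L M G]
  show "VFO (vftr_comp FSet K L M G F) \<in> VOb K \<rightarrow>\<^sub>E VOb M"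
    using FD(2) GD(2) by (simp add: vftr_comp_def)
  show "VFM (vftr_comp FSet K L M G F) \<in> extensional (VOb K)"
    "\<And>x. x \<in> VOb K \<Longrightarrow> VFM (vftr_comp FSet K L M G F) x \<in> extensional (VOb K)"
    by (simp_all add: vftr_comp_def)
  show "VFM (vftr_comp FSet K L M G F) x y \<in> nat_trans FIN SET (VHom K x y)
      (VHom M (VFO (vftr_comp FSet K L M G F) x) (VFO (vftr_comp FSet K L M G F) y))"
    if "x \<in> VOb K" "y \<in> VOb K" for x y
    using that FD(2,5) GD(2,5) KD(1) MD(1) by (simp add: vftr_comp_simps Cmp_FSet_in)
  show "VFM (vftr_comp FSet K L M G F) x x n (VIdn K x n i) = VIdn M (VFO (vftr_comp FSet K L M G F) x) n i"
    if x: "x \<in> VOb K" and n: "n \<in> Ob FIN" and i: "i \<in> elts n" for x n i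
    using that nat_trans_SET_D(3)[OF KD(2)[OF x] n] FD(2,6) GD(6) by (simp add: vftr_comp_simps)
  fix x y z n m a b assume o: "x \<in> VOb K" "y \<in> VOb K" "z \<in> VOb K" and n: "n \<in> Ob FIN" "m \<in> Ob FIN" and
    ab: "a \<in> elts (FO (VHom K y z) m)" "b \<in> m \<leadsto> FO (VHom K x y) n"
  have "coend_class (VHom K y z) (FO (VHom K x y) n) m a b \<in> elts (FO (tens (VHom K y z) (VHom K x y)) n)"
    using o n ab by (simp add: FO_tens KD(1) coend_class_in)
  then have c: "VCmp K x y z n (coend_class (VHom K y z) (FO (VHom K x y) n) m a b) \<in> elts (FO (VHom K x z) n)"
    using nat_trans_SET_D(3)[OF KD(3)[OF o] n(1)] by blast
  have a': "VFM F y z m a \<in> elts (FO (VHom L (VFO F y) (VFO F z)) m)"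
    by (rule nat_trans_SET_D(3)[OF FD(5)[OF o(2,3)] n(2) ab(1)])
  have b': "compose (elts m) (VFM F x y n) b \<in> m \<leadsto> FO (VHom L (VFO F x) (VFO F y)) n"
    by (rule compose_PiE[OF ab(2) nat_trans_SET_D(2)[OF FD(5)[OF o(1,2)] n(1)]])
  have b'': "compose (elts m) (VFM G (VFO F x) (VFO F y) n) (compose (elts m) (VFM F x y n) b) =
      compose (elts m) (Cmp FSet (VHom K x y) (VHom L (VFO F x) (VFO F y))
        (VHom M (VFO G (VFO F x)) (VFO G (VFO F y))) (VFM G (VFO F x) (VFO F y)) (VFM F x y) n) b"
    using n(1) PiE_app[OF ab(2)] by (simp add: compose_def cong: restrict_cong)
  show "VFM (vftr_comp FSet K L M G F) x z n (VCmp K x y z n (coend_class (VHom K y z) (FO (VHom K x y) n) m a b)) =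
      VCmp M (VFO (vftr_comp FSet K L M G F) x) (VFO (vftr_comp FSet K L M G F) y) (VFO (vftr_comp FSet K L M G F) z) n
        (coend_class (VHom M (VFO (vftr_comp FSet K L M G F) y) (VFO (vftr_comp FSet K L M G F) z))
        (FO (VHom M (VFO (vftr_comp FSet K L M G F) x) (VFO (vftr_comp FSet K L M G F) y)) n) m
        (VFM (vftr_comp FSet K L M G F) y z m a)
        (compose (elts m) (VFM (vftr_comp FSet K L M G F) x y n) b))"
    using o n ab c by (simp add: vftr_comp_simps FD(2,7) GD(7)[OF FD(2) FD(2) FD(2) n a' b'] b'')
qed

text \<open>Besides being the codomain of \<Sigma>, this category supplies the unit and
  associativity laws behind functoriality of precomposition, with \<open>S_vcat\<close> as one of
  its objects.\<close>

lemma is_category_VCAT: "is_category (VCAT (FSet :: ('u::set_universe presheaf, 'u presheaf_map) monoidal)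
    :: (('x, 'u presheaf, 'u presheaf_map) vcat, ('x, 'x, 'u presheaf_map) vftr) category)"
proof -
  have unit: "vftr_comp FSet K K L F (vftr_id FSet K) = F" "vftr_comp FSet K L L (vftr_id FSet L) F = F"
    if K: "is_vcat FSet K" and L: "is_vcat FSet L" and F: "is_vfunctor FSet K L F"
    for K L :: "('x, 'u presheaf, 'u presheaf_map) vcat" and F
  proof -
    note FD = is_vfunctor_FSet_D[OF K L F]
    have ext: "VFO F \<in> extensional (VOb K)" using FD(1) by (simp add: PiE_def)
    have "Cmp FSet (VHom K x y) (VHom K x y) (VHom L (VFO F x) (VFO F y)) (VFM F x y) (Idn FSet (VHom K x y)) = VFM F x y"
      "Cmp FSet (VHom K x y) (VHom L (VFO F x) (VFO F y)) (VHom L (VFO F x) (VFO F y))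
        (Idn FSet (VHom L (VFO F x) (VFO F y))) (VFM F x y) = VFM F x y"
      if "x \<in> VOb K" "y \<in> VOb K" for x y
      using FD(5)[OF that] nat_trans_SET_D(3)[OF FD(5)[OF that]] by (auto intro!: Cmp_FSet_eqI')
    then show "vftr_comp FSet K K L F (vftr_id FSet K) = F" "vftr_comp FSet K L L (vftr_id FSet L) F = F"
      using FD(2-4) ext
      by - (rule vftr_eqI[of _ "VOb K"]; simp add: vftr_comp_def vftr_id_def)+
  qed
  have assoc: "vftr_comp FSet K L N (vftr_comp FSet L M N H G) F = vftr_comp FSet K M N H (vftr_comp FSet K L M G F)"
    if K: "is_vcat FSet K" "is_vcat FSet L" and F: "is_vfunctor FSet K L F"
    for K L M N :: "('x, 'u presheaf, 'u presheaf_map) vcat" and F G H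
  proof -
    note FD = is_vfunctor_FSet_D[OF K F]
    show ?thesis
    proof (rule vftr_eqI[of _ "VOb K"])
      fix x y assume o: "x \<in> VOb K" "y \<in> VOb K"
      show "VFM (vftr_comp FSet K L N (vftr_comp FSet L M N H G) F) x y =
          VFM (vftr_comp FSet K M N H (vftr_comp FSet K L M G F)) x y"
        using o FD(2) nat_trans_SET_D(3)[OF FD(5)[OF o]]
        by (simp add: vftr_comp_simps) (rule Cmp_FSet_eqI, simp)
    qed (simp_all add: vftr_comp_def FD(2))
  qed
  show ?thesis
    unfolding is_category_def VCAT_def
    by (simp add: unit assoc is_vfunctor_vftr_id is_vfunctor_vftr_comp)
qed

subsection \<open>Finitary monads as one-object \<open>[F, Set]\<close>-categories\<close>

lemma is_monad_SET_D:
  fixes M :: "('u::set_universe, 'u \<Rightarrow> 'u) monad"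
  defines "T \<equiv> mnd_fun M" and "\<eta> \<equiv> mnd_unit M" and "\<mu> \<equiv> mnd_mult M"
  assumes M: "is_monad SET M"
  shows "is_functor SET SET T"
    "\<eta> X \<in> X \<leadsto> FO T X" "x \<in> elts X \<Longrightarrow> \<eta> X x \<in> elts (FO T X)"
    "f \<in> X \<leadsto> Y \<Longrightarrow> x \<in> elts X \<Longrightarrow> \<eta> Y (f x) = FM T X Y f (\<eta> X x)"
    "\<mu> X \<in> FO T (FO T X) \<leadsto> FO T X" "t \<in> elts (FO T (FO T X)) \<Longrightarrow> \<mu> X t \<in> elts (FO T X)"
    "f \<in> X \<leadsto> Y \<Longrightarrow> t \<in> elts (FO T (FO T X)) \<Longrightarrow>
      \<mu> Y (FM T (FO T X) (FO T Y) (FM T X Y f) t) = FM T X Y f (\<mu> X t)"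
    "u \<in> elts (FO T X) \<Longrightarrow> \<mu> X (\<eta> (FO T X) u) = u"
    "u \<in> elts (FO T X) \<Longrightarrow> \<mu> X (FM T X (FO T X) (\<eta> X) u) = u"
    "v \<in> elts (FO T (FO T (FO T X))) \<Longrightarrow> \<mu> X (\<mu> (FO T X) v) = \<mu> X (FM T (FO T (FO T X)) (FO T X) (\<mu> X) v)"
proof -
  note M' = M[unfolded is_monad_def Let_def, folded T_def \<eta>_def \<mu>_def]
  show T: "is_functor SET SET T" using M' by simp
  note TD = functor_SET_SET_D[OF T]
  have \<eta>: "\<eta> \<in> nat_trans SET SET (ftr_id SET) T" and \<mu>: "\<mu> \<in> nat_trans SET SET (ftr_comp SET T T) T"
    using M' by simp_all
  show \<eta>1: "\<eta> X \<in> X \<leadsto> FO T X" for X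
    using nat_trans_SET_D(2)[OF \<eta>, of X] by (simp add: ftr_id_def)
  then show \<eta>2: "x \<in> elts X \<Longrightarrow> \<eta> X x \<in> elts (FO T X)" for x X by (rule PiE_app)
  show "f \<in> X \<leadsto> Y \<Longrightarrow> x \<in> elts X \<Longrightarrow> \<eta> Y (f x) = FM T X Y f (\<eta> X x)"
    using nat_trans_SET_D(4)[OF \<eta>, of X Y f x] by (simp add: ftr_id_def)
  show \<mu>1: "\<mu> X \<in> FO T (FO T X) \<leadsto> FO T X" for X
    using nat_trans_SET_D(2)[OF \<mu>, of X] by (simp add: ftr_comp_def)
  then show \<mu>2: "t \<in> elts (FO T (FO T X)) \<Longrightarrow> \<mu> X t \<in> elts (FO T X)" for t X by (rule PiE_app)
  show "f \<in> X \<leadsto> Y \<Longrightarrow> t \<in> elts (FO T (FO T X)) \<Longrightarrow>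
      \<mu> Y (FM T (FO T X) (FO T Y) (FM T X Y f) t) = FM T X Y f (\<mu> X t)"
    using nat_trans_SET_D(4)[OF \<mu>, of X Y f t] by (simp add: ftr_comp_def)
  have *: "compose (elts (FO T X)) (\<mu> X) (\<eta> (FO T X)) = (\<lambda>x\<in>elts (FO T X). x)"
    "compose (elts (FO T X)) (\<mu> X) (FM T X (FO T X) (\<eta> X)) = (\<lambda>x\<in>elts (FO T X). x)"
    "compose (elts (FO T (FO T (FO T X)))) (\<mu> X) (\<mu> (FO T X)) =
     compose (elts (FO T (FO T (FO T X)))) (\<mu> X) (FM T (FO T (FO T X)) (FO T X) (\<mu> X))"
    using M' by simp_all
  show "u \<in> elts (FO T X) \<Longrightarrow> \<mu> X (\<eta> (FO T X) u) = u"
    using fun_cong[OF *(1), of u] by (simp add: compose_eq)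
  show "u \<in> elts (FO T X) \<Longrightarrow> \<mu> X (FM T X (FO T X) (\<eta> X) u) = u"
    using fun_cong[OF *(2), of u] by (simp add: compose_eq)
  show "v \<in> elts (FO T (FO T (FO T X))) \<Longrightarrow> \<mu> X (\<mu> (FO T X) v) = \<mu> X (FM T (FO T (FO T X)) (FO T X) (\<mu> X) v)"
    using fun_cong[OF *(3), of v] by (simp add: compose_eq)
qed

lemma monad_morphisms_SET_D:
  assumes \<phi>: "\<phi> \<in> monad_morphisms SET M N"
  shows "\<phi> X \<in> FO (mnd_fun M) X \<leadsto> FO (mnd_fun N) X"
    "t \<in> elts (FO (mnd_fun M) X) \<Longrightarrow> \<phi> X t \<in> elts (FO (mnd_fun N) X)"
    "f \<in> X \<leadsto> Y \<Longrightarrow> t \<in> elts (FO (mnd_fun M) X) \<Longrightarrow>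
      \<phi> Y (FM (mnd_fun M) X Y f t) = FM (mnd_fun N) X Y f (\<phi> X t)"
    "x \<in> elts X \<Longrightarrow> \<phi> X (mnd_unit M X x) = mnd_unit N X x"
    "u \<in> elts (FO (mnd_fun M) (FO (mnd_fun M) X)) \<Longrightarrow> \<phi> X (mnd_mult M X u) =
      mnd_mult N X (\<phi> (FO (mnd_fun N) X) (FM (mnd_fun M) (FO (mnd_fun M) X) (FO (mnd_fun N) X) (\<phi> X) u))"
proof -
  note \<phi>' = \<phi>[unfolded monad_morphisms_def Let_def]
  have nat: "\<phi> \<in> nat_trans SET SET (mnd_fun M) (mnd_fun N)" using \<phi>' by simp
  show "\<phi> X \<in> FO (mnd_fun M) X \<leadsto> FO (mnd_fun N) X"
    "t \<in> elts (FO (mnd_fun M) X) \<Longrightarrow> \<phi> X t \<in> elts (FO (mnd_fun N) X)"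
    "f \<in> X \<leadsto> Y \<Longrightarrow> t \<in> elts (FO (mnd_fun M) X) \<Longrightarrow>
      \<phi> Y (FM (mnd_fun M) X Y f t) = FM (mnd_fun N) X Y f (\<phi> X t)"
    using nat_trans_SET_D[OF nat] by simp_all
  have *: "compose (elts X) (\<phi> X) (mnd_unit M X) = mnd_unit N X"
    "compose (elts (FO (mnd_fun M) (FO (mnd_fun M) X))) (\<phi> X) (mnd_mult M X) =
     compose (elts (FO (mnd_fun M) (FO (mnd_fun M) X))) (mnd_mult N X)
       (compose (elts (FO (mnd_fun M) (FO (mnd_fun M) X))) (\<phi> (FO (mnd_fun N) X))
         (FM (mnd_fun M) (FO (mnd_fun M) X) (FO (mnd_fun N) X) (\<phi> X)))"
    using \<phi>' by simp_all
  show "x \<in> elts X \<Longrightarrow> \<phi> X (mnd_unit M X x) = mnd_unit N X x"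
    using fun_cong[OF *(1), of x] by (simp add: compose_eq)
  show "u \<in> elts (FO (mnd_fun M) (FO (mnd_fun M) X)) \<Longrightarrow> \<phi> X (mnd_mult M X u) =
      mnd_mult N X (\<phi> (FO (mnd_fun N) X) (FM (mnd_fun M) (FO (mnd_fun M) X) (FO (mnd_fun N) X) (\<phi> X) u))"
    using fun_cong[OF *(2), of u] by (simp add: compose_eq)
qed

lemma monad_morphisms_SET_I:
  fixes M N :: "('u::set_universe, 'u \<Rightarrow> 'u) monad"
  assumes M: "is_monad SET M" and N: "is_monad SET N"
    and \<phi>: "\<And>X. \<phi> X \<in> FO (mnd_fun M) X \<leadsto> FO (mnd_fun N) X"
    and nat: "\<And>X Y f t. f \<in> X \<leadsto> Y \<Longrightarrow> t \<in> elts (FO (mnd_fun M) X) \<Longrightarrow>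
      \<phi> Y (FM (mnd_fun M) X Y f t) = FM (mnd_fun N) X Y f (\<phi> X t)"
    and unit: "\<And>X x. x \<in> elts X \<Longrightarrow> \<phi> X (mnd_unit M X x) = mnd_unit N X x"
    and mult: "\<And>X u. u \<in> elts (FO (mnd_fun M) (FO (mnd_fun M) X)) \<Longrightarrow> \<phi> X (mnd_mult M X u) =
      mnd_mult N X (\<phi> (FO (mnd_fun N) X) (FM (mnd_fun M) (FO (mnd_fun M) X) (FO (mnd_fun N) X) (\<phi> X) u))"
  shows "\<phi> \<in> monad_morphisms SET M N"
proof -
  note MD = is_monad_SET_D[OF M] and ND = is_monad_SET_D[OF N]
  have "\<phi> \<in> nat_trans SET SET (mnd_fun M) (mnd_fun N)"
    by (rule nat_trans_SET_I[OF MD(1) ND(1)]) (use \<phi> nat in simp_all)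
  moreover have "compose (elts X) (\<phi> X) (mnd_unit M X) = mnd_unit N X" for X
    by (rule PiE_eqI[OF compose_PiE[OF MD(2) \<phi>] ND(2)]) (simp add: compose_eq unit)
  ultimately show ?thesis
    unfolding monad_morphisms_def Let_def by (simp add: compose_def mult cong: restrict_cong)
qed

section \<open>The category of finitary monads\<close>

lemma Mnd_f_simps:
  "M \<in> Ob Mnd_f \<longleftrightarrow> is_monad SET M \<and> finitary (mnd_fun M)"
  "Hom Mnd_f = monad_morphisms SET"
  "Idn Mnd_f M = (\<lambda>X. \<lambda>t\<in>elts (FO (mnd_fun M) X). t)"
  "Cmp Mnd_f L M N \<psi> \<phi> = (\<lambda>X. compose (elts (FO (mnd_fun L) X)) (\<psi> X) (\<phi> X))"
  by (auto simp: Mnd_f_def finitary_def is_monad_def Let_def)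

lemma is_category_Mnd_f: "is_category Mnd_f"
proof -
  have idn: "(\<lambda>X. \<lambda>t\<in>elts (FO (mnd_fun M) X). t) \<in> monad_morphisms SET M M"
    if M: "is_monad SET M" for M :: "('u::set_universe, 'u \<Rightarrow> 'u) monad"
  proof (rule monad_morphisms_SET_I[OF M M])
    note MD = is_monad_SET_D[OF M] and TD = functor_SET_SET_D[OF is_monad_SET_D(1)[OF M]]
    fix X u assume "u \<in> elts (FO (mnd_fun M) (FO (mnd_fun M) X))"
    then show "(\<lambda>t\<in>elts (FO (mnd_fun M) X). t) (mnd_mult M X u) = mnd_mult M X
      ((\<lambda>t\<in>elts (FO (mnd_fun M) (FO (mnd_fun M) X)). t) (FM (mnd_fun M) (FO (mnd_fun M) X) (FO (mnd_fun M) X)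
        (\<lambda>t\<in>elts (FO (mnd_fun M) X). t) u))"
      using MD(6) TD(3) by simp
  qed (use is_monad_SET_D[OF M] functor_SET_SET_D[OF is_monad_SET_D(1)[OF M]] in simp_all)
  have cmp: "(\<lambda>X. compose (elts (FO (mnd_fun L) X)) (\<psi> X) (\<phi> X)) \<in> monad_morphisms SET L N"
    if L: "is_monad SET L" and M: "is_monad SET M" and N: "is_monad SET N"
      and \<phi>: "\<phi> \<in> monad_morphisms SET L M" and \<psi>: "\<psi> \<in> monad_morphisms SET M N"
    for L M N :: "('u::set_universe, 'u \<Rightarrow> 'u) monad" and \<phi> \<psi>
  proof (rule monad_morphisms_SET_I[OF L N])
    note LD = is_monad_SET_D[OF L] and TD = functor_SET_SET_D[OF is_monad_SET_D(1)[OF L]]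
    note MD = is_monad_SET_D[OF M] and SD = functor_SET_SET_D[OF is_monad_SET_D(1)[OF M]]
    note \<phi>D = monad_morphisms_SET_D[OF \<phi>] and \<psi>D = monad_morphisms_SET_D[OF \<psi>]
    show "compose (elts (FO (mnd_fun L) X)) (\<psi> X) (\<phi> X) \<in> FO (mnd_fun L) X \<leadsto> FO (mnd_fun N) X" for X
      by (rule compose_PiE[OF \<phi>D(1) \<psi>D(1)])
    show "compose (elts (FO (mnd_fun L) Y)) (\<psi> Y) (\<phi> Y) (FM (mnd_fun L) X Y f t) =
        FM (mnd_fun N) X Y f (compose (elts (FO (mnd_fun L) X)) (\<psi> X) (\<phi> X) t)"
      if "f \<in> X \<leadsto> Y" "t \<in> elts (FO (mnd_fun L) X)" for X Y f t
      using that TD(2) \<phi>D(2,3) \<psi>D(3) by (simp add: compose_eq)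
    show "compose (elts (FO (mnd_fun L) X)) (\<psi> X) (\<phi> X) (mnd_unit L X x) = mnd_unit N X x" if "x \<in> elts X" for X x
      using that LD(3) \<phi>D(4) \<psi>D(4) by (simp add: compose_eq)
    fix X u assume u: "u \<in> elts (FO (mnd_fun L) (FO (mnd_fun L) X))"
    let ?L = "FO (mnd_fun L)" and ?M = "FO (mnd_fun M)" and ?N = "FO (mnd_fun N)"
    have u': "FM (mnd_fun L) (?L X) (?M X) (\<phi> X) u \<in> elts (?L (?M X))"
      by (rule TD(2)[OF \<phi>D(1) u])
    have "compose (elts (?L X)) (\<psi> X) (\<phi> X) (mnd_mult L X u) =
        mnd_mult N X (\<psi> (?N X) (FM (mnd_fun M) (?M X) (?N X) (\<psi> X)
          (\<phi> (?M X) (FM (mnd_fun L) (?L X) (?M X) (\<phi> X) u))))"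
      using u LD(6) \<phi>D(2)[OF u'] by (simp add: compose_eq \<phi>D(5) \<psi>D(5))
    \<comment> \<open>Naturality of \<phi> at the map \<open>\<psi> X\<close> brings \<phi> and
      \<psi> next to each other in front of the functorial part.\<close>
    also have "FM (mnd_fun M) (?M X) (?N X) (\<psi> X) (\<phi> (?M X) (FM (mnd_fun L) (?L X) (?M X) (\<phi> X) u)) =
        \<phi> (?N X) (FM (mnd_fun L) (?M X) (?N X) (\<psi> X) (FM (mnd_fun L) (?L X) (?M X) (\<phi> X) u))"
      by (rule \<phi>D(3)[OF \<psi>D(1) u', symmetric])
    also have "FM (mnd_fun L) (?M X) (?N X) (\<psi> X) (FM (mnd_fun L) (?L X) (?M X) (\<phi> X) u) =
        FM (mnd_fun L) (?L X) (?N X) (compose (elts (?L X)) (\<psi> X) (\<phi> X)) u"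
      by (rule TD(4)[OF \<phi>D(1) \<psi>D(1) u, symmetric])
    also have "\<psi> (?N X) (\<phi> (?N X) \<dots>) = compose (elts (?L (?N X))) (\<psi> (?N X)) (\<phi> (?N X)) \<dots>"
      by (rule compose_eq[symmetric], rule TD(2)[OF compose_PiE[OF \<phi>D(1) \<psi>D(1)] u])
    finally show "compose (elts (?L X)) (\<psi> X) (\<phi> X) (mnd_mult L X u) = mnd_mult N X
      (compose (elts (?L (?N X))) (\<psi> (?N X)) (\<phi> (?N X)) (FM (mnd_fun L) (?L X) (?N X)
        (compose (elts (?L X)) (\<psi> X) (\<phi> X)) u))" .
  qed
  show ?thesis
    unfolding is_category_def Mnd_f_simps
    by (auto simp: Mnd_f_simps(1) idn cmp compose_id_PiE[OF monad_morphisms_SET_D(1)]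
        intro!: compose_assoc_PiE[OF monad_morphisms_SET_D(1), symmetric])
qed

section \<open>The one-object enriched category of a monad\<close>

lemma restrict_to_FIN_simps [simp]:
  "n \<in> Ob FIN \<Longrightarrow> FO (restrict_to_FIN M) n = FO (mnd_fun M) n"
  "m \<in> Ob FIN \<Longrightarrow> n \<in> Ob FIN \<Longrightarrow> s \<in> m \<leadsto> n \<Longrightarrow> FM (restrict_to_FIN M) m n s = FM (mnd_fun M) m n s"
  by (simp_all add: restrict_to_FIN_def ftr_comp_def)

lemma Sigma_vcat_simps [simp]:
  "VOb (Sigma_vcat M) = {vset {}}" "VHom (Sigma_vcat M) x y = restrict_to_FIN M"
  "VIdn (Sigma_vcat M) x = (\<lambda>n\<in>Ob FIN. mnd_unit M n)"
  by (simp_all add: Sigma_vcat_def Let_def)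

context
  fixes M :: "('u::set_universe, 'u \<Rightarrow> 'u) monad"
  assumes M: "is_monad SET M"
begin

lemma is_functor_restrict_to_FIN: "is_functor FIN SET (restrict_to_FIN M)"
proof (rule is_functor_SET_I[OF is_category_FIN])
  note TD = functor_SET_SET_D[OF is_monad_SET_D(1)[OF M]]
  show "FO (restrict_to_FIN M) \<in> extensional (Ob FIN)"
    by (simp add: restrict_to_FIN_def ftr_comp_def)
  show "FM (restrict_to_FIN M) \<in> (\<Pi>\<^sub>E x\<in>Ob FIN. \<Pi>\<^sub>E y\<in>Ob FIN. Hom FIN x y \<rightarrow>\<^sub>E
      (FO (restrict_to_FIN M) x \<leadsto> FO (restrict_to_FIN M) y))"
    using TD(1) by (simp add: restrict_to_FIN_def ftr_comp_def)
qed (use functor_SET_SET_D[OF is_monad_SET_D(1)[OF M]] in \<open>simp_all add: compose_PiE\<close>)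

lemma Sigma_mult_glue:
  assumes "m \<in> Ob FIN" "m' \<in> Ob FIN" "s \<in> m \<leadsto> m'" "a \<in> elts (FO (restrict_to_FIN M) m)"
    "b \<in> m' \<leadsto> FO (restrict_to_FIN M) n" "n \<in> Ob FIN"
  shows "mnd_mult M n (FM (mnd_fun M) m (FO (mnd_fun M) n) (compose (elts m) b s) a) =
      mnd_mult M n (FM (mnd_fun M) m' (FO (mnd_fun M) n) b (FM (restrict_to_FIN M) m m' s a))"
  using assms functor_SET_SET_D[OF is_monad_SET_D(1)[OF M]] by simp

lemma Sigma_VCmp_class [simp]:
  assumes "n \<in> Ob FIN" "m \<in> Ob FIN" "a \<in> elts (FO (mnd_fun M) m)" "b \<in> m \<leadsto> FO (mnd_fun M) n"
  shows "VCmp (Sigma_vcat M) x y z n (coend_class (restrict_to_FIN M) (FO (mnd_fun M) n) m a b) =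
    mnd_mult M n (FM (mnd_fun M) m (FO (mnd_fun M) n) b a)"
proof -
  have "coend_lift (restrict_to_FIN M) (FO (restrict_to_FIN M) n)
      (\<lambda>m a b. mnd_mult M n (FM (mnd_fun M) m (FO (mnd_fun M) n) b a))
      (coend_class (restrict_to_FIN M) (FO (restrict_to_FIN M) n) m a b) =
    mnd_mult M n (FM (mnd_fun M) m (FO (mnd_fun M) n) b a)"
    by (rule coend_lift_class[OF is_functor_restrict_to_FIN Sigma_mult_glue]) (use assms in simp_all)
  then show ?thesis using assms(1) by (simp add: Sigma_vcat_def Let_def)
qed

text \<open>Each axiom is one monad law once functoriality and naturality have collected the maps:
  the left unit law uses naturality of \<eta> and the law for \<eta> at \<open>T n\<close>, the
  right one the law for \<open>T \<eta>\<close>, and associativity the associativity of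
  \<mu>.\<close>

lemma is_vcat_Sigma: "is_vcat FSet (Sigma_vcat M)"
proof (rule is_vcat_FSet_I)
  note MD = is_monad_SET_D[OF M] and TD = functor_SET_SET_D[OF is_monad_SET_D(1)[OF M]]
  let ?T = "mnd_fun M" and ?\<mu> = "mnd_mult M" and ?\<eta> = "mnd_unit M"
  fix x y z w
  show "is_functor FIN SET (VHom (Sigma_vcat M) x y)"
    by (simp add: is_functor_restrict_to_FIN)
  show "VIdn (Sigma_vcat M) x \<in> nat_trans FIN SET incl (VHom (Sigma_vcat M) x x)"
    by (rule nat_trans_SET_I[OF is_functor_incl])
      (use is_functor_restrict_to_FIN MD(2,4) in \<open>simp_all add: PiE_app\<close>)
  have "(\<lambda>n\<in>Ob FIN. coend_lift (restrict_to_FIN M) (FO (restrict_to_FIN M) n)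
      (\<lambda>m a b. ?\<mu> n (FM ?T m (FO ?T n) b a)))
    \<in> nat_trans FIN SET (tens (restrict_to_FIN M) (restrict_to_FIN M)) (restrict_to_FIN M)"
  proof (rule nat_trans_tens_I[OF is_functor_restrict_to_FIN is_functor_restrict_to_FIN is_functor_restrict_to_FIN])
    fix n n' m :: 'u and s a b
    assume n: "n \<in> Ob FIN" "n' \<in> Ob FIN" and s: "s \<in> n \<leadsto> n'" and m: "m \<in> Ob FIN" and
      a: "a \<in> elts (FO (restrict_to_FIN M) m)" and b: "b \<in> m \<leadsto> FO (restrict_to_FIN M) n"
    have a': "a \<in> elts (FO ?T m)" and b': "b \<in> m \<leadsto> FO ?T n" using a b n m by simp_all
    show "?\<mu> n' (FM ?T m (FO ?T n') (compose (elts m) (FM (restrict_to_FIN M) n n' s) b) a) =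
        FM (restrict_to_FIN M) n n' s (?\<mu> n (FM ?T m (FO ?T n) b a))"
      using n s TD(2)[OF b' a'] by (simp add: TD(4)[OF b' TD(1)[OF s] a'] MD(7))
  qed (use TD MD(6) Sigma_mult_glue in simp_all)
  then show "VCmp (Sigma_vcat M) x y z \<in> nat_trans FIN SET (tens (VHom (Sigma_vcat M) y z) (VHom (Sigma_vcat M) x y))
      (VHom (Sigma_vcat M) x z)"
    by (simp add: Sigma_vcat_def Let_def)
  fix n m :: 'u assume n: "n \<in> Ob FIN" and m: "m \<in> Ob FIN"
  show "VCmp (Sigma_vcat M) x y y n (coend_class (VHom (Sigma_vcat M) y y) (FO (VHom (Sigma_vcat M) x y) n) m
      (VIdn (Sigma_vcat M) y m i) b) = b i"
    if i: "i \<in> elts m" and b: "b \<in> m \<leadsto> FO (VHom (Sigma_vcat M) x y) n" for i b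
  proof -
    have b: "b \<in> m \<leadsto> FO ?T n" using b n by simp
    then show ?thesis
      using n m MD(3)[OF i] MD(4)[OF b i] MD(8)[OF PiE_app[OF b i]] by simp
  qed
  show "VCmp (Sigma_vcat M) x x y n (coend_class (VHom (Sigma_vcat M) x y) (FO (VHom (Sigma_vcat M) x x) n) m a
        (compose (elts m) (VIdn (Sigma_vcat M) x n) s)) = FM (VHom (Sigma_vcat M) x y) m n s a"
    if a: "a \<in> elts (FO (VHom (Sigma_vcat M) x y) m)" and s: "s \<in> m \<leadsto> n" for a s
  proof -
    have a: "a \<in> elts (FO ?T m)" using a m by simp
    show ?thesis
      using n m a s compose_PiE[OF s MD(2)] MD(9)[OF TD(2)[OF s a]] by (simp add: TD(4)[OF s MD(2) a])
  qed
  fix k :: 'u and a b c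
  assume k: "k \<in> Ob FIN" and "a \<in> elts (FO (VHom (Sigma_vcat M) y z) k)"
    "b \<in> k \<leadsto> FO (VHom (Sigma_vcat M) x y) m" "c \<in> m \<leadsto> FO (VHom (Sigma_vcat M) w x) n"
  then have a: "a \<in> elts (FO ?T k)" and b: "b \<in> k \<leadsto> FO ?T m" and c: "c \<in> m \<leadsto> FO ?T n"
    using n m by simp_all
  let ?d = "\<lambda>j\<in>elts k. ?\<mu> n (FM ?T m (FO ?T n) c (b j))"
  have cb: "compose (elts k) (FM ?T m (FO ?T n) c) b \<in> k \<leadsto> FO ?T (FO ?T n)"
    by (rule compose_PiE[OF b TD(1)[OF c]])
  have d: "?d \<in> k \<leadsto> FO ?T n"
    using MD(6)[OF TD(2)[OF c PiE_app[OF b]]] by simp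
  \<comment> \<open>Naturality of \<mu> along \<open>c : m -> T n\<close> pulls the inner
    multiplication outside, giving two nested multiplications to which associativity
    applies.\<close>
  have "?\<mu> n (FM ?T m (FO ?T n) c (?\<mu> m (FM ?T k (FO ?T m) b a))) =
      ?\<mu> n (?\<mu> (FO ?T n) (FM ?T (FO ?T m) (FO ?T (FO ?T n)) (FM ?T m (FO ?T n) c) (FM ?T k (FO ?T m) b a)))"
    using MD(7)[OF c TD(2)[OF b a]] by simp
  also have "FM ?T (FO ?T m) (FO ?T (FO ?T n)) (FM ?T m (FO ?T n) c) (FM ?T k (FO ?T m) b a) =
      FM ?T k (FO ?T (FO ?T n)) (compose (elts k) (FM ?T m (FO ?T n) c) b) a"
    by (rule TD(4)[OF b TD(1)[OF c] a, symmetric])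
  also have "?\<mu> n (?\<mu> (FO ?T n) \<dots>) = ?\<mu> n (FM ?T (FO ?T (FO ?T n)) (FO ?T n) (?\<mu> n) \<dots>)"
    by (rule MD(10)[OF TD(2)[OF cb a]])
  also have "FM ?T (FO ?T (FO ?T n)) (FO ?T n) (?\<mu> n) (FM ?T k (FO ?T (FO ?T n)) (compose (elts k) (FM ?T m (FO ?T n) c) b) a) =
      FM ?T k (FO ?T n) (compose (elts k) (?\<mu> n) (compose (elts k) (FM ?T m (FO ?T n) c) b)) a"
    by (rule TD(4)[OF cb MD(5) a, symmetric])
  also have "compose (elts k) (?\<mu> n) (compose (elts k) (FM ?T m (FO ?T n) c) b) = ?d"
    by (simp add: compose_def cong: restrict_cong)
  finally have eq: "?\<mu> n (FM ?T m (FO ?T n) c (?\<mu> m (FM ?T k (FO ?T m) b a))) = ?\<mu> n (FM ?T k (FO ?T n) ?d a)" .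
  have d_eq: "(\<lambda>j\<in>elts k. VCmp (Sigma_vcat M) w x y n (coend_class (restrict_to_FIN M) (FO ?T n) m (b j) c)) = ?d"
    using n m PiE_app[OF b] c by (simp cong: restrict_cong)
  show "VCmp (Sigma_vcat M) w x z n (coend_class (VHom (Sigma_vcat M) x z) (FO (VHom (Sigma_vcat M) w x) n) m
        (VCmp (Sigma_vcat M) x y z m (coend_class (VHom (Sigma_vcat M) y z) (FO (VHom (Sigma_vcat M) x y) m) k a b)) c) =
      VCmp (Sigma_vcat M) w y z n (coend_class (VHom (Sigma_vcat M) y z) (FO (VHom (Sigma_vcat M) w y) n) k a
        (\<lambda>j\<in>elts k. VCmp (Sigma_vcat M) w x y n (coend_class (VHom (Sigma_vcat M) x y) (FO (VHom (Sigma_vcat M) w x) n) m (b j) c)))"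
    using n m k a b c MD(6)[OF TD(2)[OF b a]] by (simp only: Sigma_vcat_simps restrict_to_FIN_simps Sigma_VCmp_class d_eq d eq)
qed

end

section \<open>The action of \<Sigma> on monad morphisms\<close>

definition Sigma_map :: "('u::set_universe \<Rightarrow> 'u \<Rightarrow> 'u) \<Rightarrow> ('u, 'u, 'u presheaf_map) vftr" where
  "Sigma_map \<phi> = \<lparr>VFO = (\<lambda>x\<in>{vset {}}. x),
     VFM = (\<lambda>x\<in>{vset {}}. \<lambda>y\<in>{vset {}}. \<lambda>n\<in>Ob FIN. \<phi> n)\<rparr>"

lemma Sigma_functor_simps:
  "M \<in> Ob Mnd_f \<Longrightarrow> FO Sigma_functor M = Sigma_vcat M"
  "M \<in> Ob Mnd_f \<Longrightarrow> N \<in> Ob Mnd_f \<Longrightarrow> \<phi> \<in> Hom Mnd_f M N \<Longrightarrow> FM Sigma_functor M N \<phi> = Sigma_map \<phi>"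
  by (simp_all add: Sigma_functor_def Sigma_map_def)

text \<open>Compatibility with composition is the multiplication law of a monad morphism, followed
  by naturality of \<phi> at the tuple \<open>\<phi> o b\<close>.\<close>

lemma is_vfunctor_Sigma_map:
  fixes M N :: "('u::set_universe, 'u \<Rightarrow> 'u) monad"
  assumes M: "is_monad SET M" and N: "is_monad SET N" and \<phi>: "\<phi> \<in> monad_morphisms SET M N"
  shows "is_vfunctor FSet (Sigma_vcat M) (Sigma_vcat N) (Sigma_map \<phi>)"
proof (rule is_vfunctor_FSet_I[OF is_vcat_Sigma[OF M] is_vcat_Sigma[OF N]])
  note MD = is_monad_SET_D[OF M] and SD = functor_SET_SET_D[OF is_monad_SET_D(1)[OF M]]
  note ND = is_monad_SET_D[OF N] and TD = functor_SET_SET_D[OF is_monad_SET_D(1)[OF N]]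
  note \<phi>D = monad_morphisms_SET_D[OF \<phi>]
  let ?S = "mnd_fun M" and ?T = "mnd_fun N"
  have nat: "(\<lambda>n\<in>Ob FIN. \<phi> n) \<in> nat_trans FIN SET (restrict_to_FIN M) (restrict_to_FIN N)"
    by (rule nat_trans_SET_I[OF is_functor_restrict_to_FIN[OF M] is_functor_restrict_to_FIN[OF N]])
      (use \<phi>D in simp_all)
  show "VFM (Sigma_map \<phi>) x y \<in> nat_trans FIN SET (VHom (Sigma_vcat M) x y)
      (VHom (Sigma_vcat N) (VFO (Sigma_map \<phi>) x) (VFO (Sigma_map \<phi>) y))"
    if "x \<in> VOb (Sigma_vcat M)" "y \<in> VOb (Sigma_vcat M)" for x y
    using that nat by (simp add: Sigma_map_def)
  fix x y z and n m :: 'u and a b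
  assume o: "x \<in> VOb (Sigma_vcat M)" "y \<in> VOb (Sigma_vcat M)" "z \<in> VOb (Sigma_vcat M)"
    and n: "n \<in> Ob FIN" "m \<in> Ob FIN" and "a \<in> elts (FO (VHom (Sigma_vcat M) y z) m)"
    "b \<in> m \<leadsto> FO (VHom (Sigma_vcat M) x y) n"
  then have a: "a \<in> elts (FO ?S m)" and b: "b \<in> m \<leadsto> FO ?S n" by simp_all
  have \<phi>b: "compose (elts m) (\<phi> n) b \<in> m \<leadsto> FO ?T n"
    by (rule compose_PiE[OF b \<phi>D(1)])
  have "\<phi> n (mnd_mult M n (FM ?S m (FO ?S n) b a)) =
      mnd_mult N n (\<phi> (FO ?T n) (FM ?S (FO ?S n) (FO ?T n) (\<phi> n) (FM ?S m (FO ?S n) b a)))"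
    by (rule \<phi>D(5)[OF SD(2)[OF b a]])
  also have "FM ?S (FO ?S n) (FO ?T n) (\<phi> n) (FM ?S m (FO ?S n) b a) =
      FM ?S m (FO ?T n) (compose (elts m) (\<phi> n) b) a"
    by (rule SD(4)[OF b \<phi>D(1) a, symmetric])
  also have "\<phi> (FO ?T n) \<dots> = FM ?T m (FO ?T n) (compose (elts m) (\<phi> n) b) (\<phi> m a)"
    by (rule \<phi>D(3)[OF \<phi>b a])
  finally show "VFM (Sigma_map \<phi>) x z n (VCmp (Sigma_vcat M) x y z n
        (coend_class (VHom (Sigma_vcat M) y z) (FO (VHom (Sigma_vcat M) x y) n) m a b)) =
      VCmp (Sigma_vcat N) (VFO (Sigma_map \<phi>) x) (VFO (Sigma_map \<phi>) y) (VFO (Sigma_map \<phi>) z) n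
        (coend_class (VHom (Sigma_vcat N) (VFO (Sigma_map \<phi>) y) (VFO (Sigma_map \<phi>) z))
        (FO (VHom (Sigma_vcat N) (VFO (Sigma_map \<phi>) x) (VFO (Sigma_map \<phi>) y)) n) m
        (VFM (Sigma_map \<phi>) y z m a) (compose (elts m) (VFM (Sigma_map \<phi>) x y n) b))"
    using o n a b \<phi>b \<phi>D(2)[OF a] by (simp add: Sigma_map_def Sigma_VCmp_class[OF M] Sigma_VCmp_class[OF N])
next
  show "VFO (Sigma_map \<phi>) \<in> VOb (Sigma_vcat M) \<rightarrow>\<^sub>E VOb (Sigma_vcat N)"
    by (rule PiE_I) (auto simp: Sigma_map_def)
qed (use monad_morphisms_SET_D(4)[OF \<phi>] in \<open>simp_all add: Sigma_map_def\<close>)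

lemma is_functor_Sigma:
  "is_functor (Mnd_f :: (('u::set_universe, 'u \<Rightarrow> 'u) monad, 'u \<Rightarrow> 'u \<Rightarrow> 'u) category) (VCAT FSet) Sigma_functor"
  unfolding is_functor_def
proof (intro conjI ballI is_category_Mnd_f is_category_VCAT)
  show "FO Sigma_functor \<in> Ob (Mnd_f :: (('u, 'u \<Rightarrow> 'u) monad, 'u \<Rightarrow> 'u \<Rightarrow> 'u) category) \<rightarrow>\<^sub>E Ob (VCAT FSet)"
    by (simp add: Sigma_functor_def VCAT_def Mnd_f_simps(1) is_vcat_Sigma)
  show "FM Sigma_functor \<in> (\<Pi>\<^sub>E M\<in>Ob (Mnd_f :: (('u, 'u \<Rightarrow> 'u) monad, 'u \<Rightarrow> 'u \<Rightarrow> 'u) category).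
      \<Pi>\<^sub>E N\<in>Ob Mnd_f. Hom Mnd_f M N \<rightarrow>\<^sub>E Hom (VCAT FSet) (FO Sigma_functor M) (FO Sigma_functor N))"
    by (intro PiE_I)
      (simp_all add: Sigma_functor_simps VCAT_def is_vfunctor_Sigma_map Mnd_f_simps(1,2),
        auto simp: Sigma_functor_def Mnd_f_simps(1,2))
next
  fix M :: "('u, 'u \<Rightarrow> 'u) monad" assume M: "M \<in> Ob Mnd_f"
  have "Idn Mnd_f M \<in> Hom Mnd_f M M"
    using is_category_Mnd_f M unfolding is_category_def by blast
  then show "FM Sigma_functor M M (Idn Mnd_f M) = Idn (VCAT FSet) (FO Sigma_functor M)"
    using M by (simp add: Sigma_functor_simps VCAT_def vftr_id_def Sigma_map_def Mnd_f_simps(3) Idn_FSet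
        cong: restrict_cong)
next
  fix L M N :: "('u, 'u \<Rightarrow> 'u) monad" and \<phi> \<psi>
  assume *: "L \<in> Ob Mnd_f" "M \<in> Ob Mnd_f" "N \<in> Ob Mnd_f" "\<phi> \<in> Hom Mnd_f L M" "\<psi> \<in> Hom Mnd_f M N"
  have "Cmp Mnd_f L M N \<psi> \<phi> \<in> Hom Mnd_f L N"
    using is_category_Mnd_f * unfolding is_category_def by blast
  then show "FM Sigma_functor L N (Cmp Mnd_f L M N \<psi> \<phi>) =
      Cmp (VCAT FSet) (FO Sigma_functor L) (FO Sigma_functor M) (FO Sigma_functor N)
        (FM Sigma_functor M N \<psi>) (FM Sigma_functor L M \<phi>)"
    using * by (simp add: Sigma_functor_simps VCAT_def vftr_comp_def Sigma_map_def Mnd_f_simps(4) Cmp_FSet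
        cong: restrict_cong)
qed

section \<open>Full faithfulness\<close>

lemma Sigma_map_inject:
  fixes M N :: "('u::set_universe, 'u \<Rightarrow> 'u) monad"
  assumes M: "finitary (mnd_fun M)" and \<phi>: "\<phi> \<in> monad_morphisms SET M N" and \<psi>: "\<psi> \<in> monad_morphisms SET M N"
    and eq: "Sigma_map \<phi> = Sigma_map \<psi>"
  shows "\<phi> = \<psi>"
proof
  fix X
  have "VFM (Sigma_map \<phi>) (vset {}) (vset {}) n = VFM (Sigma_map \<psi>) (vset {}) (vset {}) n" for n
    by (simp add: eq)
  then have n: "\<phi> n = \<psi> n" if "n \<in> Ob FIN" for n
    using that by (simp add: Sigma_map_def) metis
  show "\<phi> X = \<psi> X"
    by (rule finitary_ext[OF M monad_morphisms_SET_D(1)[OF \<phi>] monad_morphisms_SET_D(1)[OF \<psi>]])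
      (simp add: monad_morphisms_SET_D(3)[OF \<phi>] monad_morphisms_SET_D(3)[OF \<psi>] n)
qed

text \<open>The components at finite cardinals force
  \<open>\<phi> X (S b a) = T b (\<alpha> a)\<close>, and naturality of \<alpha> makes this well
  defined. The unit law is then checked at the cardinal 1, and the multiplication law at a common
  cardinal \<open>n\<close>, where it is the composition axiom of \<open>F\<close>.\<close>

lemma Sigma_map_surj:
  fixes M N :: "('u::set_universe, 'u \<Rightarrow> 'u) monad"
  assumes M: "is_monad SET M" and fin: "finitary (mnd_fun M)" and N: "is_monad SET N"
    and F: "is_vfunctor FSet (Sigma_vcat M) (Sigma_vcat N) F"
  obtains \<phi> where "\<phi> \<in> monad_morphisms SET M N" "Sigma_map \<phi> = F"
proof -
  note MD = is_monad_SET_D[OF M] and SD = functor_SET_SET_D[OF is_monad_SET_D(1)[OF M]]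
  note ND = is_monad_SET_D[OF N] and TD = functor_SET_SET_D[OF is_monad_SET_D(1)[OF N]]
  note FD = is_vfunctor_FSet_D[OF is_vcat_Sigma[OF M] is_vcat_Sigma[OF N] F]
  let ?S = "mnd_fun M" and ?T = "mnd_fun N"
  define \<alpha> where "\<alpha> = VFM F (vset {}) (vset {})"
  have \<alpha>: "\<alpha> \<in> nat_trans FIN SET (restrict_to_FIN M) (restrict_to_FIN N)"
    using FD(5)[of "vset {}" "vset {}"] by (simp add: \<alpha>_def)
  have F0: "VFO F (vset {}) = vset {}" using FD(2)[of "vset {}"] by simp
  have \<alpha>1: "\<alpha> n t \<in> elts (FO ?T n)" if "n \<in> Ob FIN" "t \<in> elts (FO ?S n)" for n t
    using nat_trans_SET_D(3)[OF \<alpha> that(1)] that by simp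
  have \<alpha>2: "\<alpha> n (FM ?S m n s t) = FM ?T m n s (\<alpha> m t)"
    if "n \<in> Ob FIN" "m \<in> Ob FIN" "s \<in> m \<leadsto> n" "t \<in> elts (FO ?S m)" for n m s t
    using nat_trans_FIN_natural[OF \<alpha> that(2,1,3)] that by simp
  have \<alpha>3: "\<alpha> n (mnd_unit M n i) = mnd_unit N n i" if "n \<in> Ob FIN" "i \<in> elts n" for n i
    using FD(6)[of "vset {}" n i] that by (simp add: \<alpha>_def)
  have \<alpha>4: "\<alpha> n (mnd_mult M n (FM ?S m (FO ?S n) b a)) =
      mnd_mult N n (FM ?T m (FO ?T n) (compose (elts m) (\<alpha> n) b) (\<alpha> m a))"
    if n: "n \<in> Ob FIN" "m \<in> Ob FIN" and a: "a \<in> elts (FO ?S m)" and b: "b \<in> m \<leadsto> FO ?S n" for n m a b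
  proof -
    have \<alpha>b: "compose (elts m) (\<alpha> n) b \<in> m \<leadsto> FO ?T n"
      by (rule compose_in_PiE[OF b]) (rule \<alpha>1[OF n(1)])
    show ?thesis
      using FD(7)[of "vset {}" "vset {}" "vset {}" n m a b] n a b \<alpha>b \<alpha>1[OF n(2) a] F0
      by (simp add: \<alpha>_def[symmetric] Sigma_VCmp_class[OF M] Sigma_VCmp_class[OF N])
  qed
  have "\<exists>f\<in>FO ?S X \<leadsto> FO ?T X. \<forall>m\<in>Ob FIN. \<forall>a\<in>elts (FO ?S m). \<forall>b\<in>m \<leadsto> X.
      f (FM ?S m X b a) = FM ?T m X b (\<alpha> m a)" for X
    by (rule finitary_lift[OF fin, where h = "\<lambda>m a b. FM ?T m X b (\<alpha> m a)"])
      (simp_all add: TD(2,4) \<alpha>1 \<alpha>2)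
  then obtain \<phi> where \<phi>: "\<And>X. \<phi> X \<in> FO ?S X \<leadsto> FO ?T X"
    and \<phi>_rep: "\<And>X m a b. m \<in> Ob FIN \<Longrightarrow> a \<in> elts (FO ?S m) \<Longrightarrow> b \<in> m \<leadsto> X \<Longrightarrow>
      \<phi> X (FM ?S m X b a) = FM ?T m X b (\<alpha> m a)" by metis
  \<comment> \<open>Presenting \<open>t\<close> by the identity tuple shows that the extension
    restricts to \<alpha>.\<close>
  have \<phi>n: "\<phi> n t = \<alpha> n t" if "n \<in> Ob FIN" "t \<in> elts (FO ?S n)" for n t
    using \<phi>_rep[OF that, of "\<lambda>x\<in>elts n. x" n] that by (simp add: SD(3) TD(3) \<alpha>1)
  have nat: "\<phi> Y (FM ?S X Y f t) = FM ?T X Y f (\<phi> X t)" if f: "f \<in> X \<leadsto> Y" and t: "t \<in> elts (FO ?S X)" for X Y f t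
  proof -
    obtain m a b where *: "m \<in> Ob FIN" "a \<in> elts (FO ?S m)" "b \<in> m \<leadsto> X" "t = FM ?S m X b a"
      using finitary_rep[OF fin t] by metis
    then show ?thesis
      using f \<alpha>1 compose_PiE[OF *(3) f] by (simp add: \<phi>_rep TD(4) flip: SD(4))
  qed
  have "\<phi> \<in> monad_morphisms SET M N"
  proof (rule monad_morphisms_SET_I[OF M N \<phi> nat])
    fix X :: 'u and x assume x: "x \<in> elts X"
    \<comment> \<open>\<open>x\<close> is the image of the element of 1 under \<open>?x\<close>, and
      naturality of both units reduces the law to \<open>\<alpha>3\<close> at 1.\<close>
    let ?x = "\<lambda>_\<in>elts (vnat (Suc 0)). x" and ?i = "vset {} :: 'u"
    have i: "?i \<in> elts (vnat (Suc 0))" by (simp add: elts_one)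
    have px: "?x \<in> vnat (Suc 0) \<leadsto> X" using x by simp
    have e: "mnd_unit M X x = FM ?S (vnat (Suc 0)) X ?x (mnd_unit M (vnat (Suc 0)) ?i)"
      "mnd_unit N X x = FM ?T (vnat (Suc 0)) X ?x (mnd_unit N (vnat (Suc 0)) ?i)"
      using MD(4)[OF px i] ND(4)[OF px i] i by simp_all
    show "\<phi> X (mnd_unit M X x) = mnd_unit N X x"
      unfolding e \<phi>_rep[OF vnat_FIN(1) MD(3)[OF i] px] \<alpha>3[OF vnat_FIN(1) i] ..
  next
    fix X :: 'u and u assume u: "u \<in> elts (FO ?S (FO ?S X))"
    obtain m a b where m: "m \<in> Ob FIN" "a \<in> elts (FO ?S m)" "b \<in> m \<leadsto> FO ?S X"
      and u_eq: "u = FM ?S m (FO ?S X) b a"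
      using finitary_rep[OF fin u] by metis
    obtain n c b' where n: "n \<in> Ob FIN" "c \<in> n \<leadsto> X" "b' \<in> m \<leadsto> FO ?S n"
      and b_eq: "b = compose (elts m) (FM ?S n X c) b'"
      using finitary_rep_family[OF fin m(1,3)] by metis
    have \<alpha>b: "compose (elts m) (\<alpha> n) b' \<in> m \<leadsto> FO ?T n"
      by (rule compose_in_PiE[OF n(3)]) (rule \<alpha>1[OF n(1)])
    \<comment> \<open>\<open>b\<close> factors through \<open>S c\<close>, so \<open>u\<close> is
      the image of an element of \<open>S (S n)\<close>. There \<open>\<alpha>4\<close> applies, and
      the rest of the chain returns to \<open>X\<close> by naturality.\<close>
    have "u = FM ?S (FO ?S n) (FO ?S X) (FM ?S n X c) (FM ?S m (FO ?S n) b' a)"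
      unfolding u_eq b_eq by (rule SD(4)[OF n(3) SD(1)[OF n(2)] m(2)])
    then have "\<phi> X (mnd_mult M X u) = \<phi> X (FM ?S n X c (mnd_mult M n (FM ?S m (FO ?S n) b' a)))"
      using MD(7)[OF n(2) SD(2)[OF n(3) m(2)]] by simp
    also have "\<dots> = FM ?T n X c (\<alpha> n (mnd_mult M n (FM ?S m (FO ?S n) b' a)))"
      by (rule \<phi>_rep[OF n(1) MD(6)[OF SD(2)[OF n(3) m(2)]] n(2)])
    also have "\<alpha> n (mnd_mult M n (FM ?S m (FO ?S n) b' a)) =
        mnd_mult N n (FM ?T m (FO ?T n) (compose (elts m) (\<alpha> n) b') (\<alpha> m a))"
      by (rule \<alpha>4[OF n(1) m(1,2) n(3)])
    also have "FM ?T n X c \<dots> = mnd_mult N X (FM ?T (FO ?T n) (FO ?T X) (FM ?T n X c)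
        (FM ?T m (FO ?T n) (compose (elts m) (\<alpha> n) b') (\<alpha> m a)))"
      by (rule ND(7)[OF n(2) TD(2)[OF \<alpha>b \<alpha>1[OF m(1,2)]], symmetric])
    also have "FM ?T (FO ?T n) (FO ?T X) (FM ?T n X c) (FM ?T m (FO ?T n) (compose (elts m) (\<alpha> n) b') (\<alpha> m a)) =
        FM ?T m (FO ?T X) (compose (elts m) (FM ?T n X c) (compose (elts m) (\<alpha> n) b')) (\<alpha> m a)"
      by (rule TD(4)[OF \<alpha>b TD(1)[OF n(2)] \<alpha>1[OF m(1,2)], symmetric])
    also have "compose (elts m) (FM ?T n X c) (compose (elts m) (\<alpha> n) b') = compose (elts m) (\<phi> X) b"
      unfolding b_eq using PiE_app[OF n(3)] n(1,2) by (simp add: compose_def \<phi>_rep cong: restrict_cong)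
    also have "FM ?T m (FO ?T X) (compose (elts m) (\<phi> X) b) (\<alpha> m a) =
        \<phi> (FO ?T X) (FM ?S m (FO ?T X) (compose (elts m) (\<phi> X) b) a)"
      by (rule \<phi>_rep[OF m(1,2) compose_PiE[OF m(3) \<phi>], symmetric])
    also have "FM ?S m (FO ?T X) (compose (elts m) (\<phi> X) b) a = FM ?S (FO ?S X) (FO ?T X) (\<phi> X) u"
      unfolding u_eq by (rule SD(4)[OF m(3) \<phi> m(2)])
    finally show "\<phi> X (mnd_mult M X u) = mnd_mult N X (\<phi> (FO ?T X) (FM ?S (FO ?S X) (FO ?T X) (\<phi> X) u))" .
  qed
  moreover have "Sigma_map \<phi> = F"
  proof (rule vftr_eqI[of _ "{vset {}}"])
    have "(\<lambda>n\<in>Ob FIN. \<phi> n) = \<alpha>"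
    proof (rule extensionalityI[of _ "Ob FIN"])
      fix n :: 'u assume n: "n \<in> Ob FIN"
      have "\<phi> n = \<alpha> n"
        by (rule PiE_eqI[OF \<phi> nat_trans_SET_D(2)[OF \<alpha> n, unfolded restrict_to_FIN_simps[OF n]]]) (rule \<phi>n[OF n])
      then show "(\<lambda>n\<in>Ob FIN. \<phi> n) n = \<alpha> n" using n by simp
    qed (use nat_trans_SET_D(1)[OF \<alpha>] in simp_all)
    then show "VFM (Sigma_map \<phi>) x y = VFM F x y" if "x \<in> {vset {}}" "y \<in> {vset {}}" for x y
      using that by (simp add: Sigma_map_def \<alpha>_def)
  qed (use FD(1-4) F0 in \<open>simp_all add: Sigma_map_def PiE_def\<close>)
  ultimately show ?thesis by (rule that)
qed

lemma fully_faithful_Sigma: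
  "fully_faithful (Mnd_f :: (('u::set_universe, 'u \<Rightarrow> 'u) monad, 'u \<Rightarrow> 'u \<Rightarrow> 'u) category) (VCAT FSet) Sigma_functor"
  unfolding fully_faithful_def
proof (intro ballI bij_betwI')
  fix M N :: "('u, 'u \<Rightarrow> 'u) monad" assume M: "M \<in> Ob Mnd_f" and N: "N \<in> Ob Mnd_f"
  then have *: "is_monad SET M" "finitary (mnd_fun M)" "is_monad SET N"
    by (simp_all add: Mnd_f_simps)
  show "(FM Sigma_functor M N \<phi> = FM Sigma_functor M N \<psi>) = (\<phi> = \<psi>)"
    if "\<phi> \<in> Hom Mnd_f M N" "\<psi> \<in> Hom Mnd_f M N" for \<phi> \<psi>
    using that Sigma_map_inject[OF *(2)] by (auto simp: Sigma_functor_simps[OF M] Sigma_functor_simps(2)[OF M N] Mnd_f_simps(2))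
  show "FM Sigma_functor M N \<phi> \<in> Hom (VCAT FSet) (FO Sigma_functor M) (FO Sigma_functor N)"
    if "\<phi> \<in> Hom Mnd_f M N" for \<phi>
    using that M N is_vfunctor_Sigma_map[OF *(1,3)] by (simp add: Sigma_functor_simps VCAT_def Mnd_f_simps(2))
  fix F assume "F \<in> Hom (VCAT FSet) (FO Sigma_functor M) (FO Sigma_functor N)"
  then have "is_vfunctor FSet (Sigma_vcat M) (Sigma_vcat N) F"
    using M N by (simp add: Sigma_functor_simps VCAT_def)
  then obtain \<phi> where "\<phi> \<in> monad_morphisms SET M N" "Sigma_map \<phi> = F"
    by (rule Sigma_map_surj[OF *])
  then show "\<exists>\<phi>\<in>Hom Mnd_f M N. F = FM Sigma_functor M N \<phi>"
    using M N by (intro bexI[of _ \<phi>]) (simp_all add: Sigma_functor_simps Mnd_f_simps(2))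
qed

subsection \<open>The \<open>[F, Set]\<close>-category \<open>\<S>\<close>\<close>

lemma S_hom_simps [simp]:
  "n \<in> Ob FIN \<Longrightarrow> FO (S_hom X Y) n = vexp (vexp n X) Y"
  "m \<in> Ob FIN \<Longrightarrow> n \<in> Ob FIN \<Longrightarrow> s \<in> m \<leadsto> n \<Longrightarrow> g \<in> elts (vexp (vexp m X) Y) \<Longrightarrow>
    FM (S_hom X Y) m n s g = vlam (vexp n X) (\<lambda>x. vapp g (vlam m (\<lambda>i. vapp x (s i))))"
  by (simp_all add: S_hom_def)

lemma vlam_reindex_in:
  "s \<in> m \<leadsto> n \<Longrightarrow> x \<in> elts (vexp n X) \<Longrightarrow> vlam m (\<lambda>i. vapp x (s i)) \<in> elts (vexp m X)"
  by (rule vlam_in_vexp) (rule vapp_in, assumption, rule PiE_app)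

lemma S_hom_FM_in:
  assumes "s \<in> m \<leadsto> n" "g \<in> elts (vexp (vexp m X) Y)"
  shows "vlam (vexp n X) (\<lambda>x. vapp g (vlam m (\<lambda>i. vapp x (s i)))) \<in> elts (vexp (vexp n X) Y)"
  by (rule vlam_in_vexp, rule vapp_in[OF assms(2)], rule vlam_reindex_in[OF assms(1)])

lemma is_functor_S_hom:
  fixes X Y :: "'u::set_universe"
  shows "is_functor FIN SET (S_hom X Y)"
proof (rule is_functor_SET_I[OF is_category_FIN])
  show "FO (S_hom X Y) \<in> extensional (Ob FIN)" by (simp add: S_hom_def)
  show "FM (S_hom X Y) \<in> (\<Pi>\<^sub>E m\<in>Ob FIN. \<Pi>\<^sub>E n\<in>Ob FIN. Hom FIN m n \<rightarrow>\<^sub>E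
      (FO (S_hom X Y) m \<leadsto> FO (S_hom X Y) n))"
    by (simp add: S_hom_def S_hom_FM_in)
next
  fix n :: 'u and g assume n: "n \<in> Ob FIN" and "g \<in> elts (FO (S_hom X Y) n)"
  then have g: "g \<in> elts (vexp (vexp n X) Y)" by simp
  have "vlam (vexp n X) (\<lambda>x. vapp g (vlam n (\<lambda>i. vapp x ((\<lambda>x\<in>elts n. x) i)))) = vlam (vexp n X) (vapp g)"
    by (intro vlam_cong arg_cong[where f = "vapp g"]) (simp add: vlam_vapp cong: vlam_cong)
  then show "FM (S_hom X Y) n n (Idn FIN n) g = g"
    using n g by (simp add: vlam_vapp)
next
  fix k m n :: 'u and s r g
  assume n: "k \<in> Ob FIN" "m \<in> Ob FIN" "n \<in> Ob FIN" and "s \<in> Hom FIN k m" "r \<in> Hom FIN m n"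
    and "g \<in> elts (FO (S_hom X Y) k)"
  then have s: "s \<in> k \<leadsto> m" and r: "r \<in> m \<leadsto> n" and g: "g \<in> elts (vexp (vexp k X) Y)"
    by simp_all
  have "vlam (vexp n X) (\<lambda>x. vapp g (vlam k (\<lambda>i. vapp x (compose (elts k) r s i)))) =
      vlam (vexp n X) (\<lambda>x. vapp (vlam (vexp m X) (\<lambda>x. vapp g (vlam k (\<lambda>i. vapp x (s i))))) (vlam m (\<lambda>i. vapp x (r i))))"
    by (rule vlam_cong) (simp add: vapp_vlam vlam_reindex_in[OF r] PiE_app[OF s] compose_eq cong: vlam_cong)
  then show "FM (S_hom X Y) k n (Cmp FIN k m n r s) g = FM (S_hom X Y) m n r (FM (S_hom X Y) k m s g)"
    using n s r g S_hom_FM_in[OF s g] by (simp add: compose_PiE)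
qed

lemma S_vcat_simps [simp]:
  "VOb S_vcat = UNIV" "VHom S_vcat = S_hom"
  "n \<in> Ob FIN \<Longrightarrow> j \<in> elts n \<Longrightarrow> VIdn S_vcat X n j = vlam (vexp n X) (\<lambda>x. vapp x j)"
  by (simp_all add: S_vcat_def)

lemma S_tuple_in:
  assumes "f \<in> m \<leadsto> vexp Q Y" "x \<in> elts Q"
  shows "vlam m (\<lambda>j. vapp (f j) x) \<in> elts (vexp m Y)"
  by (rule vlam_in_vexp, rule vapp_in[OF PiE_app[OF assms(1)] assms(2)])

lemma S_comp_in:
  assumes "g \<in> elts (vexp (vexp m Y) Z)" "f \<in> m \<leadsto> vexp Q Y"
  shows "vlam Q (\<lambda>x. vapp g (vlam m (\<lambda>j. vapp (f j) x))) \<in> elts (vexp Q Z)"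
  by (rule vlam_in_vexp, rule vapp_in[OF assms(1)], rule S_tuple_in[OF assms(2)])

text \<open>The operation \<open>FM (S_hom Y Z) m m' s g\<close> applies \<open>g\<close> to its
  \<open>m'\<close>-tuple reindexed along \<open>s\<close>, so both sides feed the same arguments to
  \<open>g\<close>.\<close>

lemma S_comp_glue:
  fixes X Y Z n :: "'u::set_universe"
  assumes "n \<in> Ob FIN" "m \<in> Ob FIN" "m' \<in> Ob FIN" and s: "s \<in> m \<leadsto> m'"
    and "g \<in> elts (FO (S_hom Y Z) m)" "f \<in> m' \<leadsto> FO (S_hom X Y) n"
  shows "vlam (vexp n X) (\<lambda>x. vapp g (vlam m (\<lambda>j. vapp (compose (elts m) f s j) x))) =
    vlam (vexp n X) (\<lambda>x. vapp (FM (S_hom Y Z) m m' s g) (vlam m' (\<lambda>j. vapp (f j) x)))"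
proof (rule vlam_cong)
  fix x assume x: "x \<in> elts (vexp n X)"
  have f: "f \<in> m' \<leadsto> vexp (vexp n X) Y" and g: "g \<in> elts (vexp (vexp m Y) Z)"
    using assms by simp_all
  show "vapp g (vlam m (\<lambda>j. vapp (compose (elts m) f s j) x)) =
      vapp (FM (S_hom Y Z) m m' s g) (vlam m' (\<lambda>j. vapp (f j) x))"
    using assms(2,3) s g S_tuple_in[OF f x] PiE_app[OF s] by (simp add: vapp_vlam compose_eq cong: vlam_cong)
qed

lemma S_VCmp_class [simp]:
  assumes "n \<in> Ob FIN" "m \<in> Ob FIN" "g \<in> elts (vexp (vexp m Y) Z)" "f \<in> m \<leadsto> vexp (vexp n X) Y"
  shows "VCmp S_vcat X Y Z n (coend_class (S_hom Y Z) (vexp (vexp n X) Y) m g f) =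
    vlam (vexp n X) (\<lambda>x. vapp g (vlam m (\<lambda>j. vapp (f j) x)))"
proof -
  have "coend_lift (S_hom Y Z) (FO (S_hom X Y) n) (\<lambda>m g f. vlam (vexp n X) (\<lambda>x. vapp g (vlam m (\<lambda>j. vapp (f j) x))))
      (coend_class (S_hom Y Z) (FO (S_hom X Y) n) m g f) = vlam (vexp n X) (\<lambda>x. vapp g (vlam m (\<lambda>j. vapp (f j) x)))"
    by (rule coend_lift_class[OF is_functor_S_hom S_comp_glue]) (use assms in simp_all)
  then show ?thesis using assms(1) by (simp add: S_vcat_def)
qed

text \<open>Composition in \<open>S_vcat\<close> is substitution of functions of several variables,
  so the laws hold at each argument. The work is to see that every tuple lies in the power on which
  an operation is defined, since \<open>vapp\<close> of a \<open>vlam\<close> is known only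
  there.\<close>

lemma is_vcat_S: "is_vcat FSet (S_vcat :: ('u::set_universe, 'u presheaf, 'u presheaf_map) vcat)"
proof (rule is_vcat_FSet_I)
  fix W X Y Z :: 'u
  show "is_functor FIN SET (VHom S_vcat X Y)" by (simp add: is_functor_S_hom)
  show "VIdn S_vcat X \<in> nat_trans FIN SET incl (VHom S_vcat X X)"
  proof (rule nat_trans_SET_I[OF is_functor_incl])
    fix m n :: 'u and s j assume "m \<in> Ob FIN" "n \<in> Ob FIN" "s \<in> Hom FIN m n" "j \<in> elts (FO incl m)"
    then have *: "m \<in> Ob FIN" "n \<in> Ob FIN" "s \<in> m \<leadsto> n" "j \<in> elts m" by simp_all
    have "vlam (vexp m X) (\<lambda>x. vapp x j) \<in> elts (vexp (vexp m X) X)"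
      by (rule vlam_in_vexp) (rule vapp_in[OF _ *(4)])
    then show "VIdn S_vcat X n (FM incl m n s j) = FM (VHom S_vcat X X) m n s (VIdn S_vcat X m j)"
      using * PiE_app[OF *(3)] vlam_reindex_in[OF *(3)] by (simp add: vapp_vlam cong: vlam_cong)
  next
    fix n :: 'u assume n: "n \<in> Ob FIN"
    have "vlam (vexp n X) (\<lambda>x. vapp x j) \<in> elts (vexp (vexp n X) X)" if "j \<in> elts n" for j
      by (rule vlam_in_vexp) (rule vapp_in[OF _ that])
    then show "VIdn S_vcat X n \<in> FO incl n \<leadsto> FO (VHom S_vcat X X) n"
      using n by (simp add: S_vcat_def)
  qed (simp_all add: is_functor_S_hom S_vcat_def)
  have "(\<lambda>n\<in>Ob FIN. coend_lift (S_hom Y Z) (FO (S_hom X Y) n)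
      (\<lambda>m g f. vlam (vexp n X) (\<lambda>x. vapp g (vlam m (\<lambda>j. vapp (f j) x)))))
    \<in> nat_trans FIN SET (tens (S_hom Y Z) (S_hom X Y)) (S_hom X Z)"
  proof (rule nat_trans_tens_I[OF is_functor_S_hom is_functor_S_hom is_functor_S_hom])
    fix n m :: 'u and g f
    assume n: "n \<in> Ob FIN" "m \<in> Ob FIN" and "g \<in> elts (FO (S_hom Y Z) m)" "f \<in> m \<leadsto> FO (S_hom X Y) n"
    then have g: "g \<in> elts (vexp (vexp m Y) Z)" and f: "f \<in> m \<leadsto> vexp (vexp n X) Y"
      by simp_all
    note gf = S_comp_in[OF g f]
    then show "vlam (vexp n X) (\<lambda>x. vapp g (vlam m (\<lambda>j. vapp (f j) x))) \<in> elts (FO (S_hom X Z) n)"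
      using n by simp
    fix n' :: 'u and s assume n': "n' \<in> Ob FIN" and s: "s \<in> n \<leadsto> n'"
    have "vapp (compose (elts m) (FM (S_hom X Y) n n' s) f j) x = vapp (f j) (vlam n (\<lambda>i. vapp x (s i)))"
      if "j \<in> elts m" "x \<in> elts (vexp n' X)" for j x
      using that n n' s PiE_app[OF f] by (simp add: compose_eq vapp_vlam)
    then show "vlam (vexp n' X) (\<lambda>x. vapp g (vlam m (\<lambda>j. vapp (compose (elts m) (FM (S_hom X Y) n n' s) f j) x))) =
        FM (S_hom X Z) n n' s (vlam (vexp n X) (\<lambda>x. vapp g (vlam m (\<lambda>j. vapp (f j) x))))"
      using n n' s gf vlam_reindex_in[OF s] by (simp add: vapp_vlam cong: vlam_cong)
  qed (rule S_comp_glue)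
  then show "VCmp S_vcat X Y Z \<in> nat_trans FIN SET (tens (VHom S_vcat Y Z) (VHom S_vcat X Y)) (VHom S_vcat X Z)"
    by (simp add: S_vcat_def)
  fix n m :: 'u assume n: "n \<in> Ob FIN" and m: "m \<in> Ob FIN"
  have pr: "vlam (vexp m X) (\<lambda>x. vapp x j) \<in> elts (vexp (vexp m X) X)" if "j \<in> elts m" for j m X :: 'u
    by (rule vlam_in_vexp) (rule vapp_in[OF _ that])
  show "VCmp S_vcat X Y Y n (coend_class (VHom S_vcat Y Y) (FO (VHom S_vcat X Y) n) m (VIdn S_vcat Y m i) b) = b i"
    if i: "i \<in> elts m" and b: "b \<in> m \<leadsto> FO (VHom S_vcat X Y) n" for i b
  proof -
    have b: "b \<in> m \<leadsto> vexp (vexp n X) Y" using b n by simp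
    show ?thesis
      using n m i b pr[OF i] S_tuple_in[OF b] vlam_vapp[OF PiE_app[OF b i]]
      by (simp add: vapp_vlam cong: vlam_cong)
  qed
  show "VCmp S_vcat X X Y n (coend_class (VHom S_vcat X Y) (FO (VHom S_vcat X X) n) m a
        (compose (elts m) (VIdn S_vcat X n) s)) = FM (VHom S_vcat X Y) m n s a"
    if a: "a \<in> elts (FO (VHom S_vcat X Y) m)" and s: "s \<in> m \<leadsto> n" for a s
  proof -
    have a: "a \<in> elts (vexp (vexp m X) Y)" using a m by simp
    have eq: "compose (elts m) (VIdn S_vcat X n) s = (\<lambda>j\<in>elts m. vlam (vexp n X) (\<lambda>x. vapp x (s j)))"
      using n PiE_app[OF s] by (simp add: compose_def cong: restrict_cong)
    have "(\<lambda>j\<in>elts m. vlam (vexp n X) (\<lambda>x. vapp x (s j))) \<in> m \<leadsto> vexp (vexp n X) X"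
      using pr PiE_app[OF s] by simp
    then show ?thesis
      unfolding eq using n m a s by (simp add: vapp_vlam cong: vlam_cong)
  qed
  fix k :: 'u and a b c
  assume k: "k \<in> Ob FIN" and "a \<in> elts (FO (VHom S_vcat Y Z) k)"
    "b \<in> k \<leadsto> FO (VHom S_vcat X Y) m" "c \<in> m \<leadsto> FO (VHom S_vcat W X) n"
  then have a: "a \<in> elts (vexp (vexp k Y) Z)" and b: "b \<in> k \<leadsto> vexp (vexp m X) Y"
    and c: "c \<in> m \<leadsto> vexp (vexp n W) X"
    using n m by simp_all
  let ?d = "\<lambda>j\<in>elts k. vlam (vexp n W) (\<lambda>x. vapp (b j) (vlam m (\<lambda>i. vapp (c i) x)))"
  have d_eq: "(\<lambda>j\<in>elts k. VCmp S_vcat W X Y n (coend_class (S_hom X Y) (vexp (vexp n W) X) m (b j) c)) = ?d"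
    using n m PiE_app[OF b] c by (simp cong: restrict_cong)
  have d: "?d \<in> k \<leadsto> vexp (vexp n W) Y"
    using S_comp_in[OF PiE_app[OF b] c] by simp
  have "vlam (vexp n W) (\<lambda>x. vapp (vlam (vexp m X) (\<lambda>x. vapp a (vlam k (\<lambda>j. vapp (b j) x)))) (vlam m (\<lambda>j. vapp (c j) x))) =
      vlam (vexp n W) (\<lambda>x. vapp a (vlam k (\<lambda>j. vapp (?d j) x)))"
    by (rule vlam_cong) (simp add: vapp_vlam S_tuple_in[OF c] cong: vlam_cong)
  then show "VCmp S_vcat W X Z n (coend_class (VHom S_vcat X Z) (FO (VHom S_vcat W X) n) m
        (VCmp S_vcat X Y Z m (coend_class (VHom S_vcat Y Z) (FO (VHom S_vcat X Y) m) k a b)) c) =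
      VCmp S_vcat W Y Z n (coend_class (VHom S_vcat Y Z) (FO (VHom S_vcat W Y) n) k a
        (\<lambda>j\<in>elts k. VCmp S_vcat W X Y n (coend_class (VHom S_vcat X Y) (FO (VHom S_vcat W X) n) m (b j) c)))"
    using S_comp_in[OF a b]
    by (simp only: S_vcat_simps S_hom_simps n m k S_VCmp_class[OF m k a b] d_eq S_VCmp_class[OF n k a d]
        S_VCmp_class[OF n m _ c])
qed

subsection \<open>Isomorphisms of categories\<close>

lemma is_category_D:
  assumes "is_category C"
  shows "x \<in> Ob C \<Longrightarrow> Idn C x \<in> Hom C x x"
    "x \<in> Ob C \<Longrightarrow> y \<in> Ob C \<Longrightarrow> z \<in> Ob C \<Longrightarrow> f \<in> Hom C x y \<Longrightarrow> g \<in> Hom C y z \<Longrightarrow> Cmp C x y z g f \<in> Hom C x z"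
    "x \<in> Ob C \<Longrightarrow> y \<in> Ob C \<Longrightarrow> f \<in> Hom C x y \<Longrightarrow> Cmp C x x y f (Idn C x) = f"
    "x \<in> Ob C \<Longrightarrow> y \<in> Ob C \<Longrightarrow> f \<in> Hom C x y \<Longrightarrow> Cmp C x y y (Idn C y) f = f"
    "w \<in> Ob C \<Longrightarrow> x \<in> Ob C \<Longrightarrow> y \<in> Ob C \<Longrightarrow> z \<in> Ob C \<Longrightarrow> f \<in> Hom C w x \<Longrightarrow> g \<in> Hom C x y \<Longrightarrow> h \<in> Hom C y z
      \<Longrightarrow> Cmp C w x z (Cmp C x y z h g) f = Cmp C w y z h (Cmp C w x y g f)"
  using assms unfolding is_category_def by blast+

lemma is_category_op:
  assumes "is_category C"
  shows "is_category (op_cat C)"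
  using is_category_D[OF assms] unfolding is_category_def op_cat_def by simp

lemma op_cat_simps [simp]:
  "Ob (op_cat C) = Ob C" "Hom (op_cat C) x y = Hom C y x" "Idn (op_cat C) = Idn C"
  "Cmp (op_cat C) x y z g f = Cmp C z y x f g"
  by (simp_all add: op_cat_def)

lemma is_functor_I:
  assumes "is_category C" "is_category D" "FO F \<in> extensional (Ob C)" "FM F \<in> extensional (Ob C)"
    "\<And>x. x \<in> Ob C \<Longrightarrow> FM F x \<in> extensional (Ob C)"
    "\<And>x y. x \<in> Ob C \<Longrightarrow> y \<in> Ob C \<Longrightarrow> FM F x y \<in> extensional (Hom C x y)"
    "\<And>x. x \<in> Ob C \<Longrightarrow> FO F x \<in> Ob D"
    "\<And>x y f. x \<in> Ob C \<Longrightarrow> y \<in> Ob C \<Longrightarrow> f \<in> Hom C x y \<Longrightarrow> FM F x y f \<in> Hom D (FO F x) (FO F y)"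
    "\<And>x. x \<in> Ob C \<Longrightarrow> FM F x x (Idn C x) = Idn D (FO F x)"
    "\<And>x y z f g. x \<in> Ob C \<Longrightarrow> y \<in> Ob C \<Longrightarrow> z \<in> Ob C \<Longrightarrow> f \<in> Hom C x y \<Longrightarrow> g \<in> Hom C y z \<Longrightarrow>
      FM F x z (Cmp C x y z g f) = Cmp D (FO F x) (FO F y) (FO F z) (FM F y z g) (FM F x y f)"
  shows "is_functor C D F"
  using assms unfolding is_functor_def PiE_def Pi_def by simp

lemma is_functor_D:
  assumes "is_functor C D F"
  shows "is_category C" "is_category D" "FO F \<in> extensional (Ob C)" "FM F \<in> extensional (Ob C)"
    "x \<in> Ob C \<Longrightarrow> FM F x \<in> extensional (Ob C)"
    "x \<in> Ob C \<Longrightarrow> y \<in> Ob C \<Longrightarrow> FM F x y \<in> extensional (Hom C x y)"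
    "x \<in> Ob C \<Longrightarrow> FO F x \<in> Ob D"
    "x \<in> Ob C \<Longrightarrow> y \<in> Ob C \<Longrightarrow> f \<in> Hom C x y \<Longrightarrow> FM F x y f \<in> Hom D (FO F x) (FO F y)"
    "x \<in> Ob C \<Longrightarrow> FM F x x (Idn C x) = Idn D (FO F x)"
    "x \<in> Ob C \<Longrightarrow> y \<in> Ob C \<Longrightarrow> z \<in> Ob C \<Longrightarrow> f \<in> Hom C x y \<Longrightarrow> g \<in> Hom C y z \<Longrightarrow>
      FM F x z (Cmp C x y z g f) = Cmp D (FO F x) (FO F y) (FO F z) (FM F y z g) (FM F x y f)"
  using assms unfolding is_functor_def PiE_def Pi_def by simp_all

lemma ftr_eqI:
  fixes F G :: "('o, 'm, 'p, 'n) ftr"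
  assumes F: "is_functor C D F" and G: "is_functor C D' G"
    and FO: "\<And>x. x \<in> Ob C \<Longrightarrow> FO F x = FO G x"
    and FM: "\<And>x y f. x \<in> Ob C \<Longrightarrow> y \<in> Ob C \<Longrightarrow> f \<in> Hom C x y \<Longrightarrow> FM F x y f = FM G x y f"
  shows "F = G"
proof -
  have "FO F = FO G"
    by (rule extensionalityI[OF is_functor_D(3)[OF F] is_functor_D(3)[OF G] FO])
  moreover have "FM F x y = FM G x y" if "x \<in> Ob C" "y \<in> Ob C" for x y
    using is_functor_D(6)[OF F] is_functor_D(6)[OF G] that FM by (intro extensionalityI[of _ "Hom C x y"]) auto
  then have "FM F x = FM G x" if "x \<in> Ob C" for x
    using is_functor_D(5)[OF F] is_functor_D(5)[OF G] that by (intro extensionalityI[of _ "Ob C"]) auto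
  then have "FM F = FM G"
    by (rule extensionalityI[OF is_functor_D(4)[OF F] is_functor_D(4)[OF G]])
  ultimately show ?thesis by simp
qed

lemma ftr_id_simps [simp]:
  "x \<in> Ob C \<Longrightarrow> FO (ftr_id C) x = x"
  "x \<in> Ob C \<Longrightarrow> y \<in> Ob C \<Longrightarrow> f \<in> Hom C x y \<Longrightarrow> FM (ftr_id C) x y f = f"
  by (simp_all add: ftr_id_def)

lemma ftr_comp_simps [simp]:
  "x \<in> Ob C \<Longrightarrow> FO (ftr_comp C G F) x = FO G (FO F x)"
  "x \<in> Ob C \<Longrightarrow> y \<in> Ob C \<Longrightarrow> f \<in> Hom C x y \<Longrightarrow>
    FM (ftr_comp C G F) x y f = FM G (FO F x) (FO F y) (FM F x y f)"
  by (simp_all add: ftr_comp_def)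

lemma is_functor_ftr_id: "is_category C \<Longrightarrow> is_functor C C (ftr_id C)"
  by (rule is_functor_I) (simp_all add: ftr_id_def is_category_D)

lemma is_functor_ftr_comp:
  assumes F: "is_functor C D F" and G: "is_functor D E G"
  shows "is_functor C E (ftr_comp C G F)"
proof (rule is_functor_I)
  note FD = is_functor_D[OF F] and GD = is_functor_D[OF G]
  show "FM (ftr_comp C G F) x x (Idn C x) = Idn E (FO (ftr_comp C G F) x)" if "x \<in> Ob C" for x
    using that FD GD is_category_D(1)[OF FD(1)] by simp
  show "FM (ftr_comp C G F) x z (Cmp C x y z g f) = Cmp E (FO (ftr_comp C G F) x) (FO (ftr_comp C G F) y)
      (FO (ftr_comp C G F) z) (FM (ftr_comp C G F) y z g) (FM (ftr_comp C G F) x y f)"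
    if "x \<in> Ob C" "y \<in> Ob C" "z \<in> Ob C" "f \<in> Hom C x y" "g \<in> Hom C y z" for x y z f g
    using that FD GD is_category_D(2)[OF FD(1)] by simp
qed (use is_functor_D[OF F] is_functor_D[OF G] in \<open>simp_all add: ftr_comp_def\<close>)

lemma CAT_simps [simp]:
  "Ob CAT = {C. is_category C}" "Hom CAT C D = {F. is_functor C D F}" "Idn CAT = ftr_id"
  "Cmp CAT C D E G F = ftr_comp C G F"
  by (simp_all add: CAT_def)

lemma is_category_CAT: "is_category CAT"
proof -
  have unit: "ftr_comp C F (ftr_id C) = F" "ftr_comp C (ftr_id D) F = F" if F: "is_functor C D F" for C D F
    by (rule ftr_eqI[OF is_functor_ftr_comp[OF is_functor_ftr_id[OF is_functor_D(1)[OF F]] F] F];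
        simp add: is_functor_D[OF F])
      (rule ftr_eqI[OF is_functor_ftr_comp[OF F is_functor_ftr_id[OF is_functor_D(2)[OF F]]] F];
        simp add: is_functor_D[OF F])
  have assoc: "ftr_comp C (ftr_comp D H G) F = ftr_comp C H (ftr_comp C G F)"
    if F: "is_functor C D F" and G: "is_functor D E G" and H: "is_functor E E' H" for C D E E' F G H
    by (rule ftr_eqI[OF is_functor_ftr_comp[OF F is_functor_ftr_comp[OF G H]]
          is_functor_ftr_comp[OF is_functor_ftr_comp[OF F G] H]]) (simp_all add: is_functor_D[OF F])
  show ?thesis
    unfolding is_category_def
    by (auto simp: unit intro: is_functor_ftr_id is_functor_ftr_comp assoc)
qed

section \<open>Transport of categories and functors\<close>

definition cat_iso :: "('o, 'm) category \<Rightarrow> ('p, 'n) category \<Rightarrow> ('o, 'm, 'p, 'n) ftr \<Rightarrow> bool" where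
  "cat_iso C D E \<longleftrightarrow> is_functor C D E \<and> fully_faithful C D E \<and> bij_betw (FO E) (Ob C) (Ob D)"

text \<open>\<open>D\<close> is only a bare structure here: as \<open>E\<close> is onto objects and
  onto each hom, every instance of a law in \<open>D\<close> is the image of one in
  \<open>C\<close>. The categories of enriched functors into \<open>S_vcat\<close> acquire their
  laws in this way.\<close>

lemma category_transport:
  assumes C: "is_category C"
    and ob: "FO E ` Ob C = Ob D"
    and hom: "\<And>x y. x \<in> Ob C \<Longrightarrow> y \<in> Ob C \<Longrightarrow> FM E x y ` Hom C x y = Hom D (FO E x) (FO E y)"
    and idn: "\<And>x. x \<in> Ob C \<Longrightarrow> FM E x x (Idn C x) = Idn D (FO E x)"
    and cmp: "\<And>x y z f g. x \<in> Ob C \<Longrightarrow> y \<in> Ob C \<Longrightarrow> z \<in> Ob C \<Longrightarrow> f \<in> Hom C x y \<Longrightarrow> g \<in> Hom C y z \<Longrightarrow>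
      FM E x z (Cmp C x y z g f) = Cmp D (FO E x) (FO E y) (FO E z) (FM E y z g) (FM E x y f)"
  shows "is_category D"
proof -
  note CD = is_category_D[OF C]
  have in_hom: "FM E x y f \<in> Hom D (FO E x) (FO E y)" if "x \<in> Ob C" "y \<in> Ob C" "f \<in> Hom C x y" for x y f
    using hom[OF that(1,2)] that(3) by blast
  show ?thesis
    unfolding is_category_def ob[symmetric]
    by (auto simp: hom[symmetric] CD in_hom simp flip: idn cmp)
qed

text \<open>\<open>F\<close> completes the square with \<open>G\<close>, \<open>E\<close> and
  \<open>E'\<close>, and surjectivity of \<open>E\<close> on objects and arrows carries the functor
  laws over. One use is the inverse of \<open>E\<close>, with identities for \<open>G\<close> and
  \<open>E'\<close>; the other is precomposition with the image of a monad morphism.\<close>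

lemma functor_transport:
  assumes G: "is_functor C C' G" and E: "cat_iso C D E" and E': "is_functor C' D' E'"
    and ext: "FO F \<in> extensional (Ob D)" "FM F \<in> extensional (Ob D)"
      "\<And>x. x \<in> Ob D \<Longrightarrow> FM F x \<in> extensional (Ob D)"
      "\<And>x y. x \<in> Ob D \<Longrightarrow> y \<in> Ob D \<Longrightarrow> FM F x y \<in> extensional (Hom D x y)"
    and FO: "\<And>x. x \<in> Ob C \<Longrightarrow> FO F (FO E x) = FO E' (FO G x)"
    and FM: "\<And>x y f. x \<in> Ob C \<Longrightarrow> y \<in> Ob C \<Longrightarrow> f \<in> Hom C x y \<Longrightarrow>
      FM F (FO E x) (FO E y) (FM E x y f) = FM E' (FO G x) (FO G y) (FM G x y f)"
  shows "is_functor D D' F"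
proof -
  have Ef: "is_functor C D E" and ob: "Ob D = FO E ` Ob C"
    and hom: "\<And>x y. x \<in> Ob C \<Longrightarrow> y \<in> Ob C \<Longrightarrow> Hom D (FO E x) (FO E y) = FM E x y ` Hom C x y"
    using E unfolding cat_iso_def fully_faithful_def bij_betw_def by auto
  note ED = is_functor_D[OF Ef] and GD = is_functor_D[OF G] and E'D = is_functor_D[OF E']
  show ?thesis
  proof (rule is_functor_I[OF ED(2) E'D(2) ext])
    fix x assume "x \<in> Ob D"
    then obtain x' where x: "x' \<in> Ob C" "x = FO E x'" unfolding ob by blast
    then show "FO F x \<in> Ob D'" by (simp add: FO GD E'D)
    have "FM F x x (Idn D x) = FM F (FO E x') (FO E x') (FM E x' x' (Idn C x'))"
      using x by (simp add: ED)
    also have "\<dots> = Idn D' (FO F x)"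
      using x is_category_D(1)[OF ED(1) x(1)] by (simp add: FM FO GD E'D)
    finally show "FM F x x (Idn D x) = Idn D' (FO F x)" .
    fix y assume "y \<in> Ob D"
    then obtain y' where y: "y' \<in> Ob C" "y = FO E y'" unfolding ob by blast
    fix f assume "f \<in> Hom D x y"
    then obtain f' where f: "f' \<in> Hom C x' y'" "f = FM E x' y' f'"
      unfolding x(2) y(2) hom[OF x(1) y(1)] by blast
    then show "FM F x y f \<in> Hom D' (FO F x) (FO F y)"
      using x y by (simp add: FM FO GD E'D)
    fix z assume "z \<in> Ob D"
    then obtain z' where z: "z' \<in> Ob C" "z = FO E z'" unfolding ob by blast
    fix g assume "g \<in> Hom D y z"
    then obtain g' where g: "g' \<in> Hom C y' z'" "g = FM E y' z' g'"
      unfolding y(2) z(2) hom[OF y(1) z(1)] by blast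
    have "FM F x z (Cmp D x y z g f) = FM F (FO E x') (FO E z') (FM E x' z' (Cmp C x' y' z' g' f'))"
      using x y z f g by (simp add: ED)
    also have "\<dots> = Cmp D' (FO F x) (FO F y) (FO F z) (FM F y z g) (FM F x y f)"
      using x y z f g is_category_D(2)[OF ED(1) x(1) y(1) z(1) f(1) g(1)] by (simp add: FM FO GD E'D)
    finally show "FM F x z (Cmp D x y z g f) = Cmp D' (FO F x) (FO F y) (FO F z) (FM F y z g) (FM F x y f)" .
  qed
qed

lemma nat_iso_id:
  assumes F: "is_functor C D F"
  shows "nat_iso C D F F (\<lambda>x\<in>Ob C. Idn D (FO F x))"
proof -
  note FD = is_functor_D[OF F] and DD = is_category_D[OF is_functor_D(2)[OF F]]
  have "is_iso D (FO F x) (FO F x) (Idn D (FO F x))" if "x \<in> Ob C" for x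
    unfolding is_iso_def inverse_arrows_def
    using FD(7)[OF that] DD by (intro exI[of _ "Idn D (FO F x)"]) simp
  then show ?thesis
    unfolding nat_iso_def nat_trans_def by (simp add: FD DD)
qed

text \<open>The inverse is strict, so identity transformations serve as unit and counit.\<close>

lemma cat_iso_is_equivalence:
  assumes E: "cat_iso C D E"
  shows "is_equivalence C D E"
proof -
  have Ef: "is_functor C D E" and ob: "bij_betw (FO E) (Ob C) (Ob D)"
    and hom: "\<And>x y. x \<in> Ob C \<Longrightarrow> y \<in> Ob C \<Longrightarrow> bij_betw (FM E x y) (Hom C x y) (Hom D (FO E x) (FO E y))"
    using E unfolding cat_iso_def fully_faithful_def by auto
  note ED = is_functor_D[OF Ef]
  define h where "h = inv_into (Ob C) (FO E)"
  define H where "H = \<lparr>FO = restrict h (Ob D), FM = (\<lambda>x\<in>Ob D. \<lambda>y\<in>Ob D. \<lambda>f\<in>Hom D x y.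
    inv_into (Hom C (h x) (h y)) (FM E (h x) (h y)) f)\<rparr>"
  have h: "h (FO E x) = x" if "x \<in> Ob C" for x
    unfolding h_def by (rule bij_betw_inv_into_left[OF ob that])
  have hm: "inv_into (Hom C x y) (FM E x y) (FM E x y f) = f" if "x \<in> Ob C" "y \<in> Ob C" "f \<in> Hom C x y" for x y f
    by (rule bij_betw_inv_into_left[OF hom[OF that(1,2)] that(3)])
  have HE: "FO H (FO E x) = x" if "x \<in> Ob C" for x
    using that by (simp add: H_def ED h)
  have HEm: "FM H (FO E x) (FO E y) (FM E x y f) = f" if "x \<in> Ob C" "y \<in> Ob C" "f \<in> Hom C x y" for x y f
    using that by (simp add: H_def ED h hm)
  have Hf: "is_functor D C H"
    by (rule functor_transport[OF is_functor_ftr_id[OF ED(1)] E is_functor_ftr_id[OF ED(1)]])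
      (simp_all add: H_def[THEN arg_cong[where f = FO]] H_def[THEN arg_cong[where f = FM]] ED h hm)
  have c1: "ftr_comp C H E = ftr_id C"
    by (rule ftr_eqI[OF is_functor_ftr_comp[OF Ef Hf] is_functor_ftr_id[OF ED(1)]]) (simp_all add: HE HEm)
  have c2: "ftr_comp D E H = ftr_id D"
  proof (rule ftr_eqI[OF is_functor_ftr_comp[OF Hf Ef] is_functor_ftr_id[OF ED(2)]])
    fix x assume x: "x \<in> Ob D"
    then obtain x' where x': "x' \<in> Ob C" "x = FO E x'" using ob unfolding bij_betw_def by blast
    then show "FO (ftr_comp D E H) x = FO (ftr_id D) x" by (simp add: ED HE)
    fix y f assume y: "y \<in> Ob D" and f: "f \<in> Hom D x y"
    obtain y' where y': "y' \<in> Ob C" "y = FO E y'" using ob y unfolding bij_betw_def by blast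
    obtain f' where f': "f' \<in> Hom C x' y'" "f = FM E x' y' f'"
      using f hom[OF x'(1) y'(1)] unfolding bij_betw_def x'(2) y'(2) by blast
    show "FM (ftr_comp D E H) x y f = FM (ftr_id D) x y f"
      using x y f by (simp add: x'(2) y'(2)) (simp add: f' x' y' HE HEm)
  qed
  show ?thesis
    unfolding is_equivalence_def using Ef Hf c1 c2
      nat_iso_id[OF is_functor_ftr_id[OF ED(1)]] nat_iso_id[OF is_functor_ftr_id[OF ED(2)]] by metis
qed

text \<open>The composition axiom for identity cells says that an identity is the composite of an
  identity with \<open>FM Q y z g\<close> of an identity, once strict naturality has identified the
  objects involved.\<close>

lemma strictly_natural_pseudonaturally_equivalent:
  assumes P: "is_functor C CAT P" and Q: "is_functor C CAT Q"
    and E: "\<And>x. x \<in> Ob C \<Longrightarrow> cat_iso (FO P x) (FO Q x) (E x)"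
    and nat: "\<And>x y f. x \<in> Ob C \<Longrightarrow> y \<in> Ob C \<Longrightarrow> f \<in> Hom C x y \<Longrightarrow>
      ftr_comp (FO P x) (FM Q x y f) (E x) = ftr_comp (FO P x) (E y) (FM P x y f)"
  shows "pseudonaturally_equivalent C P Q"
proof -
  note PD = is_functor_D[OF P] and QD = is_functor_D[OF Q] and CD = is_category_D[OF is_functor_D(1)[OF P]]
  \<comment> \<open>Placed at the target \<open>E y (P f a)\<close>; by strict naturality the source
    \<open>Q f (E x a)\<close> is the same object.\<close>
  define \<theta> where "\<theta> = (\<lambda>x y f. \<lambda>a\<in>Ob (FO P x). Idn (FO Q y) (FO (E y) (FO (FM P x y f) a)))"
  have Ef: "is_functor (FO P x) (FO Q x) (E x)" if "x \<in> Ob C" for x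
    using E[OF that] unfolding cat_iso_def by blast
  have Pf: "is_functor (FO P x) (FO P y) (FM P x y f)" and Qf: "is_functor (FO Q x) (FO Q y) (FM Q x y f)"
    if "x \<in> Ob C" "y \<in> Ob C" "f \<in> Hom C x y" for x y f
    using PD(8)[OF that] QD(8)[OF that] by simp_all
  have natO: "FO (FM Q x y f) (FO (E x) a) = FO (E y) (FO (FM P x y f) a)"
    if "x \<in> Ob C" "y \<in> Ob C" "f \<in> Hom C x y" "a \<in> Ob (FO P x)" for x y f a
    using arg_cong[OF nat[OF that(1-3)], of "\<lambda>F. FO F a"] that(4) by simp
  have "pseudonatural C P Q E \<theta>"
    unfolding pseudonatural_def
  proof (intro conjI ballI)
    fix x assume x: "x \<in> Ob C"
    show "is_functor (FO P x) (FO Q x) (E x)" by (rule Ef[OF x])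
    show "\<theta> x x (Idn C x) a = Idn (FO Q x) (FO (E x) a)" if a: "a \<in> Ob (FO P x)" for a
      using x a PD(9)[OF x] by (simp add: \<theta>_def)
    fix y f assume y: "y \<in> Ob C" and f: "f \<in> Hom C x y"
    show "nat_iso (FO P x) (FO Q y) (ftr_comp (FO P x) (FM Q x y f) (E x)) (ftr_comp (FO P x) (E y) (FM P x y f)) (\<theta> x y f)"
      using nat_iso_id[OF is_functor_ftr_comp[OF Pf[OF x y f] Ef[OF y]]]
      unfolding nat[OF x y f] \<theta>_def by (simp cong: restrict_cong)
    fix z g a assume z: "z \<in> Ob C" and g: "g \<in> Hom C y z" and a: "a \<in> Ob (FO P x)"
    let ?Pa = "FO (FM P x y f) a"
    have Pa: "?Pa \<in> Ob (FO P y)" by (rule is_functor_D(7)[OF Pf[OF x y f] a])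
    have Pga: "FO (FM P y z g) ?Pa \<in> Ob (FO P z)" by (rule is_functor_D(7)[OF Pf[OF y z g] Pa])
    have EPa: "FO (E y) ?Pa \<in> Ob (FO Q y)" by (rule is_functor_D(7)[OF Ef[OF y] Pa])
    have EPga: "FO (E z) (FO (FM P y z g) ?Pa) \<in> Ob (FO Q z)" by (rule is_functor_D(7)[OF Ef[OF z] Pga])
    have "FO (FM P x z (Cmp C x y z g f)) a = FO (FM P y z g) ?Pa"
      using PD(10)[OF x y z f g] a by simp
    moreover have "FM (FM Q y z g) (FO (E y) ?Pa) (FO (E y) ?Pa) (Idn (FO Q y) (FO (E y) ?Pa)) =
        Idn (FO Q z) (FO (E z) (FO (FM P y z g) ?Pa))"
      using is_functor_D(9)[OF Qf[OF y z g] EPa] natO[OF y z g Pa] by simp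
    moreover have "Cmp (FO Q z) (FO (E z) (FO (FM P y z g) ?Pa)) (FO (E z) (FO (FM P y z g) ?Pa))
        (FO (E z) (FO (FM P y z g) ?Pa)) (Idn (FO Q z) (FO (E z) (FO (FM P y z g) ?Pa)))
        (Idn (FO Q z) (FO (E z) (FO (FM P y z g) ?Pa))) = Idn (FO Q z) (FO (E z) (FO (FM P y z g) ?Pa))"
      using is_category_D(1,3)[OF is_functor_D(2)[OF Ef[OF z]]] EPga by simp
    ultimately show "\<theta> x z (Cmp C x y z g f) a =
        Cmp (FO Q z)
          (FO (FM Q y z g) (FO (FM Q x y f) (FO (E x) a)))
          (FO (FM Q y z g) (FO (E y) (FO (FM P x y f) a)))
          (FO (E z) (FO (FM P y z g) (FO (FM P x y f) a)))
          (\<theta> y z g (FO (FM P x y f) a))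
          (FM (FM Q y z g) (FO (FM Q x y f) (FO (E x) a)) (FO (E y) (FO (FM P x y f) a)) (\<theta> x y f a))"
      using a Pa by (simp add: \<theta>_def natO[OF x y f a] natO[OF y z g Pa])
  qed
  then show ?thesis
    unfolding pseudonaturally_equivalent_def using cat_iso_is_equivalence[OF E] by blast
qed

subsection \<open>Algebras\<close>

lemma Alg_simps:
  "(X, a) \<in> Ob (Alg SET M) \<longleftrightarrow> a \<in> FO (mnd_fun M) X \<leadsto> X \<and>
    compose (elts X) a (mnd_unit M X) = (\<lambda>x\<in>elts X. x) \<and>
    compose (elts (FO (mnd_fun M) (FO (mnd_fun M) X))) a (mnd_mult M X) =
    compose (elts (FO (mnd_fun M) (FO (mnd_fun M) X))) a (FM (mnd_fun M) (FO (mnd_fun M) X) X a)"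
  "f \<in> Hom (Alg SET M) (X, a) (Y, b) \<longleftrightarrow> f \<in> X \<leadsto> Y \<and>
    compose (elts (FO (mnd_fun M) X)) f a = compose (elts (FO (mnd_fun M) X)) b (FM (mnd_fun M) X Y f)"
  "Idn (Alg SET M) (X, a) = (\<lambda>x\<in>elts X. x)"
  "Cmp (Alg SET M) (X, a) (Y, b) (Z, c) g f = compose (elts X) g f"
  by (simp_all add: Alg_def Let_def)

lemma restrict_eq_iff: "restrict f A = restrict g A \<longleftrightarrow> (\<forall>x\<in>A. f x = g x)"
  by (auto simp: restrict_def fun_eq_iff)

lemma Alg_Ob_iff:
  "(X, a) \<in> Ob (Alg SET M) \<longleftrightarrow> a \<in> FO (mnd_fun M) X \<leadsto> X \<and>
    (\<forall>x\<in>elts X. a (mnd_unit M X x) = x) \<and>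
    (\<forall>u\<in>elts (FO (mnd_fun M) (FO (mnd_fun M) X)).
      a (mnd_mult M X u) = a (FM (mnd_fun M) (FO (mnd_fun M) X) X a u))"
  unfolding Alg_simps compose_def restrict_eq_iff ..

lemma Alg_Hom_iff:
  "f \<in> Hom (Alg SET M) (X, a) (Y, b) \<longleftrightarrow> f \<in> X \<leadsto> Y \<and>
    (\<forall>t\<in>elts (FO (mnd_fun M) X). f (a t) = b (FM (mnd_fun M) X Y f t))"
  unfolding Alg_simps compose_def restrict_eq_iff ..

lemma is_category_Alg:
  assumes M: "is_monad SET M"
  shows "is_category (Alg SET M)"
proof -
  note TD = functor_SET_SET_D[OF is_monad_SET_D(1)[OF M]]
  have cmp: "compose (elts X) g f \<in> Hom (Alg SET M) (X, a) (Z, c)"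
    if a: "(X, a) \<in> Ob (Alg SET M)" and f: "f \<in> Hom (Alg SET M) (X, a) (Y, b)" and g: "g \<in> Hom (Alg SET M) (Y, b) (Z, c)"
    for X a Y b Z c f g
  proof -
    have a: "a \<in> FO (mnd_fun M) X \<leadsto> X" using a by (simp add: Alg_Ob_iff)
    have f: "f \<in> X \<leadsto> Y" "\<And>t. t \<in> elts (FO (mnd_fun M) X) \<Longrightarrow> f (a t) = b (FM (mnd_fun M) X Y f t)"
      and g: "g \<in> Y \<leadsto> Z" "\<And>t. t \<in> elts (FO (mnd_fun M) Y) \<Longrightarrow> g (b t) = c (FM (mnd_fun M) Y Z g t)"
      using f g by (simp_all add: Alg_Hom_iff)
    show ?thesis
      using compose_PiE[OF f(1) g(1)] PiE_app[OF a] TD(2)[OF f(1)] TD(4)[OF f(1) g(1)]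
      by (simp add: Alg_Hom_iff compose_eq f g)
  qed
  have idn: "(\<lambda>x\<in>elts X. x) \<in> Hom (Alg SET M) (X, a) (X, a)" if "(X, a) \<in> Ob (Alg SET M)" for X a
  proof -
    have "a t \<in> elts X" if "t \<in> elts (FO (mnd_fun M) X)" for t
      using \<open>(X, a) \<in> Ob (Alg SET M)\<close> that unfolding Alg_Ob_iff by (blast dest: PiE_app)
    then show ?thesis using TD(3) by (simp add: Alg_Hom_iff)
  qed
  show ?thesis
    unfolding is_category_def
  proof (intro conjI ballI; clarify)
    fix X a assume *: "(X, a) \<in> Ob (Alg SET M)"
    show "Idn (Alg SET M) (X, a) \<in> Hom (Alg SET M) (X, a) (X, a)"
      using idn[OF *] by (simp add: Alg_simps(3))
    fix Y b f assume f: "f \<in> Hom (Alg SET M) (X, a) (Y, b)"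
    then have f': "f \<in> X \<leadsto> Y" by (simp add: Alg_Hom_iff)
    show "Cmp (Alg SET M) (X, a) (X, a) (Y, b) f (Idn (Alg SET M) (X, a)) = f"
      "Cmp (Alg SET M) (X, a) (Y, b) (Y, b) (Idn (Alg SET M) (Y, b)) f = f"
      by (simp_all add: Alg_simps(3,4) compose_id_PiE[OF f'])
    fix Z c g assume g: "g \<in> Hom (Alg SET M) (Y, b) (Z, c)"
    show "Cmp (Alg SET M) (X, a) (Y, b) (Z, c) g f \<in> Hom (Alg SET M) (X, a) (Z, c)"
      using cmp[OF * f g] by (simp add: Alg_simps(4))
    fix W d h
    show "Cmp (Alg SET M) (X, a) (Y, b) (W, d) (Cmp (Alg SET M) (Y, b) (Z, c) (W, d) h g) f =
      Cmp (Alg SET M) (X, a) (Z, c) (W, d) h (Cmp (Alg SET M) (X, a) (Y, b) (Z, c) g f)"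
      by (simp add: Alg_simps(4) compose_assoc_PiE[OF f'])
  qed
qed

lemma alg_pullback_simps:
  "(X, a) \<in> Ob (Alg SET N) \<Longrightarrow>
    FO (alg_pullback SET M N \<phi>) (X, a) = (X, compose (elts (FO (mnd_fun M) X)) a (\<phi> X))"
  "A \<in> Ob (Alg SET N) \<Longrightarrow> B \<in> Ob (Alg SET N) \<Longrightarrow> f \<in> Hom (Alg SET N) A B \<Longrightarrow>
    FM (alg_pullback SET M N \<phi>) A B f = f"
  by (simp_all add: alg_pullback_def)

text \<open>The associativity law of the structure \<open>a o \<phi>\<close> comes from the
  multiplication law of \<phi> and that of \<open>a\<close>, with naturality of \<phi> at the map
  \<open>a\<close> to exchange the two.\<close>

lemma is_functor_alg_pullback:
  assumes M: "is_monad SET M" and N: "is_monad SET N" and \<phi>: "\<phi> \<in> monad_morphisms SET M N"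
  shows "is_functor (Alg SET N) (Alg SET M) (alg_pullback SET M N \<phi>)"
proof -
  note MD = is_monad_SET_D[OF M] and SD = functor_SET_SET_D[OF is_monad_SET_D(1)[OF M]]
  note \<phi>D = monad_morphisms_SET_D[OF \<phi>] and ND = is_monad_SET_D[OF N]
  let ?S = "mnd_fun M" and ?T = "mnd_fun N"
  have ob: "(X, compose (elts (FO ?S X)) a (\<phi> X)) \<in> Ob (Alg SET M)" if "(X, a) \<in> Ob (Alg SET N)" for X a
  proof -
    have a: "a \<in> FO ?T X \<leadsto> X" "\<And>x. x \<in> elts X \<Longrightarrow> a (mnd_unit N X x) = x"
      "\<And>u. u \<in> elts (FO ?T (FO ?T X)) \<Longrightarrow> a (mnd_mult N X u) = a (FM ?T (FO ?T X) X a u)"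
      using that by (simp_all add: Alg_Ob_iff)
    have "a (\<phi> X (mnd_mult M X u)) = a (\<phi> X (FM ?S (FO ?S X) X (compose (elts (FO ?S X)) a (\<phi> X)) u))"
      if u: "u \<in> elts (FO ?S (FO ?S X))" for u
    proof -
      let ?v = "FM ?S (FO ?S X) (FO ?T X) (\<phi> X) u"
      have v: "?v \<in> elts (FO ?S (FO ?T X))" by (rule SD(2)[OF \<phi>D(1) u])
      have "a (\<phi> X (mnd_mult M X u)) = a (FM ?T (FO ?T X) X a (\<phi> (FO ?T X) ?v))"
        using \<phi>D(5)[OF u] a(3)[OF \<phi>D(2)[OF v]] by simp
      also have "FM ?T (FO ?T X) X a (\<phi> (FO ?T X) ?v) = \<phi> X (FM ?S (FO ?T X) X a ?v)"
        by (rule \<phi>D(3)[OF a(1) v, symmetric])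
      also have "FM ?S (FO ?T X) X a ?v = FM ?S (FO ?S X) X (compose (elts (FO ?S X)) a (\<phi> X)) u"
        by (rule SD(4)[OF \<phi>D(1) a(1) u, symmetric])
      finally show ?thesis .
    qed
    then show ?thesis
      using compose_PiE[OF \<phi>D(1) a(1)] MD(3,6) \<phi>D(4) SD(2)[OF compose_PiE[OF \<phi>D(1) a(1)]] a(2)
      by (simp add: Alg_Ob_iff compose_eq)
  qed
  have hom: "f \<in> Hom (Alg SET M) (X, compose (elts (FO ?S X)) a (\<phi> X)) (Y, compose (elts (FO ?S Y)) b (\<phi> Y))"
    if "f \<in> Hom (Alg SET N) (X, a) (Y, b)" for X a Y b f
    using that \<phi>D(2,3) SD(2) by (simp add: Alg_Hom_iff compose_eq)
  show ?thesis
  proof (rule is_functor_I[OF is_category_Alg[OF N] is_category_Alg[OF M]])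
    fix A assume A: "A \<in> Ob (Alg SET N)"
    obtain X a where Xa: "A = (X, a)" by (cases A)
    show "FO (alg_pullback SET M N \<phi>) A \<in> Ob (Alg SET M)"
      using A ob unfolding Xa by (simp add: alg_pullback_simps)
    show "FM (alg_pullback SET M N \<phi>) A A (Idn (Alg SET N) A) = Idn (Alg SET M) (FO (alg_pullback SET M N \<phi>) A)"
      using A is_category_D(1)[OF is_category_Alg[OF N] A] unfolding Xa by (simp add: alg_pullback_simps Alg_simps(3))
    fix B f assume B: "B \<in> Ob (Alg SET N)" and f: "f \<in> Hom (Alg SET N) A B"
    obtain Y b where Yb: "B = (Y, b)" by (cases B)
    show "FM (alg_pullback SET M N \<phi>) A B f \<in> Hom (Alg SET M) (FO (alg_pullback SET M N \<phi>) A) (FO (alg_pullback SET M N \<phi>) B)"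
      using A B f hom unfolding Xa Yb by (simp add: alg_pullback_simps)
    fix C g assume C: "C \<in> Ob (Alg SET N)" and g: "g \<in> Hom (Alg SET N) B C"
    obtain Z c where Zc: "C = (Z, c)" by (cases C)
    show "FM (alg_pullback SET M N \<phi>) A C (Cmp (Alg SET N) A B C g f) = Cmp (Alg SET M)
      (FO (alg_pullback SET M N \<phi>) A) (FO (alg_pullback SET M N \<phi>) B) (FO (alg_pullback SET M N \<phi>) C)
      (FM (alg_pullback SET M N \<phi>) B C g) (FM (alg_pullback SET M N \<phi>) A B f)"
      using A B C f g is_category_D(2)[OF is_category_Alg[OF N] A B C f g] unfolding Xa Yb Zc
      by (simp add: alg_pullback_simps Alg_simps(4))
  qed (simp_all add: alg_pullback_def)
qed

lemma Alg_functor_simps: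
  "M \<in> Ob Mnd_f \<Longrightarrow> FO Alg_functor M = Alg SET M"
  "N \<in> Ob Mnd_f \<Longrightarrow> M \<in> Ob Mnd_f \<Longrightarrow> \<phi> \<in> Hom Mnd_f M N \<Longrightarrow> FM Alg_functor N M \<phi> = alg_pullback SET M N \<phi>"
  by (simp_all add: Alg_functor_def)

lemma is_functor_Alg:
  "is_functor (op_cat (Mnd_f :: (('u::set_universe, 'u \<Rightarrow> 'u) monad, 'u \<Rightarrow> 'u \<Rightarrow> 'u) category)) CAT Alg_functor"
proof (rule is_functor_I[OF is_category_op[OF is_category_Mnd_f] is_category_CAT])
  fix L :: "('u, 'u \<Rightarrow> 'u) monad" assume "L \<in> Ob (op_cat Mnd_f)"
  then have L: "L \<in> Ob Mnd_f" and Lm: "is_monad SET L" by (simp_all add: Mnd_f_simps(1))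
  show "FO Alg_functor L \<in> Ob CAT"
    using L Lm by (simp add: Alg_functor_simps is_category_Alg)
  have idn: "Idn Mnd_f L \<in> Hom Mnd_f L L" by (rule is_category_D(1)[OF is_category_Mnd_f L])
  have "alg_pullback SET L L (Idn Mnd_f L) = ftr_id (Alg SET L)"
  proof (rule ftr_eqI[OF is_functor_alg_pullback[OF Lm Lm idn[unfolded Mnd_f_simps(2)]]
        is_functor_ftr_id[OF is_category_Alg[OF Lm]]])
    show "FO (alg_pullback SET L L (Idn Mnd_f L)) A = FO (ftr_id (Alg SET L)) A" if "A \<in> Ob (Alg SET L)" for A
      using that
      by (cases A) (simp add: alg_pullback_simps Mnd_f_simps(3), simp add: Alg_Ob_iff, elim conjE, erule compose_id_PiE(1))
  qed (simp add: alg_pullback_simps)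
  then show "FM Alg_functor L L (Idn (op_cat Mnd_f) L) = Idn CAT (FO Alg_functor L)"
    using L idn by (simp add: Alg_functor_simps)
  fix M :: "('u, 'u \<Rightarrow> 'u) monad" and \<phi> assume "M \<in> Ob (op_cat Mnd_f)" "\<phi> \<in> Hom (op_cat Mnd_f) L M"
  then have M: "M \<in> Ob Mnd_f" and Mm: "is_monad SET M" and \<phi>: "\<phi> \<in> Hom Mnd_f M L" by (simp_all add: Mnd_f_simps(1))
  show "FM Alg_functor L M \<phi> \<in> Hom CAT (FO Alg_functor L) (FO Alg_functor M)"
    using L Lm M Mm \<phi> is_functor_alg_pullback[OF Mm Lm] by (simp add: Alg_functor_simps) (simp add: Mnd_f_simps(2))
  fix N :: "('u, 'u \<Rightarrow> 'u) monad" and \<psi> assume "N \<in> Ob (op_cat Mnd_f)" "\<psi> \<in> Hom (op_cat Mnd_f) M N"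
  then have N: "N \<in> Ob Mnd_f" and Nm: "is_monad SET N" and \<psi>: "\<psi> \<in> Hom Mnd_f N M" by (simp_all add: Mnd_f_simps(1))
  have cmp: "Cmp Mnd_f N M L \<phi> \<psi> \<in> Hom Mnd_f N L"
    by (rule is_category_D(2)[OF is_category_Mnd_f N M L \<psi> \<phi>])
  note \<phi>f = is_functor_alg_pullback[OF Mm Lm \<phi>[unfolded Mnd_f_simps(2)]]
  note \<psi>f = is_functor_alg_pullback[OF Nm Mm \<psi>[unfolded Mnd_f_simps(2)]]
  have "alg_pullback SET N L (Cmp Mnd_f N M L \<phi> \<psi>) =
      ftr_comp (Alg SET L) (alg_pullback SET N M \<psi>) (alg_pullback SET M L \<phi>)"
  proof (rule ftr_eqI[OF is_functor_alg_pullback[OF Nm Lm cmp[unfolded Mnd_f_simps(2)]] is_functor_ftr_comp[OF \<phi>f \<psi>f]])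
    show "FO (alg_pullback SET N L (Cmp Mnd_f N M L \<phi> \<psi>)) A =
        FO (ftr_comp (Alg SET L) (alg_pullback SET N M \<psi>) (alg_pullback SET M L \<phi>)) A" if A: "A \<in> Ob (Alg SET L)" for A
    proof -
      obtain X a where Xa: "A = (X, a)" by (cases A)
      show ?thesis
        using A is_functor_D(7)[OF \<phi>f A] compose_assoc_PiE[OF monad_morphisms_SET_D(1)[OF \<psi>[unfolded Mnd_f_simps(2)]]]
        unfolding Xa by (simp add: alg_pullback_simps Mnd_f_simps(4))
    qed
    show "FM (alg_pullback SET N L (Cmp Mnd_f N M L \<phi> \<psi>)) A B f =
        FM (ftr_comp (Alg SET L) (alg_pullback SET N M \<psi>) (alg_pullback SET M L \<phi>)) A B f"
      if A: "A \<in> Ob (Alg SET L)" and B: "B \<in> Ob (Alg SET L)" and f: "f \<in> Hom (Alg SET L) A B" for A B f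
      using A B f is_functor_D(7)[OF \<phi>f A] is_functor_D(7)[OF \<phi>f B] is_functor_D(8)[OF \<phi>f A B f]
      by (simp add: alg_pullback_simps)
  qed
  then show "FM Alg_functor L N (Cmp (op_cat Mnd_f) L M N \<psi> \<phi>) =
      Cmp CAT (FO Alg_functor L) (FO Alg_functor M) (FO Alg_functor N) (FM Alg_functor M N \<psi>) (FM Alg_functor L M \<phi>)"
    using L M N \<phi> \<psi> cmp by (simp add: Alg_functor_simps)
qed (simp_all add: Alg_functor_def)

subsection \<open>Enriched functors and transformations into \<open>\<S>\<close>\<close>

text \<open>Enriched naturality inserts the unit through an inverse unitor. With that inverse in
  normal form over 1, the composite sends \<open>t\<close> to a single class: the unary operation
  given by \<alpha> at the element of 1, with the constant tuple \<open>\<beta> n t\<close>.\<close>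

lemma tens_map_lunit_inv:
  fixes A A' B :: "'u::set_universe presheaf"
  assumes A: "is_functor FIN SET A" and A': "is_functor FIN SET A'" and B: "is_functor FIN SET B"
    and \<alpha>: "\<alpha> \<in> nat_trans FIN SET incl B" and \<beta>: "\<beta> \<in> nat_trans FIN SET A A'"
    and n: "n \<in> Ob FIN" and t: "t \<in> elts (FO A n)"
  shows "tens_map incl B A A' \<alpha> \<beta> n (lunit_inv A n t) =
    coend_class B (FO A' n) (vnat (Suc 0)) (\<alpha> (vnat (Suc 0)) (vset {})) (\<lambda>_\<in>elts (vnat (Suc 0)). \<beta> n t)"
proof -
  have "lunit_inv A n t = coend_class incl (FO A n) (vnat (Suc 0)) (vset {}) (\<lambda>_\<in>elts (vnat (Suc 0)). t)"
    using n t by (simp add: lunit_inv_def[OF A])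
  moreover have "tens_map incl B A A' \<alpha> \<beta> n (coend_class incl (FO A n) (vnat (Suc 0)) (vset {}) (\<lambda>_\<in>elts (vnat (Suc 0)). t)) =
      coend_class B (FO A' n) (vnat (Suc 0)) (\<alpha> (vnat (Suc 0)) (vset {}))
        (compose (elts (vnat (Suc 0))) (\<beta> n) (\<lambda>_\<in>elts (vnat (Suc 0)). t))"
    by (rule tens_map_class[OF is_functor_incl B A A' \<alpha> \<beta> n vnat_FIN(1)]) (use t in \<open>simp_all add: elts_one\<close>)
  moreover have "compose (elts (vnat (Suc 0))) (\<beta> n) (\<lambda>_\<in>elts (vnat (Suc 0)). t) = (\<lambda>_\<in>elts (vnat (Suc 0) :: 'u). \<beta> n t)"
    by (simp add: compose_def cong: restrict_cong)
  ultimately show ?thesis by (simp only:)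
qed

text \<open>The mirror image: the inverse of the right unitor presents \<open>t\<close> over
  \<open>n\<close> by the identity tuple, so all of \<open>\<alpha> n\<close> enters as the
  tuple.\<close>

lemma tens_map_runit_inv:
  fixes A A' B :: "'u::set_universe presheaf"
  assumes A: "is_functor FIN SET A" and A': "is_functor FIN SET A'" and B: "is_functor FIN SET B"
    and \<alpha>: "\<alpha> \<in> nat_trans FIN SET incl B" and \<beta>: "\<beta> \<in> nat_trans FIN SET A A'"
    and n: "n \<in> Ob FIN" and t: "t \<in> elts (FO A n)"
  shows "tens_map A A' incl B \<beta> \<alpha> n (runit_inv A n t) = coend_class A' (FO B n) n (\<beta> n t) (\<alpha> n)"
proof -
  have "runit_inv A n t = coend_class A (FO incl n) n t (\<lambda>i\<in>elts n. i)"
    using n t by (simp add: runit_inv_def[OF A])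
  moreover have "tens_map A A' incl B \<beta> \<alpha> n (coend_class A (FO incl n) n t (\<lambda>i\<in>elts n. i)) =
      coend_class A' (FO B n) n (\<beta> n t) (compose (elts n) (\<alpha> n) (\<lambda>i\<in>elts n. i))"
    by (rule tens_map_class[OF A A' is_functor_incl B \<beta> \<alpha> n n t]) (use n in simp)
  moreover have "compose (elts n) (\<alpha> n) (\<lambda>i\<in>elts n. i) = \<alpha> n"
    using nat_trans_SET_D(2)[OF \<alpha> n] n by (intro compose_id_PiE(1)) simp
  ultimately show ?thesis by (simp only:)
qed

text \<open>Enriched naturality at an element: on one side a unary operation is applied to
  \<open>F t\<close>, on the other \<open>G t\<close> is applied to the tuple
  \<open>\<alpha> x n\<close>. For \<open>S_vcat\<close> these become the two sides of the
  homomorphism condition.\<close>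

lemma vnat_trans_FSet_iff:
  fixes K :: "('x, 'u::set_universe presheaf, 'u presheaf_map) vcat"
    and L :: "('y, 'u presheaf, 'u presheaf_map) vcat"
  assumes K: "is_vcat FSet K" and L: "is_vcat FSet L"
    and F: "is_vfunctor FSet K L F" and G: "is_vfunctor FSet K L G"
  shows "\<alpha> \<in> vnat_trans FSet K L F G \<longleftrightarrow> \<alpha> \<in> extensional (VOb K) \<and>
    (\<forall>x\<in>VOb K. \<alpha> x \<in> nat_trans FIN SET incl (VHom L (VFO F x) (VFO G x))) \<and>
    (\<forall>x\<in>VOb K. \<forall>y\<in>VOb K. \<forall>n\<in>Ob FIN. \<forall>t\<in>elts (FO (VHom K x y) n).
      VCmp L (VFO F x) (VFO F y) (VFO G y) n (coend_class (VHom L (VFO F y) (VFO G y))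
        (FO (VHom L (VFO F x) (VFO F y)) n) (vnat (Suc 0)) (\<alpha> y (vnat (Suc 0)) (vset {}))
        (\<lambda>_\<in>elts (vnat (Suc 0)). VFM F x y n t)) =
      VCmp L (VFO F x) (VFO G x) (VFO G y) n (coend_class (VHom L (VFO G x) (VFO G y))
        (FO (VHom L (VFO F x) (VFO G x)) n) n (VFM G x y n t) (\<alpha> x n)))"
proof -
  note FD = is_vfunctor_FSet_D[OF K L F] and GD = is_vfunctor_FSet_D[OF K L G]
  note KD = is_vcat_FSet_D[OF K] and LD = is_vcat_FSet_D[OF L]
  let ?H = "VHom K" and ?H' = "VHom L" and ?f = "VFO F" and ?g = "VFO G"
  have arrow: "Cmp FSet (?H x y) (tens (?H' (?f y) (?g y)) (?H' (?f x) (?f y))) (?H' (?f x) (?g y)) (VCmp L (?f x) (?f y) (?g y))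
      (Cmp FSet (?H x y) (tens incl (?H x y)) (tens (?H' (?f y) (?g y)) (?H' (?f x) (?f y)))
        (tens_map incl (?H' (?f y) (?g y)) (?H x y) (?H' (?f x) (?f y)) (\<alpha> y) (VFM F x y))
        (inv_arrow FSet (tens incl (?H x y)) (?H x y) (tens_lunit (?H x y)))) =
    Cmp FSet (?H x y) (tens (?H' (?g x) (?g y)) (?H' (?f x) (?g x))) (?H' (?f x) (?g y)) (VCmp L (?f x) (?g x) (?g y))
      (Cmp FSet (?H x y) (tens (?H x y) incl) (tens (?H' (?g x) (?g y)) (?H' (?f x) (?g x)))
        (tens_map (?H x y) (?H' (?g x) (?g y)) incl (?H' (?f x) (?g x)) (VFM G x y) (\<alpha> x))
        (inv_arrow FSet (tens (?H x y) incl) (?H x y) (tens_runit (?H x y)))) \<longleftrightarrow>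
    (\<forall>n\<in>Ob FIN. \<forall>t\<in>elts (FO (?H x y) n).
      VCmp L (?f x) (?f y) (?g y) n (coend_class (?H' (?f y) (?g y))
        (FO (?H' (?f x) (?f y)) n) (vnat (Suc 0)) (\<alpha> y (vnat (Suc 0)) (vset {}))
        (\<lambda>_\<in>elts (vnat (Suc 0)). VFM F x y n t)) =
      VCmp L (?f x) (?g x) (?g y) n (coend_class (?H' (?g x) (?g y))
        (FO (?H' (?f x) (?g x)) n) n (VFM G x y n t) (\<alpha> x n)))" (is "?l = ?r \<longleftrightarrow> ?P")
    if x: "x \<in> VOb K" and y: "y \<in> VOb K"
      and \<alpha>: "\<And>x. x \<in> VOb K \<Longrightarrow> \<alpha> x \<in> nat_trans FIN SET incl (?H' (?f x) (?g x))" for x y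
  proof -
    have l: "?l n t = VCmp L (?f x) (?f y) (?g y) n (coend_class (?H' (?f y) (?g y))
        (FO (?H' (?f x) (?f y)) n) (vnat (Suc 0)) (\<alpha> y (vnat (Suc 0)) (vset {}))
        (\<lambda>_\<in>elts (vnat (Suc 0)). VFM F x y n t))" if n: "n \<in> Ob FIN" and t: "t \<in> elts (FO (?H x y) n)" for n t
      unfolding inv_arrow_lunit[OF KD(1)[OF x y]] Cmp_FSet_apply[OF n t]
        tens_map_lunit_inv[OF KD(1)[OF x y] LD(1)[OF FD(2)[OF x] FD(2)[OF y]] LD(1)[OF FD(2)[OF y] GD(2)[OF y]]
          \<alpha>[OF y] FD(5)[OF x y] n t] ..
    have r: "?r n t = VCmp L (?f x) (?g x) (?g y) n (coend_class (?H' (?g x) (?g y))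
        (FO (?H' (?f x) (?g x)) n) n (VFM G x y n t) (\<alpha> x n))" if n: "n \<in> Ob FIN" and t: "t \<in> elts (FO (?H x y) n)" for n t
      unfolding inv_arrow_runit[OF KD(1)[OF x y]] Cmp_FSet_apply[OF n t]
        tens_map_runit_inv[OF KD(1)[OF x y] LD(1)[OF GD(2)[OF x] GD(2)[OF y]] LD(1)[OF FD(2)[OF x] GD(2)[OF x]]
          \<alpha>[OF x] GD(5)[OF x y] n t] ..
    have "?l = ?r \<longleftrightarrow> (\<forall>n\<in>Ob FIN. \<forall>t\<in>elts (FO (?H x y) n). ?l n t = ?r n t)"
      unfolding Cmp_FSet[where A = "?H x y" and \<beta> = "VCmp L _ _ _"] restrict_eq_iff compose_def
      by simp
    then show ?thesis by (simp only: l r cong: ball_cong)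
  qed
  have base: "\<alpha> \<in> (\<Pi>\<^sub>E x\<in>VOb K. nat_trans FIN SET incl (?H' (?f x) (?g x))) \<longleftrightarrow>
      \<alpha> \<in> extensional (VOb K) \<and> (\<forall>x\<in>VOb K. \<alpha> x \<in> nat_trans FIN SET incl (?H' (?f x) (?g x)))"
    unfolding PiE_iff by blast
  show ?thesis
  \<comment> \<open>The composites can be evaluated only if every \<open>\<alpha> x\<close> is a
    natural transformation; otherwise both sides of the equivalence are false.\<close>
  proof (cases "\<forall>x\<in>VOb K. \<alpha> x \<in> nat_trans FIN SET incl (?H' (?f x) (?g x))")
    case True
    then show ?thesis
      unfolding vnat_trans_def Let_def FSet_simps mem_Collect_eq base
      by (simp only: arrow[OF _ _ bspec[OF True]] conj_assoc cong: ball_cong)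
  next
    case False
    then show ?thesis
      unfolding vnat_trans_def Let_def FSet_simps mem_Collect_eq base by blast
  qed
qed

lemma vfun_cat_simps:
  "Ob (vfun_cat FSet K L) = {F. is_vfunctor FSet K L F}"
  "Hom (vfun_cat FSet K L) = vnat_trans FSet K L"
  "Idn (vfun_cat FSet K L) F = (\<lambda>x\<in>VOb K. VIdn L (VFO F x))"
  by (simp_all add: vfun_cat_def Let_def)

text \<open>By the Yoneda lemma, maps from \<open>incl\<close>, which is represented by \<open>1\<close>, to \<open>S_hom X Y\<close>
  correspond to functions from \<open>X\<close> to \<open>Y\<close>.\<close>

definition S_elem :: "'u::set_universe \<Rightarrow> ('u \<Rightarrow> 'u) \<Rightarrow> 'u presheaf_map" where
  "S_elem X f = (\<lambda>n\<in>Ob FIN. \<lambda>j\<in>elts n. vlam (vexp n X) (\<lambda>x. f (vapp x j)))"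

lemma S_elem_apply [simp]:
  "n \<in> Ob FIN \<Longrightarrow> j \<in> elts n \<Longrightarrow> S_elem X f n j = vlam (vexp n X) (\<lambda>x. f (vapp x j))"
  by (simp add: S_elem_def)

lemma S_elem_vlam_in:
  assumes "f \<in> X \<leadsto> Y" "j \<in> elts n"
  shows "vlam (vexp n X) (\<lambda>x. f (vapp x j)) \<in> elts (vexp (vexp n X) Y)"
  by (rule vlam_in_vexp, rule PiE_app[OF assms(1)], rule vapp_in[OF _ assms(2)])

lemma S_elem_in:
  assumes f: "f \<in> X \<leadsto> Y"
  shows "S_elem X f \<in> nat_trans FIN SET incl (S_hom X Y)"
proof (rule nat_trans_SET_I[OF is_functor_incl is_functor_S_hom])
  show "S_elem X f n \<in> FO incl n \<leadsto> FO (S_hom X Y) n" if "n \<in> Ob FIN" for n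
    using that S_elem_vlam_in[OF f] by (simp add: S_elem_def)
  show "S_elem X f n (FM incl m n s j) = FM (S_hom X Y) m n s (S_elem X f m j)"
    if "m \<in> Ob FIN" "n \<in> Ob FIN" "s \<in> Hom FIN m n" "j \<in> elts (FO incl m)" for m n s j
  proof -
    have s: "s \<in> m \<leadsto> n" and j: "j \<in> elts m" using that by simp_all
    show ?thesis
      using that S_elem_vlam_in[OF f j] PiE_app[OF s j] vlam_reindex_in[OF s]
      by (simp add: vapp_vlam cong: vlam_cong)
  qed
qed (simp add: S_elem_def)

lemma const_in_vexp: "y \<in> elts X \<Longrightarrow> vlam n (\<lambda>_. y) \<in> elts (vexp n X)"
  by (rule vlam_in_vexp)

text \<open>Evaluation at the element of 1 and at a constant tuple recovers \<open>f\<close>. This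
  gives injectivity in the Yoneda lemma and also tells how a unary operation acts when enriched
  transformations are composed.\<close>

lemma S_elem_value:
  fixes X :: "'u::set_universe"
  assumes "y \<in> elts X"
  shows "vapp (S_elem X f (vnat (Suc 0)) (vset {})) (vlam (vnat (Suc 0)) (\<lambda>_. y)) = f y"
  using const_in_vexp[OF assms] by (simp add: elts_one vapp_vlam)

lemma S_elem_inject:
  assumes "f \<in> elts X \<rightarrow>\<^sub>E Y" "g \<in> elts X \<rightarrow>\<^sub>E Z" "S_elem X f = S_elem X g"
  shows "f = g"
proof (rule PiE_eqI[OF assms(1,2)])
  fix x assume "x \<in> elts X"
  from S_elem_value[OF this, of f] S_elem_value[OF this, of g] show "f x = g x"
    by (simp only: assms(3))
qed

lemma S_elem_surj:
  fixes X Y :: "'u::set_universe"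
  assumes \<alpha>: "\<alpha> \<in> nat_trans FIN SET incl (S_hom X Y)"
  obtains f where "f \<in> X \<leadsto> Y" "\<alpha> = S_elem X f"
proof
  let ?one = "vnat (Suc 0) :: 'u" and ?i = "vset {} :: 'u"
  \<comment> \<open>Read \<alpha> at the universal element, that of the cardinal 1, and identify the
    power of \<open>X\<close> by 1 with \<open>X\<close> through constant tuples.\<close>
  let ?f = "\<lambda>y\<in>elts X. vapp (\<alpha> ?one ?i) (vlam ?one (\<lambda>_. y))"
  have i: "?i \<in> elts ?one" by (simp add: elts_one)
  have \<alpha>1: "\<alpha> ?one ?i \<in> elts (vexp (vexp ?one X) Y)"
    using nat_trans_SET_D(3)[OF \<alpha>, of ?one ?i] i by simp
  show f: "?f \<in> X \<leadsto> Y"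
    using vapp_in[OF \<alpha>1 const_in_vexp] by simp
  show "\<alpha> = S_elem X ?f"
  proof (rule nat_trans_SET_eqI[OF \<alpha> S_elem_in[OF f]])
    fix n j :: 'u assume n: "n \<in> Ob FIN" and "j \<in> elts (FO incl n)"
    then have j: "j \<in> elts n" by simp
    \<comment> \<open>Naturality along the map from 1 that picks \<open>j\<close> determines
      \<alpha> at \<open>j\<close>.\<close>
    let ?s = "\<lambda>_\<in>elts ?one. j"
    have s: "?s \<in> ?one \<leadsto> n" using j by simp
    have "\<alpha> n (FM incl ?one n ?s ?i) = FM (S_hom X Y) ?one n ?s (\<alpha> ?one ?i)"
      by (rule nat_trans_FIN_natural[OF \<alpha> vnat_FIN(1) n s]) (use i in simp)
    moreover have "FM incl ?one n ?s ?i = j"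
      unfolding incl_simps(2)[OF vnat_FIN(1) n s] using i by simp
    moreover have "FM (S_hom X Y) ?one n ?s (\<alpha> ?one ?i) =
        vlam (vexp n X) (\<lambda>x. vapp (\<alpha> ?one ?i) (vlam ?one (\<lambda>i. vapp x (?s i))))"
      by (rule S_hom_simps(2)[OF vnat_FIN(1) n s \<alpha>1])
    moreover have "vlam (vexp n X) (\<lambda>x. vapp (\<alpha> ?one ?i) (vlam ?one (\<lambda>i. vapp x (?s i)))) =
        vlam (vexp n X) (\<lambda>x. ?f (vapp x j))"
      using vapp_in[OF _ j] by (simp cong: vlam_cong)
    ultimately show "\<alpha> n j = S_elem X ?f n j"
      using n j by (simp only: S_elem_apply)
  qed
qed

section \<open>Algebra structures as enriched functors\<close>

lemma vlam_restrict_vapp: "b \<in> elts n \<rightarrow>\<^sub>E Y \<Longrightarrow> (\<lambda>i\<in>elts n. vapp (vlam n b) i) = b"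
  by (simp add: vapp_vlam PiE_def extensional_restrict cong: restrict_cong)

lemma vapp_tuple_in: "x \<in> elts (vexp n X) \<Longrightarrow> (\<lambda>i\<in>elts n. vapp x i) \<in> n \<leadsto> X"
  by (rule restrict_PiE_iff[THEN iffD2], intro ballI, erule (1) vapp_in)

text \<open>Elements of \<open>T n\<close> are the derived \<open>n\<close>-ary operations of the
  theory, and this is their interpretation in the algebra \<open>(X, a)\<close>. A member
  \<open>x\<close> of the power is turned back into a function on \<open>n\<close> before
  \<open>T\<close> is applied to it.\<close>

definition alg_vftr :: "('u::set_universe, 'u \<Rightarrow> 'u) monad \<Rightarrow> 'u \<Rightarrow> ('u \<Rightarrow> 'u) \<Rightarrow> ('u, 'u, 'u presheaf_map) vftr" where
  "alg_vftr M X a = \<lparr>VFO = (\<lambda>_\<in>{vset {}}. X),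
    VFM = (\<lambda>_\<in>{vset {}}. \<lambda>_\<in>{vset {}}. \<lambda>n\<in>Ob FIN. \<lambda>t\<in>elts (FO (mnd_fun M) n).
      vlam (vexp n X) (\<lambda>x. a (FM (mnd_fun M) n X (\<lambda>i\<in>elts n. vapp x i) t)))\<rparr>"

lemma alg_vftr_simps [simp]:
  "VFO (alg_vftr M X a) (vset {}) = X"
  "n \<in> Ob FIN \<Longrightarrow> t \<in> elts (FO (mnd_fun M) n) \<Longrightarrow> VFM (alg_vftr M X a) (vset {}) (vset {}) n t =
    vlam (vexp n X) (\<lambda>x. a (FM (mnd_fun M) n X (\<lambda>i\<in>elts n. vapp x i) t))"
  by (simp_all add: alg_vftr_def)

context
  fixes M :: "('u::set_universe, 'u \<Rightarrow> 'u) monad"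
  assumes M: "is_monad SET M" and fin: "finitary (mnd_fun M)"
begin

lemma alg_vftr_value:
  assumes "n \<in> Ob FIN" "t \<in> elts (FO (mnd_fun M) n)" "b \<in> n \<leadsto> X"
  shows "vapp (VFM (alg_vftr M X a) (vset {}) (vset {}) n t) (vlam n b) = a (FM (mnd_fun M) n X b t)"
proof -
  have "vlam n b \<in> elts (vexp n X)" by (rule vlam_in_vexp) (rule PiE_app[OF assms(3)])
  then show ?thesis
    using assms(1,2) by (simp add: vapp_vlam vlam_restrict_vapp[OF assms(3)])
qed

lemma alg_vftr_hom_in:
  assumes a: "a \<in> FO (mnd_fun M) X \<leadsto> X" and t: "t \<in> elts (FO (mnd_fun M) n)"
  shows "vlam (vexp n X) (\<lambda>x. a (FM (mnd_fun M) n X (\<lambda>i\<in>elts n. vapp x i) t)) \<in> elts (vexp (vexp n X) X)"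
  by (rule vlam_in_vexp, rule PiE_app[OF a],
      rule functor_SET_SET_D(2)[OF is_monad_SET_D(1)[OF M] vapp_tuple_in t])

text \<open>The unit law of the algebra makes projections act as projections; its associativity law
  makes substituted operations act by composition.\<close>

lemma is_vfunctor_alg_vftr:
  assumes "(X, a) \<in> Ob (Alg SET M)"
  shows "is_vfunctor FSet (Sigma_vcat M) S_vcat (alg_vftr M X a)"
proof (rule is_vfunctor_FSet_I[OF is_vcat_Sigma[OF M] is_vcat_S])
  note MD = is_monad_SET_D[OF M] and TD = functor_SET_SET_D[OF is_monad_SET_D(1)[OF M]]
  let ?T = "mnd_fun M" and ?F = "VFM (alg_vftr M X a) (vset {}) (vset {})"
  have a: "a \<in> FO ?T X \<leadsto> X" and a1: "\<And>x. x \<in> elts X \<Longrightarrow> a (mnd_unit M X x) = x"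
    and a2: "\<And>u. u \<in> elts (FO ?T (FO ?T X)) \<Longrightarrow> a (mnd_mult M X u) = a (FM ?T (FO ?T X) X a u)"
    using assms by (simp_all add: Alg_Ob_iff)
  have F: "?F \<in> nat_trans FIN SET (restrict_to_FIN M) (S_hom X X)"
  proof (rule nat_trans_SET_I[OF is_functor_restrict_to_FIN[OF M] is_functor_S_hom])
    show "?F n \<in> FO (restrict_to_FIN M) n \<leadsto> FO (S_hom X X) n" if "n \<in> Ob FIN" for n
      using that alg_vftr_hom_in[OF a] by (simp add: alg_vftr_def)
    fix m n s t assume m: "m \<in> Ob FIN" and n: "n \<in> Ob FIN" and "s \<in> Hom FIN m n" "t \<in> elts (FO (restrict_to_FIN M) m)"
    then have s: "s \<in> m \<leadsto> n" and t: "t \<in> elts (FO ?T m)" by simp_all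
    have "vlam (vexp n X) (\<lambda>x. a (FM ?T n X (\<lambda>i\<in>elts n. vapp x i) (FM ?T m n s t))) =
        vlam (vexp n X) (\<lambda>x. vapp (?F m t) (vlam m (\<lambda>i. vapp x (s i))))"
    proof (rule vlam_cong)
      fix x assume x: "x \<in> elts (vexp n X)"
      let ?b = "compose (elts m) (\<lambda>i\<in>elts n. vapp x i) s"
      have b: "?b \<in> m \<leadsto> X" by (rule compose_PiE[OF s vapp_tuple_in[OF x]])
      have "vlam m (\<lambda>i. vapp x (s i)) = vlam m ?b"
        by (rule vlam_cong) (simp add: compose_eq PiE_app[OF s])
      then have "vapp (?F m t) (vlam m (\<lambda>i. vapp x (s i))) = a (FM ?T m X ?b t)"
        using alg_vftr_value[OF m t b] by (simp only:)
      then show "a (FM ?T n X (\<lambda>i\<in>elts n. vapp x i) (FM ?T m n s t)) = vapp (?F m t) (vlam m (\<lambda>i. vapp x (s i)))"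
        using TD(4)[OF s vapp_tuple_in[OF x] t] by (simp only:)
    qed
    then show "?F n (FM (restrict_to_FIN M) m n s t) = FM (S_hom X X) m n s (?F m t)"
      using m n s t TD(2)[OF s t] alg_vftr_hom_in[OF a t] by simp
  qed (simp add: alg_vftr_def)
  then show "VFM (alg_vftr M X a) x y \<in> nat_trans FIN SET (VHom (Sigma_vcat M) x y)
      (VHom S_vcat (VFO (alg_vftr M X a) x) (VFO (alg_vftr M X a) y))"
    if "x \<in> VOb (Sigma_vcat M)" "y \<in> VOb (Sigma_vcat M)" for x y
    using that by simp
  show "VFM (alg_vftr M X a) x x n (VIdn (Sigma_vcat M) x n i) = VIdn S_vcat (VFO (alg_vftr M X a) x) n i"
    if "x \<in> VOb (Sigma_vcat M)" and n: "n \<in> Ob FIN" and i: "i \<in> elts n" for x n i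
  proof -
    have "vlam (vexp n X) (\<lambda>x. a (FM ?T n X (\<lambda>i\<in>elts n. vapp x i) (mnd_unit M n i))) = vlam (vexp n X) (\<lambda>x. vapp x i)"
    proof (rule vlam_cong)
      fix x assume x: "x \<in> elts (vexp n X)"
      have "a (FM ?T n X (\<lambda>i\<in>elts n. vapp x i) (mnd_unit M n i)) = a (mnd_unit M X ((\<lambda>i\<in>elts n. vapp x i) i))"
        by (simp only: MD(4)[OF vapp_tuple_in[OF x] i])
      then show "a (FM ?T n X (\<lambda>i\<in>elts n. vapp x i) (mnd_unit M n i)) = vapp x i"
        using i a1[OF vapp_in[OF x i]] by simp
    qed
    then show ?thesis using that MD(3)[OF i] by simp
  qed
  fix x y z and n m :: 'u and t b
  assume o: "x \<in> VOb (Sigma_vcat M)" "y \<in> VOb (Sigma_vcat M)" "z \<in> VOb (Sigma_vcat M)"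
    and n: "n \<in> Ob FIN" and m: "m \<in> Ob FIN" and "t \<in> elts (FO (VHom (Sigma_vcat M) y z) m)"
    "b \<in> m \<leadsto> FO (VHom (Sigma_vcat M) x y) n"
  then have t: "t \<in> elts (FO ?T m)" and b: "b \<in> m \<leadsto> FO ?T n" by simp_all
  have Fb: "compose (elts m) (?F n) b \<in> m \<leadsto> vexp (vexp n X) X"
    by (rule compose_in_PiE[OF b]) (simp add: n alg_vftr_hom_in[OF a])
  have "vlam (vexp n X) (\<lambda>x. a (FM ?T n X (\<lambda>i\<in>elts n. vapp x i) (mnd_mult M n (FM ?T m (FO ?T n) b t)))) =
      vlam (vexp n X) (\<lambda>x. vapp (?F m t) (vlam m (\<lambda>j. vapp (compose (elts m) (?F n) b j) x)))"
  proof (rule vlam_cong)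
    fix x assume x: "x \<in> elts (vexp n X)"
    let ?x = "\<lambda>i\<in>elts n. vapp x i"
    note px = vapp_tuple_in[OF x]
    let ?c = "compose (elts m) a (compose (elts m) (FM ?T n X ?x) b)"
    have xb: "compose (elts m) (FM ?T n X ?x) b \<in> m \<leadsto> FO ?T X"
      by (rule compose_PiE[OF b TD(1)[OF px]])
    have c: "?c \<in> m \<leadsto> X" by (rule compose_PiE[OF xb a])
    \<comment> \<open>Push the evaluation \<open>T x\<close> through \<mu>, exchange \<mu> for
      \<open>T a\<close> by associativity of \<open>a\<close>, and collect the maps into the tuple
      \<open>?c\<close> of values.\<close>
    have "a (FM ?T n X ?x (mnd_mult M n (FM ?T m (FO ?T n) b t))) =
        a (mnd_mult M X (FM ?T (FO ?T n) (FO ?T X) (FM ?T n X ?x) (FM ?T m (FO ?T n) b t)))"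
      by (simp only: MD(7)[OF px TD(2)[OF b t]])
    also have "FM ?T (FO ?T n) (FO ?T X) (FM ?T n X ?x) (FM ?T m (FO ?T n) b t) =
        FM ?T m (FO ?T X) (compose (elts m) (FM ?T n X ?x) b) t"
      by (rule TD(4)[OF b TD(1)[OF px] t, symmetric])
    also have "a (mnd_mult M X \<dots>) = a (FM ?T (FO ?T X) X a \<dots>)"
      by (rule a2[OF TD(2)[OF xb t]])
    also have "FM ?T (FO ?T X) X a (FM ?T m (FO ?T X) (compose (elts m) (FM ?T n X ?x) b) t) = FM ?T m X ?c t"
      by (rule TD(4)[OF xb a t, symmetric])
    also have "a \<dots> = vapp (?F m t) (vlam m ?c)"
      by (rule alg_vftr_value[OF m t c, symmetric])
    also have "vlam m ?c = vlam m (\<lambda>j. vapp (compose (elts m) (?F n) b j) x)"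
      by (rule vlam_cong) (simp add: compose_eq n PiE_app[OF b] vapp_vlam x)
    finally show "a (FM ?T n X ?x (mnd_mult M n (FM ?T m (FO ?T n) b t))) =
      vapp (?F m t) (vlam m (\<lambda>j. vapp (compose (elts m) (?F n) b j) x))" .
  qed
  then show "VFM (alg_vftr M X a) x z n (VCmp (Sigma_vcat M) x y z n
        (coend_class (VHom (Sigma_vcat M) y z) (FO (VHom (Sigma_vcat M) x y) n) m t b)) =
      VCmp S_vcat (VFO (alg_vftr M X a) x) (VFO (alg_vftr M X a) y) (VFO (alg_vftr M X a) z) n
        (coend_class (VHom S_vcat (VFO (alg_vftr M X a) y) (VFO (alg_vftr M X a) z))
        (FO (VHom S_vcat (VFO (alg_vftr M X a) x) (VFO (alg_vftr M X a) y)) n) m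
        (VFM (alg_vftr M X a) y z m t) (compose (elts m) (VFM (alg_vftr M X a) x y n) b))"
    using o n m t b Fb alg_vftr_hom_in[OF a t] MD(6)[OF TD(2)[OF b t]]
    by (simp add: Sigma_VCmp_class[OF M])
qed (simp_all add: alg_vftr_def)

text \<open>The carrier is the object part. The structure map is read off at tuples, which suffices
  since each element of \<open>T X\<close> has the form \<open>T c t\<close>.\<close>

lemma alg_vftr_inject:
  assumes "(X, a) \<in> Ob (Alg SET M)" "(Y, b) \<in> Ob (Alg SET M)" "alg_vftr M X a = alg_vftr M Y b"
  shows "X = Y \<and> a = b"
proof
  show XY: "X = Y" using arg_cong[OF assms(3), of "\<lambda>F. VFO F (vset {})"] by simp
  have a: "a \<in> FO (mnd_fun M) X \<leadsto> X" and b: "b \<in> FO (mnd_fun M) X \<leadsto> X"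
    using assms XY by (simp_all add: Alg_Ob_iff)
  show "a = b"
  proof (rule finitary_ext[OF fin a b])
    fix m t c assume "m \<in> Ob FIN" "t \<in> elts (FO (mnd_fun M) m)" "c \<in> m \<leadsto> X"
    then show "a (FM (mnd_fun M) m X c t) = b (FM (mnd_fun M) m X c t)"
      using assms(3) unfolding XY by (simp flip: alg_vftr_value)
  qed
qed

text \<open>A structure map must satisfy \<open>a (T b t) = \<alpha> t b\<close>, and naturality of
  \<alpha> is the reindexing condition under which such a map exists. The laws follow the route
  taken for monad morphisms: the unit law from the cardinal 1, associativity after tracing an
  element of \<open>T (T X)\<close> back to some \<open>T (T n)\<close>.\<close>

lemma alg_vftr_surj:
  assumes F: "is_vfunctor FSet (Sigma_vcat M) S_vcat F"
  obtains X a where "(X, a) \<in> Ob (Alg SET M)" "alg_vftr M X a = F"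
proof -
  note MD = is_monad_SET_D[OF M] and TD = functor_SET_SET_D[OF is_monad_SET_D(1)[OF M]]
  note FD = is_vfunctor_FSet_D[OF is_vcat_Sigma[OF M] is_vcat_S F]
  let ?T = "mnd_fun M"
  define X where "X = VFO F (vset {})"
  define \<alpha> where "\<alpha> = VFM F (vset {}) (vset {})"
  have \<alpha>: "\<alpha> \<in> nat_trans FIN SET (restrict_to_FIN M) (S_hom X X)"
    using FD(5)[of "vset {}" "vset {}"] by (simp add: \<alpha>_def X_def)
  have \<alpha>1: "\<alpha> n t \<in> elts (vexp (vexp n X) X)" if "n \<in> Ob FIN" "t \<in> elts (FO ?T n)" for n t
    using nat_trans_SET_D(3)[OF \<alpha> that(1)] that by simp
  have \<alpha>2: "\<alpha> n (FM ?T m n s t) = vlam (vexp n X) (\<lambda>x. vapp (\<alpha> m t) (vlam m (\<lambda>i. vapp x (s i))))"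
    if "n \<in> Ob FIN" "m \<in> Ob FIN" "s \<in> m \<leadsto> n" "t \<in> elts (FO ?T m)" for n m s t
    using nat_trans_FIN_natural[OF \<alpha> that(2,1,3)] that \<alpha>1 by simp
  have \<alpha>3: "\<alpha> n (mnd_unit M n i) = vlam (vexp n X) (\<lambda>x. vapp x i)" if "n \<in> Ob FIN" "i \<in> elts n" for n i
    using FD(6)[of "vset {}" n i] that by (simp add: \<alpha>_def X_def)
  have \<alpha>4: "\<alpha> n (mnd_mult M n (FM ?T m (FO ?T n) b t)) =
      vlam (vexp n X) (\<lambda>x. vapp (\<alpha> m t) (vlam m (\<lambda>j. vapp (\<alpha> n (b j)) x)))"
    if n: "n \<in> Ob FIN" "m \<in> Ob FIN" and t: "t \<in> elts (FO ?T m)" and b: "b \<in> m \<leadsto> FO ?T n" for n m t b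
  proof -
    have \<alpha>b: "compose (elts m) (\<alpha> n) b \<in> m \<leadsto> vexp (vexp n X) X"
      by (rule compose_in_PiE[OF b]) (rule \<alpha>1[OF n(1)])
    show ?thesis
      using FD(7)[of "vset {}" "vset {}" "vset {}" n m t b] n t b \<alpha>b \<alpha>1[OF n(2) t]
      by (simp add: \<alpha>_def[symmetric] X_def[symmetric] Sigma_VCmp_class[OF M] compose_eq cong: vlam_cong)
  qed
  have tuple: "vlam m b \<in> elts (vexp m X)" if "b \<in> m \<leadsto> X" for m b
    by (rule vlam_in_vexp) (rule PiE_app[OF that])
  have "\<exists>a\<in>FO ?T X \<leadsto> X. \<forall>m\<in>Ob FIN. \<forall>t\<in>elts (FO ?T m). \<forall>b\<in>m \<leadsto> X.
      a (FM ?T m X b t) = vapp (\<alpha> m t) (vlam m b)"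
  proof (rule finitary_lift[OF fin, where h = "\<lambda>m t b. vapp (\<alpha> m t) (vlam m b)"])
    show "vapp (\<alpha> m t) (vlam m b) \<in> elts X" if "m \<in> Ob FIN" "t \<in> elts (FO ?T m)" "b \<in> m \<leadsto> X" for m t b
      by (rule vapp_in[OF \<alpha>1[OF that(1,2)] tuple[OF that(3)]])
    show "vapp (\<alpha> m t) (vlam m (compose (elts m) b s)) = vapp (\<alpha> m' (FM ?T m m' s t)) (vlam m' b)"
      if "m \<in> Ob FIN" "m' \<in> Ob FIN" "s \<in> m \<leadsto> m'" "t \<in> elts (FO ?T m)" "b \<in> m' \<leadsto> X" for m m' s t b
      using tuple[OF that(5)] PiE_app[OF that(3)] that by (simp add: \<alpha>2 vapp_vlam compose_eq cong: vlam_cong)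
  qed
  then obtain a where a: "a \<in> FO ?T X \<leadsto> X"
    and a_rep: "\<And>m t b. m \<in> Ob FIN \<Longrightarrow> t \<in> elts (FO ?T m) \<Longrightarrow> b \<in> m \<leadsto> X \<Longrightarrow>
      a (FM ?T m X b t) = vapp (\<alpha> m t) (vlam m b)" by metis
  have "a (mnd_unit M X x) = x" if x: "x \<in> elts X" for x
  proof -
    let ?one = "vnat (Suc 0) :: 'u" and ?i = "vset {} :: 'u" and ?x = "\<lambda>_\<in>elts (vnat (Suc 0)). x"
    have i: "?i \<in> elts ?one" by (simp add: elts_one)
    have px: "?x \<in> ?one \<leadsto> X" using x by simp
    have "a (mnd_unit M X (?x ?i)) = vapp (vlam (vexp ?one X) (\<lambda>x. vapp x ?i)) (vlam ?one ?x)"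
      unfolding MD(4)[OF px i] a_rep[OF vnat_FIN(1) MD(3)[OF i] px] \<alpha>3[OF vnat_FIN(1) i] ..
    then show ?thesis using i tuple[OF px] by (simp add: vapp_vlam)
  qed
  moreover have "a (mnd_mult M X u) = a (FM ?T (FO ?T X) X a u)" if u: "u \<in> elts (FO ?T (FO ?T X))" for u
  proof -
    obtain m t b where m: "m \<in> Ob FIN" "t \<in> elts (FO ?T m)" "b \<in> m \<leadsto> FO ?T X"
      and u_eq: "u = FM ?T m (FO ?T X) b t"
      using finitary_rep[OF fin u] by metis
    obtain n c b' where n: "n \<in> Ob FIN" "c \<in> n \<leadsto> X" "b' \<in> m \<leadsto> FO ?T n"
      and b_eq: "b = compose (elts m) (FM ?T n X c) b'"
      using finitary_rep_family[OF fin m(1,3)] by metis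
    \<comment> \<open>\<open>u\<close> now comes from \<open>T (T n)\<close>, so
      \<open>\<alpha>4\<close>, the composition axiom of \<open>F\<close>, evaluates the
      multiplication at the tuple \<open>c\<close>.\<close>
    have "u = FM ?T (FO ?T n) (FO ?T X) (FM ?T n X c) (FM ?T m (FO ?T n) b' t)"
      unfolding u_eq b_eq by (rule TD(4)[OF n(3) TD(1)[OF n(2)] m(2)])
    then have "a (mnd_mult M X u) = a (FM ?T n X c (mnd_mult M n (FM ?T m (FO ?T n) b' t)))"
      using MD(7)[OF n(2) TD(2)[OF n(3) m(2)]] by simp
    also have "\<dots> = vapp (\<alpha> n (mnd_mult M n (FM ?T m (FO ?T n) b' t))) (vlam n c)"
      by (rule a_rep[OF n(1) MD(6)[OF TD(2)[OF n(3) m(2)]] n(2)])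
    also have "\<dots> = vapp (\<alpha> m t) (vlam m (\<lambda>j. vapp (\<alpha> n (b' j)) (vlam n c)))"
      by (simp add: \<alpha>4[OF n(1) m(1,2) n(3)] vapp_vlam tuple[OF n(2)])
    also have "vlam m (\<lambda>j. vapp (\<alpha> n (b' j)) (vlam n c)) = vlam m (compose (elts m) a b)"
      unfolding b_eq by (rule vlam_cong) (simp add: compose_eq a_rep n PiE_app[OF n(3)])
    also have "vapp (\<alpha> m t) (vlam m (compose (elts m) a b)) = a (FM ?T m X (compose (elts m) a b) t)"
      by (rule a_rep[OF m(1,2) compose_PiE[OF m(3) a], symmetric])
    also have "FM ?T m X (compose (elts m) a b) t = FM ?T (FO ?T X) X a u"
      unfolding u_eq by (rule TD(4)[OF m(3) a m(2)])
    finally show ?thesis .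
  qed
  ultimately have ob: "(X, a) \<in> Ob (Alg SET M)" using a by (simp add: Alg_Ob_iff)
  moreover have "alg_vftr M X a = F"
  proof (rule vftr_eqI[of _ "{vset {}}"])
    have "VFM (alg_vftr M X a) (vset {}) (vset {}) = \<alpha>"
    proof (rule nat_trans_SET_eqI[OF _ \<alpha>])
      show "VFM (alg_vftr M X a) (vset {}) (vset {}) \<in> nat_trans FIN SET (restrict_to_FIN M) (S_hom X X)"
        using is_vfunctor_FSet_D(5)[OF is_vcat_Sigma[OF M] is_vcat_S is_vfunctor_alg_vftr[OF ob], of "vset {}" "vset {}"]
        by simp
      fix n t assume n: "n \<in> Ob FIN" and "t \<in> elts (FO (restrict_to_FIN M) n)"
      then have t: "t \<in> elts (FO ?T n)" by simp
      have "vlam (vexp n X) (\<lambda>x. a (FM ?T n X (\<lambda>i\<in>elts n. vapp x i) t)) = vlam (vexp n X) (vapp (\<alpha> n t))"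
      proof (rule vlam_cong)
        fix x assume x: "x \<in> elts (vexp n X)"
        have "vlam n (\<lambda>i\<in>elts n. vapp x i) = x"
          using vlam_vapp[OF x] by (simp cong: vlam_cong)
        then show "a (FM ?T n X (\<lambda>i\<in>elts n. vapp x i) t) = vapp (\<alpha> n t) x"
          unfolding a_rep[OF n t vapp_tuple_in[OF x]] by (simp only:)
      qed
      then show "VFM (alg_vftr M X a) (vset {}) (vset {}) n t = \<alpha> n t"
        using n t vlam_vapp[OF \<alpha>1[OF n t]] by simp
    qed
    then show "VFM (alg_vftr M X a) x y = VFM F x y" if "x \<in> {vset {}}" "y \<in> {vset {}}" for x y
      using that by (simp add: \<alpha>_def)
  qed (use FD(1-4) in \<open>simp_all add: alg_vftr_def PiE_def X_def\<close>)
  ultimately show ?thesis by (rule that)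
qed

end

section \<open>The comparison isomorphism\<close>

definition alg_iso :: "('u::set_universe, 'u \<Rightarrow> 'u) monad
    \<Rightarrow> ('u \<times> ('u \<Rightarrow> 'u), 'u \<Rightarrow> 'u, ('u, 'u, 'u presheaf_map) vftr, 'u \<Rightarrow> 'u presheaf_map) ftr" where
  "alg_iso M = \<lparr>FO = (\<lambda>(X, a)\<in>Ob (Alg SET M). alg_vftr M X a),
    FM = (\<lambda>A\<in>Ob (Alg SET M). \<lambda>B\<in>Ob (Alg SET M). \<lambda>f\<in>Hom (Alg SET M) A B. \<lambda>_\<in>{vset {}}. S_elem (fst A) f)\<rparr>"

lemma alg_iso_simps:
  "(X, a) \<in> Ob (Alg SET M) \<Longrightarrow> FO (alg_iso M) (X, a) = alg_vftr M X a"
  "(X, a) \<in> Ob (Alg SET M) \<Longrightarrow> B \<in> Ob (Alg SET M) \<Longrightarrow> f \<in> Hom (Alg SET M) (X, a) B \<Longrightarrow>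
    FM (alg_iso M) (X, a) B f = (\<lambda>_\<in>{vset {}}. S_elem X f)"
  by (simp_all add: alg_iso_def)

text \<open>Vertical composition evaluates the unary operation of \<open>g\<close> at a constant
  tuple of values of \<open>f\<close>, so under the Yoneda correspondence it is composition of
  functions.\<close>

lemma vfun_cat_Cmp_S_elem:
  fixes X Y Z :: "'u::set_universe"
  assumes f: "f \<in> X \<leadsto> Y" and g: "g \<in> Y \<leadsto> Z"
    and FGH: "VFO F (vset {}) = X" "VFO G (vset {}) = Y" "VFO H (vset {}) = Z"
  shows "Cmp (vfun_cat FSet (Sigma_vcat M) S_vcat) F G H (\<lambda>_\<in>{vset {}}. S_elem Y g) (\<lambda>_\<in>{vset {}}. S_elem X f) =
    (\<lambda>_\<in>{vset {}}. S_elem X (compose (elts X) g f))"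
proof -
  let ?one = "vnat (Suc 0) :: 'u"
  have one: "vset {} \<in> elts ?one" by (simp add: elts_one)
  have "Cmp FSet incl (tens (S_hom Y Z) (S_hom X Y)) (S_hom X Z) (VCmp S_vcat X Y Z)
      (Cmp FSet incl (tens incl incl) (tens (S_hom Y Z) (S_hom X Y))
        (tens_map incl (S_hom Y Z) incl (S_hom X Y) (S_elem Y g) (S_elem X f))
        (inv_arrow FSet (tens incl incl) incl (tens_lunit incl))) = S_elem X (compose (elts X) g f)"
  proof (rule Cmp_FSet_eqI'[OF S_elem_in[OF compose_PiE[OF f g]]])
    fix n j :: 'u assume n: "n \<in> Ob FIN" and j': "j \<in> elts (FO incl n)"
    then have j: "j \<in> elts n" by simp
    have fj: "(\<lambda>_\<in>elts ?one. S_elem X f n j) \<in> ?one \<leadsto> vexp (vexp n X) Y"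
      using S_elem_vlam_in[OF f j] n j by simp
    have "VCmp S_vcat X Y Z n (Cmp FSet incl (tens incl incl) (tens (S_hom Y Z) (S_hom X Y))
        (tens_map incl (S_hom Y Z) incl (S_hom X Y) (S_elem Y g) (S_elem X f)) (lunit_inv incl) n j) =
      VCmp S_vcat X Y Z n (coend_class (S_hom Y Z) (vexp (vexp n X) Y) ?one (S_elem Y g ?one (vset {}))
        (\<lambda>_\<in>elts ?one. S_elem X f n j))"
      unfolding Cmp_FSet_apply[OF n j'] tens_map_lunit_inv[OF is_functor_incl is_functor_S_hom is_functor_S_hom
          S_elem_in[OF g] S_elem_in[OF f] n j'] S_hom_simps(1)[OF n] ..
    also have "\<dots> = vlam (vexp n X) (\<lambda>x. vapp (S_elem Y g ?one (vset {}))
        (vlam ?one (\<lambda>i. vapp ((\<lambda>_\<in>elts ?one. S_elem X f n j) i) x)))"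
      by (rule S_VCmp_class[OF n vnat_FIN(1) _ fj]) (use S_elem_vlam_in[OF g one] one in simp)
    also have "\<dots> = vlam (vexp n X) (\<lambda>x. compose (elts X) g f (vapp x j))"
    proof (rule vlam_cong)
      fix x assume x: "x \<in> elts (vexp n X)"
      have "vlam ?one (\<lambda>i. vapp ((\<lambda>_\<in>elts ?one. S_elem X f n j) i) x) = vlam ?one (\<lambda>_. f (vapp x j))"
        by (rule vlam_cong) (simp add: n j vapp_vlam x)
      then show "vapp (S_elem Y g ?one (vset {})) (vlam ?one (\<lambda>i. vapp ((\<lambda>_\<in>elts ?one. S_elem X f n j) i) x)) =
          compose (elts X) g f (vapp x j)"
        by (simp only: S_elem_value[OF PiE_app[OF f vapp_in[OF x j]]] compose_eq[OF vapp_in[OF x j]])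
    qed
    finally show "VCmp S_vcat X Y Z n (Cmp FSet incl (tens incl incl) (tens (S_hom Y Z) (S_hom X Y))
        (tens_map incl (S_hom Y Z) incl (S_hom X Y) (S_elem Y g) (S_elem X f))
        (inv_arrow FSet (tens incl incl) incl (tens_lunit incl)) n j) = S_elem X (compose (elts X) g f) n j"
      using n j by (simp only: inv_arrow_lunit[OF is_functor_incl] S_elem_apply)
  qed
  then show ?thesis
    by (simp add: vfun_cat_def Let_def FGH cong: restrict_cong)
qed

context
  fixes M :: "('u::set_universe, 'u \<Rightarrow> 'u) monad"
  assumes M: "is_monad SET M" and fin: "finitary (mnd_fun M)"
begin

text \<open>At \<open>t\<close> and \<open>x\<close> the two composites are
  \<open>f (a (T x t))\<close> and \<open>b (T f (T x t))\<close>. As \<open>x\<close> and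
  \<open>t\<close> vary, \<open>T x t\<close> runs through all of \<open>T X\<close>, so enriched
  naturality is exactly the homomorphism condition.\<close>

lemma S_elem_vnat_trans_iff:
  assumes A: "(X, a) \<in> Ob (Alg SET M)" and B: "(Y, b) \<in> Ob (Alg SET M)" and f: "f \<in> X \<leadsto> Y"
  shows "(\<lambda>_\<in>{vset {}}. S_elem X f) \<in> vnat_trans FSet (Sigma_vcat M) S_vcat (alg_vftr M X a) (alg_vftr M Y b) \<longleftrightarrow>
    f \<in> Hom (Alg SET M) (X, a) (Y, b)"
proof -
  note TD = functor_SET_SET_D[OF is_monad_SET_D(1)[OF M]]
  let ?T = "mnd_fun M" and ?one = "vnat (Suc 0) :: 'u"
  let ?F = "VFM (alg_vftr M X a) (vset {}) (vset {})" and ?G = "VFM (alg_vftr M Y b) (vset {}) (vset {})"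
  have a: "a \<in> FO ?T X \<leadsto> X" and b: "b \<in> FO ?T Y \<leadsto> Y"
    using A B by (simp_all add: Alg_Ob_iff)
  have one: "vset {} \<in> elts ?one" by (simp add: elts_one)
  have fx: "compose (elts n) f (\<lambda>i\<in>elts n. vapp x i) \<in> n \<leadsto> Y" if "x \<in> elts (vexp n X)" for n x
    by (rule compose_PiE[OF vapp_tuple_in[OF that] f])
  have l: "VCmp S_vcat X X Y n (coend_class (S_hom X Y) (FO (S_hom X X) n) ?one (S_elem X f ?one (vset {}))
      (\<lambda>_\<in>elts ?one. ?F n t)) = vlam (vexp n X) (\<lambda>x. f (a (FM ?T n X (\<lambda>i\<in>elts n. vapp x i) t)))"
    if n: "n \<in> Ob FIN" and t: "t \<in> elts (FO ?T n)" for n t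
  proof -
    have Ft: "(\<lambda>_\<in>elts ?one. ?F n t) \<in> ?one \<leadsto> vexp (vexp n X) X"
      using alg_vftr_hom_in[OF M fin a t] n t by simp
    have "VCmp S_vcat X X Y n (coend_class (S_hom X Y) (FO (S_hom X X) n) ?one (S_elem X f ?one (vset {}))
        (\<lambda>_\<in>elts ?one. ?F n t)) = vlam (vexp n X) (\<lambda>x. vapp (S_elem X f ?one (vset {}))
        (vlam ?one (\<lambda>i. vapp ((\<lambda>_\<in>elts ?one. ?F n t) i) x)))"
      unfolding S_hom_simps(1)[OF n]
      by (rule S_VCmp_class[OF n vnat_FIN(1) _ Ft]) (use S_elem_vlam_in[OF f one] one in simp)
    also have "\<dots> = vlam (vexp n X) (\<lambda>x. f (a (FM ?T n X (\<lambda>i\<in>elts n. vapp x i) t)))"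
    proof (rule vlam_cong)
      fix x assume x: "x \<in> elts (vexp n X)"
      have "vlam ?one (\<lambda>i. vapp ((\<lambda>_\<in>elts ?one. ?F n t) i) x) =
          vlam ?one (\<lambda>_. a (FM ?T n X (\<lambda>i\<in>elts n. vapp x i) t))"
        by (rule vlam_cong) (simp add: n t vapp_vlam x)
      then show "vapp (S_elem X f ?one (vset {})) (vlam ?one (\<lambda>i. vapp ((\<lambda>_\<in>elts ?one. ?F n t) i) x)) =
          f (a (FM ?T n X (\<lambda>i\<in>elts n. vapp x i) t))"
        by (simp only: S_elem_value[OF PiE_app[OF a TD(2)[OF vapp_tuple_in[OF x] t]]])
    qed
    finally show ?thesis .
  qed
  have r: "VCmp S_vcat X Y Y n (coend_class (S_hom Y Y) (FO (S_hom X Y) n) n (?G n t) (S_elem X f n)) =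
      vlam (vexp n X) (\<lambda>x. b (FM ?T X Y f (FM ?T n X (\<lambda>i\<in>elts n. vapp x i) t)))"
    if n: "n \<in> Ob FIN" and t: "t \<in> elts (FO ?T n)" for n t
  proof -
    have Gt: "?G n t \<in> elts (vexp (vexp n Y) Y)"
      using alg_vftr_hom_in[OF M fin b t] n t by simp
    have fn: "S_elem X f n \<in> n \<leadsto> vexp (vexp n X) Y"
      using nat_trans_SET_D(2)[OF S_elem_in[OF f] n] n by simp
    have "VCmp S_vcat X Y Y n (coend_class (S_hom Y Y) (FO (S_hom X Y) n) n (?G n t) (S_elem X f n)) =
        vlam (vexp n X) (\<lambda>x. vapp (?G n t) (vlam n (\<lambda>j. vapp (S_elem X f n j) x)))"
      unfolding S_hom_simps(1)[OF n] by (rule S_VCmp_class[OF n n Gt fn])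
    also have "\<dots> = vlam (vexp n X) (\<lambda>x. b (FM ?T X Y f (FM ?T n X (\<lambda>i\<in>elts n. vapp x i) t)))"
    proof (rule vlam_cong)
      fix x assume x: "x \<in> elts (vexp n X)"
      have "vlam n (\<lambda>j. vapp (S_elem X f n j) x) = vlam n (compose (elts n) f (\<lambda>i\<in>elts n. vapp x i))"
        by (rule vlam_cong) (simp add: n vapp_vlam x compose_eq)
      then show "vapp (?G n t) (vlam n (\<lambda>j. vapp (S_elem X f n j) x)) =
          b (FM ?T X Y f (FM ?T n X (\<lambda>i\<in>elts n. vapp x i) t))"
        by (simp only: alg_vftr_value[OF M fin n t fx[OF x]] TD(4)[OF vapp_tuple_in[OF x] f t])
    qed
    finally show ?thesis .
  qed
  have "(\<lambda>_\<in>{vset {}}. S_elem X f) \<in> vnat_trans FSet (Sigma_vcat M) S_vcat (alg_vftr M X a) (alg_vftr M Y b) \<longleftrightarrow>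
      (\<forall>n\<in>Ob FIN. \<forall>t\<in>elts (FO ?T n).
        VCmp S_vcat X X Y n (coend_class (S_hom X Y) (FO (S_hom X X) n) ?one (S_elem X f ?one (vset {})) (\<lambda>_\<in>elts ?one. ?F n t)) =
        VCmp S_vcat X Y Y n (coend_class (S_hom Y Y) (FO (S_hom X Y) n) n (?G n t) (S_elem X f n)))"
    unfolding vnat_trans_FSet_iff[OF is_vcat_Sigma[OF M] is_vcat_S is_vfunctor_alg_vftr[OF M fin A]
        is_vfunctor_alg_vftr[OF M fin B]]
    using S_elem_in[OF f] by (simp del: S_hom_simps S_elem_apply alg_vftr_simps(2) cong: ball_cong)
  also have "\<dots> \<longleftrightarrow> (\<forall>n\<in>Ob FIN. \<forall>t\<in>elts (FO ?T n).
        vlam (vexp n X) (\<lambda>x. f (a (FM ?T n X (\<lambda>i\<in>elts n. vapp x i) t))) =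
        vlam (vexp n X) (\<lambda>x. b (FM ?T X Y f (FM ?T n X (\<lambda>i\<in>elts n. vapp x i) t))))"
    by (simp only: l r cong: ball_cong)
  also have "\<dots> \<longleftrightarrow> (\<forall>u\<in>elts (FO ?T X). f (a u) = b (FM ?T X Y f u))"
  proof
    assume L: "\<forall>n\<in>Ob FIN. \<forall>t\<in>elts (FO ?T n).
        vlam (vexp n X) (\<lambda>x. f (a (FM ?T n X (\<lambda>i\<in>elts n. vapp x i) t))) =
        vlam (vexp n X) (\<lambda>x. b (FM ?T X Y f (FM ?T n X (\<lambda>i\<in>elts n. vapp x i) t)))"
    show "\<forall>u\<in>elts (FO ?T X). f (a u) = b (FM ?T X Y f u)"
    proof
      fix u assume u: "u \<in> elts (FO ?T X)"
      obtain n t c where n: "n \<in> Ob FIN" and t: "t \<in> elts (FO ?T n)" and c: "c \<in> n \<leadsto> X"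
        and u: "u = FM ?T n X c t" using finitary_rep[OF fin u] by metis
      \<comment> \<open>The tuple \<open>c\<close> is a point of the power once it is replaced by
        its graph, so the equation for \<open>t\<close> can be read at it.\<close>
      have x: "vlam n c \<in> elts (vexp n X)" by (rule vlam_in_vexp) (rule PiE_app[OF c])
      show "f (a u) = b (FM ?T X Y f u)"
        using vlam_inj[OF L[rule_format, OF n t] x] unfolding vlam_restrict_vapp[OF c] u .
    qed
  next
    assume "\<forall>u\<in>elts (FO ?T X). f (a u) = b (FM ?T X Y f u)"
    then show "\<forall>n\<in>Ob FIN. \<forall>t\<in>elts (FO ?T n).
        vlam (vexp n X) (\<lambda>x. f (a (FM ?T n X (\<lambda>i\<in>elts n. vapp x i) t))) =
        vlam (vexp n X) (\<lambda>x. b (FM ?T X Y f (FM ?T n X (\<lambda>i\<in>elts n. vapp x i) t)))"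
      using TD(2)[OF vapp_tuple_in] by (intro ballI vlam_cong) blast
  qed
  finally show ?thesis using f by (simp add: Alg_Hom_iff)
qed

lemma vnat_trans_alg_vftr_surj:
  assumes A: "(X, a) \<in> Ob (Alg SET M)" and B: "(Y, b) \<in> Ob (Alg SET M)"
    and \<alpha>: "\<alpha> \<in> vnat_trans FSet (Sigma_vcat M) S_vcat (alg_vftr M X a) (alg_vftr M Y b)"
  obtains f where "f \<in> Hom (Alg SET M) (X, a) (Y, b)" "\<alpha> = (\<lambda>_\<in>{vset {}}. S_elem X f)"
proof -
  have ext: "\<alpha> \<in> extensional {vset {}}" and "\<alpha> (vset {}) \<in> nat_trans FIN SET incl (S_hom X Y)"
    using \<alpha> unfolding vnat_trans_FSet_iff[OF is_vcat_Sigma[OF M] is_vcat_S is_vfunctor_alg_vftr[OF M fin A]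
        is_vfunctor_alg_vftr[OF M fin B]] by simp_all
  then obtain f where f: "f \<in> X \<leadsto> Y" "\<alpha> (vset {}) = S_elem X f"
    using S_elem_surj by blast
  have "\<alpha> = (\<lambda>_\<in>{vset {}}. S_elem X f)"
    by (rule extensionalityI[OF ext]) (simp_all add: f(2))
  moreover have "f \<in> Hom (Alg SET M) (X, a) (Y, b)"
    using \<alpha> S_elem_vnat_trans_iff[OF A B f(1)] calculation by simp
  ultimately show ?thesis using that by blast
qed

lemma cat_iso_alg_iso: "cat_iso (Alg SET M) (vfun_cat FSet (Sigma_vcat M) S_vcat) (alg_iso M)"
proof -
  let ?C = "Alg SET M" and ?D = "vfun_cat FSet (Sigma_vcat M) S_vcat" and ?E = "alg_iso M"
  note C = is_category_Alg[OF M]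
  have ob: "bij_betw (FO ?E) (Ob ?C) (Ob ?D)"
    unfolding vfun_cat_simps
  proof (rule bij_betwI')
    show "(FO ?E A = FO ?E B) = (A = B)" if "A \<in> Ob ?C" "B \<in> Ob ?C" for A B
      using that alg_vftr_inject[OF M fin] by (cases A; cases B) (auto simp: alg_iso_simps)
    show "FO ?E A \<in> {F. is_vfunctor FSet (Sigma_vcat M) S_vcat F}" if "A \<in> Ob ?C" for A
      using that is_vfunctor_alg_vftr[OF M fin] by (cases A) (simp add: alg_iso_simps)
    show "\<exists>A\<in>Ob ?C. F = FO ?E A" if F: "F \<in> {F. is_vfunctor FSet (Sigma_vcat M) S_vcat F}" for F
    proof -
      obtain X a where "(X, a) \<in> Ob (Alg SET M)" "alg_vftr M X a = F"
        using alg_vftr_surj[OF M fin] F by blast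
      then show ?thesis by (intro bexI[of _ "(X, a)"]) (simp_all add: alg_iso_simps)
    qed
  qed
  have hom: "bij_betw (FM ?E A B) (Hom ?C A B) (Hom ?D (FO ?E A) (FO ?E B))" if "A \<in> Ob ?C" "B \<in> Ob ?C" for A B
  proof -
    obtain X a where Xa: "A = (X, a)" by (cases A)
    obtain Y b where Yb: "B = (Y, b)" by (cases B)
    note A = that(1)[unfolded Xa] and B = that(2)[unfolded Yb]
    show ?thesis
      unfolding vfun_cat_simps Xa Yb alg_iso_simps(1)[OF A] alg_iso_simps(1)[OF B]
    proof (rule bij_betwI')
      fix f g assume f: "f \<in> Hom ?C (X, a) (Y, b)" and g: "g \<in> Hom ?C (X, a) (Y, b)"
      then have fg: "f \<in> X \<leadsto> Y" "g \<in> X \<leadsto> Y" by (simp_all add: Alg_Hom_iff)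
      show "(FM ?E (X, a) (Y, b) f = FM ?E (X, a) (Y, b) g) = (f = g)"
      proof
        assume "FM ?E (X, a) (Y, b) f = FM ?E (X, a) (Y, b) g"
        then have "(\<lambda>_\<in>{vset {} :: 'u}. S_elem X f) = (\<lambda>_\<in>{vset {}}. S_elem X g)"
          by (simp only: alg_iso_simps(2)[OF A B f] alg_iso_simps(2)[OF A B g])
        from fun_cong[OF this, of "vset {}"] show "f = g" using S_elem_inject[OF fg] by simp
      qed simp
    next
      fix f assume f: "f \<in> Hom ?C (X, a) (Y, b)"
      then have f': "f \<in> X \<leadsto> Y" by (simp add: Alg_Hom_iff)
      show "FM ?E (X, a) (Y, b) f \<in> vnat_trans FSet (Sigma_vcat M) S_vcat (alg_vftr M X a) (alg_vftr M Y b)"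
        unfolding alg_iso_simps(2)[OF A B f] S_elem_vnat_trans_iff[OF A B f'] by (rule f)
    next
      fix \<alpha> assume \<alpha>: "\<alpha> \<in> vnat_trans FSet (Sigma_vcat M) S_vcat (alg_vftr M X a) (alg_vftr M Y b)"
      obtain f where f: "f \<in> Hom ?C (X, a) (Y, b)" "\<alpha> = (\<lambda>_\<in>{vset {}}. S_elem X f)"
        by (rule vnat_trans_alg_vftr_surj[OF A B \<alpha>])
      then show "\<exists>f\<in>Hom ?C (X, a) (Y, b). \<alpha> = FM ?E (X, a) (Y, b) f"
        by (intro bexI[OF _ f(1)]) (simp only: alg_iso_simps(2)[OF A B f(1)])
    qed
  qed
  have idn: "FM ?E A A (Idn ?C A) = Idn ?D (FO ?E A)" if "A \<in> Ob ?C" for A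
  proof -
    obtain X a where Xa: "A = (X, a)" by (cases A)
    \<comment> \<open>The domain restriction in the identity function is invisible here, as every
      coordinate \<open>vapp x j\<close> lies in \<open>X\<close>.\<close>
    have "S_elem X (\<lambda>x\<in>elts X. x) = VIdn S_vcat X"
      unfolding S_elem_def S_vcat_def vcat.select_convs
      by (intro restrict_ext vlam_cong restrict_apply' vapp_in)
    then show ?thesis
      using that is_category_D(1)[OF C that] unfolding Xa
      by (simp add: alg_iso_simps Alg_simps(3) vfun_cat_simps cong: restrict_cong)
  qed
  have cmp: "FM ?E A B' (Cmp ?C A B B' g f) = Cmp ?D (FO ?E A) (FO ?E B) (FO ?E B') (FM ?E B B' g) (FM ?E A B f)"
    if o: "A \<in> Ob ?C" "B \<in> Ob ?C" "B' \<in> Ob ?C" and f: "f \<in> Hom ?C A B" and g: "g \<in> Hom ?C B B'" for A B B' f g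
  proof -
    obtain X a where Xa: "A = (X, a)" by (cases A)
    obtain Y b where Yb: "B = (Y, b)" by (cases B)
    obtain Z c where Zc: "B' = (Z, c)" by (cases B')
    have f': "f \<in> X \<leadsto> Y" and g': "g \<in> Y \<leadsto> Z"
      using f g unfolding Xa Yb Zc by (simp_all add: Alg_Hom_iff)
    show ?thesis
      using o f g is_category_D(2)[OF C o f g] unfolding Xa Yb Zc
      by (simp add: alg_iso_simps vfun_cat_Cmp_S_elem[OF f' g'] Alg_simps(4))
  qed
  \<comment> \<open>The enriched functor category has not been shown to be a category so far; it
    inherits the laws from the category of algebras through \<open>ob\<close>, \<open>hom\<close>,
    \<open>idn\<close> and \<open>cmp\<close>.\<close>
  have D: "is_category ?D"
    by (rule category_transport[OF C, of "alg_iso M"])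
      (use ob hom idn cmp in \<open>auto simp: bij_betw_def\<close>)
  have "is_functor ?C ?D ?E"
  proof (rule is_functor_I[OF C D])
    show "FO ?E A \<in> Ob ?D" if "A \<in> Ob ?C" for A
      using bij_betwE[OF ob] that by blast
    show "FM ?E A B f \<in> Hom ?D (FO ?E A) (FO ?E B)" if "A \<in> Ob ?C" "B \<in> Ob ?C" "f \<in> Hom ?C A B" for A B f
      using bij_betwE[OF hom[OF that(1,2)]] that(3) by blast
  qed (use idn cmp in \<open>simp_all add: alg_iso_def\<close>)
  then show ?thesis
    unfolding cat_iso_def fully_faithful_def using ob hom by blast
qed

end

section \<open>Naturality of the comparison\<close>

lemma vprecomp_simps:
  "F \<in> Ob (vfun_cat V K' L) \<Longrightarrow> FO (vprecomp V K K' L P) F = vftr_comp V K K' L F P"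
  "F \<in> Ob (vfun_cat V K' L) \<Longrightarrow> G \<in> Ob (vfun_cat V K' L) \<Longrightarrow> \<alpha> \<in> Hom (vfun_cat V K' L) F G \<Longrightarrow>
    FM (vprecomp V K K' L P) F G \<alpha> = (\<lambda>x\<in>VOb K. \<alpha> (VFO P x))"
  by (simp_all add: vprecomp_def)

context
  fixes M N :: "('u::set_universe, 'u \<Rightarrow> 'u) monad" and \<phi>
  assumes M: "is_monad SET M" and M_fin: "finitary (mnd_fun M)"
    and N: "is_monad SET N" and N_fin: "finitary (mnd_fun N)"
    and \<phi>: "\<phi> \<in> monad_morphisms SET M N"
begin

text \<open>Naturality of \<phi> at the tuple \<open>x\<close> turns
  \<open>a (T x (\<phi> t))\<close> into \<open>a (\<phi> (S x t))\<close>, so restricting an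
  enriched functor along \<open>Sigma_map \<phi>\<close> is restricting the algebra along \<phi>,
  with equality and not merely up to isomorphism.\<close>

lemma vftr_comp_alg_vftr:
  assumes A: "(X, a) \<in> Ob (Alg SET N)"
  shows "vftr_comp FSet (Sigma_vcat M) (Sigma_vcat N) S_vcat (alg_vftr N X a) (Sigma_map \<phi>) =
    alg_vftr M X (compose (elts (FO (mnd_fun M) X)) a (\<phi> X))"
proof (rule vftr_eqI[of _ "{vset {}}"])
  note SD = functor_SET_SET_D[OF is_monad_SET_D(1)[OF M]] and \<phi>D = monad_morphisms_SET_D[OF \<phi>]
  have "Cmp FSet (restrict_to_FIN M) (restrict_to_FIN N) (S_hom X X) (VFM (alg_vftr N X a) (vset {}) (vset {}))
      (\<lambda>n\<in>Ob FIN. \<phi> n) = VFM (alg_vftr M X (compose (elts (FO (mnd_fun M) X)) a (\<phi> X))) (vset {}) (vset {})"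
    (is "_ = ?G")
  proof (rule Cmp_FSet_eqI')
    have "(X, compose (elts (FO (mnd_fun M) X)) a (\<phi> X)) \<in> Ob (Alg SET M)"
      using is_functor_D(7)[OF is_functor_alg_pullback[OF M N \<phi>] A] by (simp add: alg_pullback_simps A)
    from is_vfunctor_FSet_D(5)[OF is_vcat_Sigma[OF M] is_vcat_S is_vfunctor_alg_vftr[OF M M_fin this],
        of "vset {}" "vset {}"]
    show "?G \<in> nat_trans FIN SET (restrict_to_FIN M) (S_hom X X)" by simp
    fix n t assume n: "n \<in> Ob FIN" and "t \<in> elts (FO (restrict_to_FIN M) n)"
    then have t: "t \<in> elts (FO (mnd_fun M) n)" by simp
    have "vlam (vexp n X) (\<lambda>x. a (FM (mnd_fun N) n X (\<lambda>i\<in>elts n. vapp x i) (\<phi> n t))) =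
        vlam (vexp n X) (\<lambda>x. compose (elts (FO (mnd_fun M) X)) a (\<phi> X) (FM (mnd_fun M) n X (\<lambda>i\<in>elts n. vapp x i) t))"
      by (rule vlam_cong) (simp only: compose_eq[OF SD(2)[OF vapp_tuple_in t]] \<phi>D(3)[OF vapp_tuple_in t])
    then show "VFM (alg_vftr N X a) (vset {}) (vset {}) n ((\<lambda>n\<in>Ob FIN. \<phi> n) n t) = ?G n t"
      using n t \<phi>D(2)[OF t] by simp
  qed
  then show "VFM (vftr_comp FSet (Sigma_vcat M) (Sigma_vcat N) S_vcat (alg_vftr N X a) (Sigma_map \<phi>)) x y =
      VFM (alg_vftr M X (compose (elts (FO (mnd_fun M) X)) a (\<phi> X))) x y" if "x \<in> {vset {}}" "y \<in> {vset {}}" for x y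
    using that by (simp add: vftr_comp_def Sigma_map_def)
qed (simp_all add: vftr_comp_def Sigma_map_def alg_vftr_def)

abbreviation (input) "precomp \<equiv> vprecomp FSet (Sigma_vcat M) (Sigma_vcat N) S_vcat (Sigma_map \<phi>)"

text \<open>The square behind strict naturality. On arrows, both ways round give the transformation
  that corresponds to the same underlying function.\<close>

lemma precomp_alg_iso:
  "A \<in> Ob (Alg SET N) \<Longrightarrow> FO precomp (FO (alg_iso N) A) = FO (alg_iso M) (FO (alg_pullback SET M N \<phi>) A)"
  "A \<in> Ob (Alg SET N) \<Longrightarrow> B \<in> Ob (Alg SET N) \<Longrightarrow> f \<in> Hom (Alg SET N) A B \<Longrightarrow>
    FM precomp (FO (alg_iso N) A) (FO (alg_iso N) B) (FM (alg_iso N) A B f) =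
    FM (alg_iso M) (FO (alg_pullback SET M N \<phi>) A) (FO (alg_pullback SET M N \<phi>) B) (FM (alg_pullback SET M N \<phi>) A B f)"
proof -
  have E: "is_functor (Alg SET N) (vfun_cat FSet (Sigma_vcat N) S_vcat) (alg_iso N)"
    using cat_iso_alg_iso[OF N N_fin] by (simp add: cat_iso_def)
  note ED = is_functor_D[OF E] and PD = is_functor_D[OF is_functor_alg_pullback[OF M N \<phi>]]
  assume A: "A \<in> Ob (Alg SET N)"
  obtain X a where Xa: "A = (X, a)" by (cases A)
  show "FO precomp (FO (alg_iso N) A) = FO (alg_iso M) (FO (alg_pullback SET M N \<phi>) A)"
    using A ED(7)[OF A] PD(7)[OF A] unfolding Xa
    by (simp add: vprecomp_simps alg_iso_simps alg_pullback_simps vftr_comp_alg_vftr)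
  assume B: "B \<in> Ob (Alg SET N)" and f: "f \<in> Hom (Alg SET N) A B"
  show "FM precomp (FO (alg_iso N) A) (FO (alg_iso N) B) (FM (alg_iso N) A B f) =
    FM (alg_iso M) (FO (alg_pullback SET M N \<phi>) A) (FO (alg_pullback SET M N \<phi>) B) (FM (alg_pullback SET M N \<phi>) A B f)"
    unfolding vprecomp_simps(2)[OF ED(7)[OF A] ED(7)[OF B] ED(8)[OF A B f]]
    using A B f PD(7)[OF A] PD(7)[OF B] PD(8)[OF A B f] unfolding Xa
    by (simp add: alg_iso_simps alg_pullback_simps Sigma_map_def cong: restrict_cong)
qed

text \<open>Under the comparison isomorphisms precomposition corresponds to restriction of algebras,
  so its functoriality is borrowed from there.\<close>

lemma is_functor_precomp:
  "is_functor (vfun_cat FSet (Sigma_vcat N) S_vcat) (vfun_cat FSet (Sigma_vcat M) S_vcat) precomp"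
proof (rule functor_transport[OF is_functor_alg_pullback[OF M N \<phi>] cat_iso_alg_iso[OF N N_fin]])
  show "is_functor (Alg SET M) (vfun_cat FSet (Sigma_vcat M) S_vcat) (alg_iso M)"
    using cat_iso_alg_iso[OF M M_fin] by (simp add: cat_iso_def)
qed (use precomp_alg_iso in \<open>simp_all add: vprecomp_def\<close>)

end

section \<open>The representable functor restricted along \<Sigma>\<close>

lemma Sigma_rep_simps:
  fixes M N :: "('u::set_universe, 'u \<Rightarrow> 'u) monad"
  defines "R \<equiv> ftr_comp (op_cat Mnd_f) (vrep FSet (S_vcat :: ('u, 'u presheaf, 'u presheaf_map) vcat)) (op_ftr Mnd_f Sigma_functor)"
  shows "M \<in> Ob Mnd_f \<Longrightarrow> FO R M = vfun_cat FSet (Sigma_vcat M) S_vcat"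
    "M \<in> Ob Mnd_f \<Longrightarrow> N \<in> Ob Mnd_f \<Longrightarrow> \<phi> \<in> Hom Mnd_f M N \<Longrightarrow>
      FM R N M \<phi> = vprecomp FSet (Sigma_vcat M) (Sigma_vcat N) S_vcat (Sigma_map \<phi>)"
proof -
  show "FO R M = vfun_cat FSet (Sigma_vcat M) S_vcat" if "M \<in> Ob Mnd_f"
    using that unfolding R_def
    by (simp add: op_ftr_def vrep_def Sigma_functor_simps VCAT_def) (simp add: Mnd_f_simps(1) is_vcat_Sigma)
  show "FM R N M \<phi> = vprecomp FSet (Sigma_vcat M) (Sigma_vcat N) S_vcat (Sigma_map \<phi>)"
    if "M \<in> Ob Mnd_f" "N \<in> Ob Mnd_f" "\<phi> \<in> Hom Mnd_f M N"
    using that is_vfunctor_Sigma_map[of M N \<phi>] unfolding R_def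
    by (simp add: op_ftr_def vrep_def Sigma_functor_simps VCAT_def)
      (simp add: Mnd_f_simps(1,2) is_vcat_Sigma)
qed

lemma is_functor_Sigma_rep:
  "is_functor (op_cat (Mnd_f :: (('u::set_universe, 'u \<Rightarrow> 'u) monad, 'u \<Rightarrow> 'u \<Rightarrow> 'u) category)) CAT
    (ftr_comp (op_cat Mnd_f) (vrep FSet S_vcat) (op_ftr Mnd_f Sigma_functor))"
    (is "is_functor _ _ ?R")
proof (rule is_functor_I[OF is_category_op[OF is_category_Mnd_f] is_category_CAT])
  \<comment> \<open>Enriched functors into \<open>S_vcat\<close> are arrows of the category of
    enriched categories, so its unit and associativity laws, unfolded here, show on objects that
    precomposition preserves identities and composites.\<close>
  note V = is_category_D[OF is_category_VCAT[where 'x = 'u and 'u = 'u], unfolded VCAT_def, simplified]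
  have S: "is_functor (Mnd_f :: (('u, 'u \<Rightarrow> 'u) monad, 'u \<Rightarrow> 'u \<Rightarrow> 'u) category) (VCAT FSet) Sigma_functor"
    by (rule is_functor_Sigma)
  fix L :: "('u, 'u \<Rightarrow> 'u) monad" assume "L \<in> Ob (op_cat Mnd_f)"
  then have L: "L \<in> Ob Mnd_f" and Lm: "is_monad SET L" "finitary (mnd_fun L)" by (simp_all add: Mnd_f_simps(1))
  note LS = is_vcat_Sigma[OF Lm(1)]
  show "FO ?R L \<in> Ob CAT"
    using cat_iso_alg_iso[OF Lm] is_functor_D(2) unfolding Sigma_rep_simps(1)[OF L] cat_iso_def by auto
  have idn: "Idn Mnd_f L \<in> Hom Mnd_f L L" by (rule is_category_D(1)[OF is_category_Mnd_f L])
  have id_eq: "Sigma_map (Idn Mnd_f L) = vftr_id FSet (Sigma_vcat L)"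
    using is_functor_D(9)[OF S L] L idn by (simp add: Sigma_functor_simps VCAT_def)
  have Lid: "is_functor (vfun_cat FSet (Sigma_vcat L) S_vcat) (vfun_cat FSet (Sigma_vcat L) S_vcat)
      (vprecomp FSet (Sigma_vcat L) (Sigma_vcat L) S_vcat (Sigma_map (Idn Mnd_f L)))"
    by (rule is_functor_precomp[OF Lm Lm idn[unfolded Mnd_f_simps(2)]])
  have "vprecomp FSet (Sigma_vcat L) (Sigma_vcat L) S_vcat (Sigma_map (Idn Mnd_f L)) =
      ftr_id (vfun_cat FSet (Sigma_vcat L) S_vcat)"
  proof (rule ftr_eqI[OF Lid is_functor_ftr_id[OF is_functor_D(1)[OF Lid]]])
    fix F assume F: "F \<in> Ob (vfun_cat FSet (Sigma_vcat L) S_vcat)"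
    then have F': "is_vfunctor FSet (Sigma_vcat L) S_vcat F" by (simp add: vfun_cat_simps)
    show "FO (vprecomp FSet (Sigma_vcat L) (Sigma_vcat L) S_vcat (Sigma_map (Idn Mnd_f L))) F =
        FO (ftr_id (vfun_cat FSet (Sigma_vcat L) S_vcat)) F"
      using F V(3)[OF LS is_vcat_S F'] by (simp add: vprecomp_simps id_eq)
    fix G \<alpha> assume G: "G \<in> Ob (vfun_cat FSet (Sigma_vcat L) S_vcat)"
      and \<alpha>: "\<alpha> \<in> Hom (vfun_cat FSet (Sigma_vcat L) S_vcat) F G"
    \<comment> \<open>A transformation is extensional on the only object, so reindexing it along the
      identity changes nothing.\<close>
    then have "\<alpha> \<in> extensional {vset {}}"
      by (simp add: vfun_cat_simps vnat_trans_def Let_def PiE_def)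
    then have "(\<lambda>x\<in>{vset {}}. \<alpha> (VFO (vftr_id FSet (Sigma_vcat L)) x)) = \<alpha>"
      by (rule extensionalityI[rotated]) (simp_all add: vftr_id_def)
    then show "FM (vprecomp FSet (Sigma_vcat L) (Sigma_vcat L) S_vcat (Sigma_map (Idn Mnd_f L))) F G \<alpha> =
        FM (ftr_id (vfun_cat FSet (Sigma_vcat L) S_vcat)) F G \<alpha>"
      using F G \<alpha> by (simp add: vprecomp_simps id_eq)
  qed
  then show "FM ?R L L (Idn (op_cat Mnd_f) L) = Idn CAT (FO ?R L)"
    unfolding op_cat_simps CAT_simps Sigma_rep_simps(1)[OF L] Sigma_rep_simps(2)[OF L L idn] .
  fix M :: "('u, 'u \<Rightarrow> 'u) monad" and \<phi> assume "M \<in> Ob (op_cat Mnd_f)" "\<phi> \<in> Hom (op_cat Mnd_f) L M"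
  then have M: "M \<in> Ob Mnd_f" and Mm: "is_monad SET M" "finitary (mnd_fun M)" and \<phi>: "\<phi> \<in> Hom Mnd_f M L"
    by (simp_all add: Mnd_f_simps(1))
  note MS = is_vcat_Sigma[OF Mm(1)]
  have \<phi>f: "is_functor (vfun_cat FSet (Sigma_vcat L) S_vcat) (vfun_cat FSet (Sigma_vcat M) S_vcat)
      (vprecomp FSet (Sigma_vcat M) (Sigma_vcat L) S_vcat (Sigma_map \<phi>))"
    by (rule is_functor_precomp[OF Mm Lm \<phi>[unfolded Mnd_f_simps(2)]])
  then show "FM ?R L M \<phi> \<in> Hom CAT (FO ?R L) (FO ?R M)"
    unfolding CAT_simps Sigma_rep_simps(1)[OF L] Sigma_rep_simps(1)[OF M] Sigma_rep_simps(2)[OF M L \<phi>] by simp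
  fix N :: "('u, 'u \<Rightarrow> 'u) monad" and \<psi> assume "N \<in> Ob (op_cat Mnd_f)" "\<psi> \<in> Hom (op_cat Mnd_f) M N"
  then have N: "N \<in> Ob Mnd_f" and Nm: "is_monad SET N" "finitary (mnd_fun N)" and \<psi>: "\<psi> \<in> Hom Mnd_f N M"
    by (simp_all add: Mnd_f_simps(1))
  note NS = is_vcat_Sigma[OF Nm(1)]
  have cmp: "Cmp Mnd_f N M L \<phi> \<psi> \<in> Hom Mnd_f N L"
    by (rule is_category_D(2)[OF is_category_Mnd_f N M L \<psi> \<phi>])
  have cmp_eq: "Sigma_map (Cmp Mnd_f N M L \<phi> \<psi>) =
      vftr_comp FSet (Sigma_vcat N) (Sigma_vcat M) (Sigma_vcat L) (Sigma_map \<phi>) (Sigma_map \<psi>)"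
    using is_functor_D(10)[OF S N M L \<psi> \<phi>] N M L \<phi> \<psi> cmp by (simp add: Sigma_functor_simps VCAT_def)
  have \<psi>f: "is_functor (vfun_cat FSet (Sigma_vcat M) S_vcat) (vfun_cat FSet (Sigma_vcat N) S_vcat)
      (vprecomp FSet (Sigma_vcat N) (Sigma_vcat M) S_vcat (Sigma_map \<psi>))"
    by (rule is_functor_precomp[OF Nm Mm \<psi>[unfolded Mnd_f_simps(2)]])
  have "vprecomp FSet (Sigma_vcat N) (Sigma_vcat L) S_vcat (Sigma_map (Cmp Mnd_f N M L \<phi> \<psi>)) =
      ftr_comp (vfun_cat FSet (Sigma_vcat L) S_vcat)
        (vprecomp FSet (Sigma_vcat N) (Sigma_vcat M) S_vcat (Sigma_map \<psi>))
        (vprecomp FSet (Sigma_vcat M) (Sigma_vcat L) S_vcat (Sigma_map \<phi>))"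
  proof (rule ftr_eqI[OF is_functor_precomp[OF Nm Lm cmp[unfolded Mnd_f_simps(2)]] is_functor_ftr_comp[OF \<phi>f \<psi>f]])
    fix F assume F: "F \<in> Ob (vfun_cat FSet (Sigma_vcat L) S_vcat)"
    then have F': "is_vfunctor FSet (Sigma_vcat L) S_vcat F" by (simp add: vfun_cat_simps)
    have \<phi>v: "is_vfunctor FSet (Sigma_vcat M) (Sigma_vcat L) (Sigma_map \<phi>)"
      by (rule is_vfunctor_Sigma_map[OF Mm(1) Lm(1) \<phi>[unfolded Mnd_f_simps(2)]])
    have \<psi>v: "is_vfunctor FSet (Sigma_vcat N) (Sigma_vcat M) (Sigma_map \<psi>)"
      by (rule is_vfunctor_Sigma_map[OF Nm(1) Mm(1) \<psi>[unfolded Mnd_f_simps(2)]])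
    show "FO (vprecomp FSet (Sigma_vcat N) (Sigma_vcat L) S_vcat (Sigma_map (Cmp Mnd_f N M L \<phi> \<psi>))) F =
      FO (ftr_comp (vfun_cat FSet (Sigma_vcat L) S_vcat)
        (vprecomp FSet (Sigma_vcat N) (Sigma_vcat M) S_vcat (Sigma_map \<psi>))
        (vprecomp FSet (Sigma_vcat M) (Sigma_vcat L) S_vcat (Sigma_map \<phi>))) F"
      using F is_functor_D(7)[OF \<phi>f F] V(5)[OF NS MS LS is_vcat_S \<psi>v \<phi>v F']
      by (simp add: vprecomp_simps cmp_eq)
    fix G \<alpha> assume G: "G \<in> Ob (vfun_cat FSet (Sigma_vcat L) S_vcat)"
      and \<alpha>: "\<alpha> \<in> Hom (vfun_cat FSet (Sigma_vcat L) S_vcat) F G"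
    show "FM (vprecomp FSet (Sigma_vcat N) (Sigma_vcat L) S_vcat (Sigma_map (Cmp Mnd_f N M L \<phi> \<psi>))) F G \<alpha> =
      FM (ftr_comp (vfun_cat FSet (Sigma_vcat L) S_vcat)
        (vprecomp FSet (Sigma_vcat N) (Sigma_vcat M) S_vcat (Sigma_map \<psi>))
        (vprecomp FSet (Sigma_vcat M) (Sigma_vcat L) S_vcat (Sigma_map \<phi>))) F G \<alpha>"
      unfolding ftr_comp_simps(2)[OF F G \<alpha>]
      unfolding vprecomp_simps(2)[OF is_functor_D(7)[OF \<phi>f F] is_functor_D(7)[OF \<phi>f G] is_functor_D(8)[OF \<phi>f F G \<alpha>]]
      unfolding vprecomp_simps(2)[OF F G \<alpha>]
      by (simp add: cmp_eq vftr_comp_def Sigma_map_def cong: restrict_cong)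
  qed
  then show "FM ?R L N (Cmp (op_cat Mnd_f) L M N \<psi> \<phi>) =
      Cmp CAT (FO ?R L) (FO ?R M) (FO ?R N) (FM ?R M N \<psi>) (FM ?R L M \<phi>)"
    unfolding op_cat_simps CAT_simps Sigma_rep_simps(1)[OF L] Sigma_rep_simps(2)[OF M L \<phi>]
      Sigma_rep_simps(2)[OF N M \<psi>] Sigma_rep_simps(2)[OF N L cmp] .
qed (simp_all add: ftr_comp_def)

theorem proposition2p5:
  shows
    "is_functor (Mnd_f :: (('u::set_universe, 'u \<Rightarrow> 'u) monad, 'u \<Rightarrow> 'u \<Rightarrow> 'u) category)
       (VCAT FSet) Sigma_functor \<and>
     fully_faithful (Mnd_f :: (('u, 'u \<Rightarrow> 'u) monad, 'u \<Rightarrow> 'u \<Rightarrow> 'u) category)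
       (VCAT FSet) Sigma_functor \<and>
     is_vcat FSet (S_vcat :: ('u, 'u presheaf, 'u presheaf_map) vcat) \<and>
     is_functor (op_cat (Mnd_f :: (('u, 'u \<Rightarrow> 'u) monad, 'u \<Rightarrow> 'u \<Rightarrow> 'u) category))
       CAT Alg_functor \<and>
     is_functor (op_cat (Mnd_f :: (('u, 'u \<Rightarrow> 'u) monad, 'u \<Rightarrow> 'u \<Rightarrow> 'u) category)) CAT
       (ftr_comp (op_cat Mnd_f) (vrep FSet S_vcat) (op_ftr Mnd_f Sigma_functor)) \<and>
     pseudonaturally_equivalent
       (op_cat (Mnd_f :: (('u, 'u \<Rightarrow> 'u) monad, 'u \<Rightarrow> 'u \<Rightarrow> 'u) category))
       Alg_functor
       (ftr_comp (op_cat Mnd_f) (vrep FSet S_vcat) (op_ftr Mnd_f Sigma_functor))"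
proof (intro conjI is_functor_Sigma fully_faithful_Sigma is_vcat_S is_functor_Alg is_functor_Sigma_rep)
  let ?C = "op_cat (Mnd_f :: (('u, 'u \<Rightarrow> 'u) monad, 'u \<Rightarrow> 'u \<Rightarrow> 'u) category)"
  let ?R = "ftr_comp ?C (vrep FSet S_vcat) (op_ftr Mnd_f Sigma_functor)"
  show "pseudonaturally_equivalent ?C Alg_functor ?R"
  proof (rule strictly_natural_pseudonaturally_equivalent[OF is_functor_Alg is_functor_Sigma_rep])
    fix N assume "N \<in> Ob ?C"
    then have N: "N \<in> Ob Mnd_f" and Nm: "is_monad SET N" "finitary (mnd_fun N)" by (simp_all add: Mnd_f_simps(1))
    show "cat_iso (FO Alg_functor N) (FO ?R N) (alg_iso N)"
      unfolding Sigma_rep_simps(1)[OF N] Alg_functor_simps(1)[OF N] by (rule cat_iso_alg_iso[OF Nm])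
    fix M \<phi> assume "M \<in> Ob ?C" "\<phi> \<in> Hom ?C N M"
    then have M: "M \<in> Ob Mnd_f" and Mm: "is_monad SET M" "finitary (mnd_fun M)"
      and \<phi>: "\<phi> \<in> Hom Mnd_f M N" and \<phi>m: "\<phi> \<in> monad_morphisms SET M N" by (simp_all add: Mnd_f_simps(1,2))
    have E: "is_functor (Alg SET K) (vfun_cat FSet (Sigma_vcat K) S_vcat) (alg_iso K)"
      if "is_monad SET K" "finitary (mnd_fun K)" for K :: "('u, 'u \<Rightarrow> 'u) monad"
      using cat_iso_alg_iso[OF that] by (simp add: cat_iso_def)
    \<comment> \<open>Strict naturality of the family \<open>alg_iso\<close>: both composites are
      already functors, so comparing their values suffices.\<close>
    have "ftr_comp (Alg SET N) (vprecomp FSet (Sigma_vcat M) (Sigma_vcat N) S_vcat (Sigma_map \<phi>)) (alg_iso N) =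
        ftr_comp (Alg SET N) (alg_iso M) (alg_pullback SET M N \<phi>)"
      by (rule ftr_eqI[OF is_functor_ftr_comp[OF E[OF Nm] is_functor_precomp[OF Mm Nm \<phi>m]]
            is_functor_ftr_comp[OF is_functor_alg_pullback[OF Mm(1) Nm(1) \<phi>m] E[OF Mm]]])
        (simp_all add: precomp_alg_iso[OF Mm Nm \<phi>m])
    then show "ftr_comp (FO Alg_functor N) (FM ?R N M \<phi>) (alg_iso N) =
        ftr_comp (FO Alg_functor N) (alg_iso M) (FM Alg_functor N M \<phi>)"
      unfolding Alg_functor_simps(1)[OF N] Alg_functor_simps(2)[OF N M \<phi>] Sigma_rep_simps(2)[OF M N \<phi>] .
  qed
qed

end
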